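(* Let $\alpha\in(0,1)$ and let $h:[0,1]\to\mathbb{R}$ be (bounded and) $\alpha$-Hölder continuous on $[0,1]$. Let $x_0\in\mathbb{R}$, $X_t=x_0+\int_0^th(s)\,dZ_s$, let $p\ge2$ be an integer, $\mu_p=\mathbf{E}Z_1^p$, and for $N\ge1$ let $$S_{N,p}(X)=\frac{2^{pHN}}{2^{[N^\gamma]}}\sum_{l=1}^{2^{[N^\gamma]}}(\Delta X_{l,N})^p.$$ Then $$S_{N,p}(X)\longrightarrow\mu_p\int_0^1h(s)^p\,ds\quad\text{in }L^1(\Omega)\text{ as }N\to\infty.$$
   Context: Fix an integer $q\ge1$ and $H\in(1/2,1)$. Let $(B(y))_{y\in\mathbb{R}}$ be a two-sided standard Brownian motion and $I_q$ the multiple Wiener-Itô integral of order $q$ with respect to $B$ (so $\mathbf{E}I_q(f)^2=q!\|f\|^2_{L^2(\mathbb{R}^q)}$ for symmetric $f$). For $u\ge 0$ put $f_u(y_1,\dots,y_q)=d(q,H)\prod_{i=1}^q(u-y_i)_+^{-(\frac12+\frac{1-H}{q})}$, where $x_+^a=x^a$ if $x>0$ and $0$ otherwise. The Hermite process of order $q$ and self-similarity index $H$ is $Z_t=I_q\left(\int_0^t f_u\,du\right)$, $t\ge0$, with $d(q,H)>0$ the constant such that $\mathbf{E}Z_t^2=t^{2H}$ for all $t\ge 0$. $[x]$ denotes the integer part of $x$. Wiener-Hermite integral: for measurable $f$ supported in $[0,\infty)$ with $\iint|f(u)||f(v)||u-v|^{2H-2}\,du\,dv<\infty$, $\int f(u)\,dZ_u=I_q\left(\int_0^\infty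 f(u)f_u\,du\right)\in L^2(\Omega)$; it is linear in $f$, sends $\mathbf{1}_{(0,t)}$ to $Z_t$, and satisfies $\mathbf{E}\left[\int f\,dZ\int g\,dZ\right]=H(2H-1)\iint f(u)g(v)|u-v|^{2H-2}\,du\,dv$. $\int_0^th(s)\,dZ_s$ means $\int h\mathbf{1}_{(0,t)}\,dZ$, where $h$ is extended by $0$ outside $[0,1]$ (so $X_t=X_1$ for $t\ge1$). Fix $\gamma\in(0,1)$. For $N\ge1$ and $l=1,\dots,2^{[N^\gamma]}$, $\Delta X_{l,N}=X_{l2^{-[N^\gamma]}+2^{-N}}-X_{l2^{-[N^\gamma]}}$. *)

theory Defs
  imports "HOL-Probability.Probability"
begin

definition two_sided_brownian_motion :: "'a measure \<Rightarrow> (real \<Rightarrow> 'a \<Rightarrow> real) \<Rightarrow> bool" where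
  "two_sided_brownian_motion M B \<longleftrightarrow>
     prob_space M \<and>
     (\<forall>t. B t \<in> borel_measurable M) \<and>
     (AE \<omega> in M. B 0 \<omega> = 0) \<and>
     (\<forall>s t. s < t \<longrightarrow>
        distributed M lborel (\<lambda>\<omega>. B t \<omega> - B s \<omega>) (normal_density 0 (sqrt (t - s)))) \<and>
     (\<forall>(m::nat) t. strict_mono_on {..m} t \<longrightarrow>
        prob_space.indep_vars M (\<lambda>_. borel) (\<lambda>i \<omega>. B (t (Suc i)) \<omega> - B (t i) \<omega>) {..<m}) \<and>
     (AE \<omega> in M. continuous_on UNIV (\<lambda>t. B t \<omega>))"

text \<open>
  Points of \<open>\<real>\<^sup>q\<close> are elements of \<open>PiM {..<q} (\<lambda>_. lborel)\<close>. An elementary kernel is constant on the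
  boxes of the grid generated by \<open>t 0 < \<dots> < t m\<close> and vanishes on every box meeting a
  diagonal, which is why only injective multi-indices occur.
\<close>

definition offdiag_indices :: "nat \<Rightarrow> nat \<Rightarrow> (nat \<Rightarrow> nat) set" where
  "offdiag_indices q m = {k \<in> {..<q} \<rightarrow>\<^sub>E {..<m}. inj_on k {..<q}}"

definition elementary_kernel ::
  "nat \<Rightarrow> nat \<Rightarrow> (nat \<Rightarrow> real) \<Rightarrow> ((nat \<Rightarrow> nat) \<Rightarrow> real) \<Rightarrow> (nat \<Rightarrow> real) \<Rightarrow> real" where
  "elementary_kernel q m t a y =
     (\<Sum>k\<in>offdiag_indices q m. a k * (\<Prod>i<q. indicator {t (k i)<..t (Suc (k i))} (y i)))"

definition elementary_integral ::
  "(real \<Rightarrow> 'a \<Rightarrow> real) \<Rightarrow> nat \<Rightarrow> nat \<Rightarrow> (nat \<Rightarrow> real) \<Rightarrow> ((nat \<Rightarrow> nat) \<Rightarrow> real) \<Rightarrow> 'a \<Rightarrow> real" where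
  "elementary_integral B q m t a \<omega> =
     (\<Sum>k\<in>offdiag_indices q m. a k * (\<Prod>i<q. B (t (Suc (k i))) \<omega> - B (t (k i)) \<omega>))"

text \<open>
  \<open>Y\<close> is a version of the integral of \<open>f\<close> if it is the limit in \<open>L\<^sup>2(\<Omega>)\<close> of integrals of elementary
  kernels converging to \<open>f\<close> in \<open>L\<^sup>2(\<real>\<^sup>q)\<close>. The kernel \<open>f\<close> need not be symmetric; replacing it by
  its symmetrization does not change the integral.
\<close>

definition has_wiener_ito_integral ::
  "'a measure \<Rightarrow> (real \<Rightarrow> 'a \<Rightarrow> real) \<Rightarrow> nat \<Rightarrow> ((nat \<Rightarrow> real) \<Rightarrow> real) \<Rightarrow> ('a \<Rightarrow> real) \<Rightarrow> bool" where
  "has_wiener_ito_integral M B q f Y \<longleftrightarrow>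
     f \<in> borel_measurable (PiM {..<q} (\<lambda>_. lborel)) \<and>
     Y \<in> borel_measurable M \<and>
     (\<exists>m t a.
        (\<forall>n::nat. strict_mono_on {..m n} (t n)) \<and>
        (\<lambda>n. \<integral>\<^sup>+ y. ennreal ((f y - elementary_kernel q (m n) (t n) (a n) y)\<^sup>2)
               \<partial>PiM {..<q} (\<lambda>_. lborel)) \<longlonglongrightarrow> 0 \<and>
        (\<lambda>n. \<integral>\<^sup>+ \<omega>. ennreal ((Y \<omega> - elementary_integral B q (m n) (t n) (a n) \<omega>)\<^sup>2) \<partial>M) \<longlonglongrightarrow> 0)"

text \<open>The integral is determined only up to almost sure equality; an arbitrary version is chosen.\<close>

definition wiener_ito_integral ::
  "'a measure \<Rightarrow> (real \<Rightarrow> 'a \<Rightarrow> real) \<Rightarrow> nat \<Rightarrow> ((nat \<Rightarrow> real) \<Rightarrow> real) \<Rightarrow> 'a \<Rightarrow> real" where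
  "wiener_ito_integral M B q f = (SOME Y. has_wiener_ito_integral M B q f Y)"

definition pos_powr :: "real \<Rightarrow> real \<Rightarrow> real" where
  "pos_powr x a = (if x > 0 then x powr a else 0)"

definition hermite_kernel :: "nat \<Rightarrow> real \<Rightarrow> real \<Rightarrow> real \<Rightarrow> (nat \<Rightarrow> real) \<Rightarrow> real" where
  "hermite_kernel q H d u y = d * (\<Prod>i<q. pos_powr (u - y i) (- (1 / 2 + (1 - H) / real q)))"

text \<open>
  The integrals over \<open>u\<close> are taken pointwise in \<open>y\<close>; on the null set of \<open>y\<close> where they diverge
  (for bounded integrands of bounded support, a subset of the union of the diagonals) they have
  the default value 0.
\<close>

definition hermite_process ::
  "'a measure \<Rightarrow> (real \<Rightarrow> 'a \<Rightarrow> real) \<Rightarrow> nat \<Rightarrow> real \<Rightarrow> real \<Rightarrow> (real \<Rightarrow> 'a \<Rightarrow> real) \<Rightarrow> bool" where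
  "hermite_process M B q H d Z \<longleftrightarrow>
     (\<forall>t\<ge>0. Z t \<in> borel_measurable M \<and>
        (AE \<omega> in M. Z t \<omega> =
           wiener_ito_integral M B q (\<lambda>y. LINT u:{0..t}|lborel. hermite_kernel q H d u y) \<omega>))"

definition wiener_hermite_integral ::
  "'a measure \<Rightarrow> (real \<Rightarrow> 'a \<Rightarrow> real) \<Rightarrow> nat \<Rightarrow> real \<Rightarrow> real \<Rightarrow> (real \<Rightarrow> real) \<Rightarrow> 'a \<Rightarrow> real" where
  "wiener_hermite_integral M B q H d f =
     wiener_ito_integral M B q (\<lambda>y. LINT u:{0..}|lborel. f u * hermite_kernel q H d u y)"

definition holder_continuous_on :: "real \<Rightarrow> real set \<Rightarrow> (real \<Rightarrow> real) \<Rightarrow> bool" where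
  "holder_continuous_on \<alpha> S h \<longleftrightarrow>
     (\<exists>C. \<forall>s\<in>S. \<forall>t\<in>S. \<bar>h s - h t\<bar> \<le> C * \<bar>s - t\<bar> powr \<alpha>)"

definition mesh_exponent :: "real \<Rightarrow> nat \<Rightarrow> nat" where
  "mesh_exponent \<gamma> N = nat \<lfloor>real N powr \<gamma>\<rfloor>"

definition increment :: "real \<Rightarrow> (real \<Rightarrow> 'a \<Rightarrow> real) \<Rightarrow> nat \<Rightarrow> nat \<Rightarrow> 'a \<Rightarrow> real" where
  "increment \<gamma> X l N \<omega> =
     X (real l / 2 ^ mesh_exponent \<gamma> N + 1 / 2 ^ N) \<omega> - X (real l / 2 ^ mesh_exponent \<gamma> N) \<omega>"

definition power_variation ::
  "real \<Rightarrow> real \<Rightarrow> nat \<Rightarrow> (real \<Rightarrow> 'a \<Rightarrow> real) \<Rightarrow> nat \<Rightarrow> 'a \<Rightarrow> real" where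
  "power_variation \<gamma> H p X N \<omega> =
     2 powr (real p * H * real N) / 2 ^ mesh_exponent \<gamma> N *
       (\<Sum>l = 1..2 ^ mesh_exponent \<gamma> N. increment \<gamma> X l N \<omega> ^ p)"

end

theory Submission
  imports Defs "HOL-Real_Asymp.Real_Asymp"
begin

text \<open>
  The rescaled increment of the integral process over \<open>[t\<^sub>l, t\<^sub>l + 2\<^bsup>-N\<^esup>]\<close> is close in \<open>L\<^sup>2\<close> to \<open>h(t\<^sub>l)\<close> times
  the rescaled increment of the Hermite process. The kernel of the latter is the rescaled and shifted kernel
  of \<open>Z\<^sub>1\<close>, so its law is that of \<open>Z\<^sub>1\<close>, and most of its \<open>L\<^sup>2\<close> mass lies in the cube over the interval of
  length \<open>2\<^bsup>-[N\<^sup>\<gamma>]\<^esup>\<close> that ends at \<open>t\<^sub>l + 2\<^bsup>-N\<^esup>\<close>, because that length is much larger than \<open>2\<^bsup>-N\<^esup>\<close>. Truncating the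
  kernels to these cubes gives independent variables, to which the weak law of large numbers applies. All
  passages from \<open>L\<^sup>2\<close> to \<open>p\<close>-th powers rest on hypercontractivity: an elementary integral is a multilinear
  polynomial in independent Gaussian variables, and for these an induction on the number of variables
  bounds the even moments by the second one.
\<close>

text \<open>The obstacle is dependence: the kernel at time u charges the whole past of u, so
  increments over disjoint intervals share Brownian noise. The assumption \<gamma> < 1 sends the
  ratio K = 2^(N-[N^\<gamma>]) of mesh to increment length to infinity, and K is the window length
  measured in increments. A bound of its moments by the kernel norm, with any constant depending
  only on q and the order, survives every limit. Independence is established for elementary
  integrals only; what passes to the limit is the factorisation of p-th moments, and uncorrelated
  p-th powers suffice for the second-moment form of the weak law. With n summands and increment
  length e, the L^1 error has four parts: freezing h over an increment (order e^\<alpha>) together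
  with truncation, the fluctuation of the average (order n^(-1/2)), the shift of the p-th moment
  caused by truncation, and the error of a Riemann sum. The condition H > 1/2 enters as local
  integrability of |w|^(2H-2), which makes the kernels square integrable.\<close>

text \<open>
  Kernels and integrals of elementary functions are values of the same functional: \<open>\<phi>\<^sub>i(\<tau>) = 1\<close> if \<open>y\<^sub>i \<le> \<tau>\<close>
  and \<open>0\<close> otherwise gives the kernel at \<open>y\<close>, and \<open>\<phi>\<^sub>i = B\<close> gives the integral. Refining grids, restricting to
  cubes and rescaling therefore need to be treated only once.
\<close>

definition grid_form ::
  "nat \<Rightarrow> nat \<Rightarrow> (nat \<Rightarrow> real) \<Rightarrow> ((nat \<Rightarrow> nat) \<Rightarrow> real) \<Rightarrow> (nat \<Rightarrow> real \<Rightarrow> real) \<Rightarrow> real" where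
  "grid_form q m t a \<phi> =
     (\<Sum>k\<in>offdiag_indices q m. a k * (\<Prod>i<q. \<phi> i (t (Suc (k i))) - \<phi> i (t (k i))))"

definition elementary_forms :: "nat \<Rightarrow> ((nat \<Rightarrow> real \<Rightarrow> real) \<Rightarrow> real) set" where
  "elementary_forms q = {s. \<exists>m t a. strict_mono_on {..m} t \<and> s = grid_form q m t a}"

definition form_kernel :: "((nat \<Rightarrow> real \<Rightarrow> real) \<Rightarrow> real) \<Rightarrow> (nat \<Rightarrow> real) \<Rightarrow> real" where
  "form_kernel s y = s (\<lambda>i \<tau>. indicator {y i..} \<tau>)"

definition form_integral ::
  "(real \<Rightarrow> 'a \<Rightarrow> real) \<Rightarrow> ((nat \<Rightarrow> real \<Rightarrow> real) \<Rightarrow> real) \<Rightarrow> 'a \<Rightarrow> real" where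
  "form_integral B s \<omega> = s (\<lambda>i \<tau>. B \<tau> \<omega>)"

section \<open>Grids, their refinement and restriction to cubes\<close>

lemma finite_offdiag_indices [simp, intro]: "finite (offdiag_indices q m)"
  unfolding offdiag_indices_def by (rule finite_subset[of _ "{..<q} \<rightarrow>\<^sub>E {..<m}"]) (auto intro: finite_PiE)

lemma offdiag_indicesD: "k \<in> offdiag_indices q m \<Longrightarrow> i < q \<Longrightarrow> k i < m"
  by (auto simp: offdiag_indices_def PiE_def Pi_def)

lemma strict_mono_on_grid_less: "strict_mono_on {..m} (t::nat \<Rightarrow> real) \<Longrightarrow> i < j \<Longrightarrow> j \<le> m \<Longrightarrow> t i < t j"
  by (rule strict_mono_onD[of "{..m}" t]) auto

lemma strict_mono_on_grid_le: "strict_mono_on {..m} (t::nat \<Rightarrow> real) \<Longrightarrow> i \<le> j \<Longrightarrow> j \<le> m \<Longrightarrow> t i \<le> t j"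
  using strict_mono_on_grid_less[of m t i j] by (cases "i = j") auto

lemma elementary_kernel_eq_form_kernel:
  assumes "strict_mono_on {..m} t"
  shows "elementary_kernel q m t a = form_kernel (grid_form q m t a)"
proof
  fix y
  have "(indicator {t (k i)<..t (Suc (k i))} (y i) :: real)
      = indicator {y i..} (t (Suc (k i))) - indicator {y i..} (t (k i))"
    if "k \<in> offdiag_indices q m" "i < q" for k i
  proof -
    have "t (k i) < t (Suc (k i))"
      using strict_mono_on_grid_less[OF assms, of "k i" "Suc (k i)"] offdiag_indicesD[OF that] by simp
    then show ?thesis by (auto simp: indicator_def)
  qed
  then show "elementary_kernel q m t a y = form_kernel (grid_form q m t a) y"
    unfolding elementary_kernel_def form_kernel_def grid_form_def
    by (intro sum.cong arg_cong2[where f="(*)"] prod.cong) auto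
qed

lemma elementary_integral_eq_form_integral:
  "elementary_integral B q m t a = form_integral B (grid_form q m t a)"
  by (simp add: fun_eq_iff elementary_integral_def form_integral_def grid_form_def)

text \<open>Each coarse difference telescopes into the differences over the block \<open>J i\<close>
  of fine cells inside cell i, and distributivity turns the product of these sums into a sum over
  the fine multi-indices \<open>W k\<close> lying in the box k.\<close>

lemma grid_form_refine:
  assumes \<sigma>: "\<And>i j. i < j \<Longrightarrow> j \<le> m \<Longrightarrow> \<sigma> i < \<sigma> j" "\<And>i. i \<le> m \<Longrightarrow> \<sigma> i \<le> m'"
    and t: "\<And>i. i \<le> m \<Longrightarrow> t i = t' (\<sigma> i)"
  shows "\<exists>a'. grid_form q m t a = grid_form q m' t' a'"
proof -
  define J where "J i = {\<sigma> i..<\<sigma> (Suc i)}" for i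
  define W where "W k = Pi\<^sub>E {..<q} (\<lambda>i. J (k i))" for k
  \<comment> \<open>A fine box inherits the coefficient of the coarse box that contains it. Fine
    off-diagonal boxes inside a coarse diagonal box receive 0.\<close>
  define a' where "a' k' = (\<Sum>k\<in>offdiag_indices q m. if k' \<in> W k then a k else 0)" for k'
  have mono: "\<sigma> i \<le> \<sigma> j" if "i \<le> j" "j \<le> m" for i j
    using \<sigma>(1)[of i j] that by (cases "i = j") auto
  have disj: "x = y" if "j \<in> J x" "j \<in> J y" "x < m" "y < m" for j x y
  proof (rule ccontr)
    assume "x \<noteq> y"
    then consider "Suc x \<le> y" | "Suc y \<le> x" by linarith
    then show False
      using that mono[of "Suc x" y] mono[of "Suc y" x] by cases (auto simp: J_def)
  qed
  \<comment> \<open>Blocks of different coarse cells are disjoint, so injectivity of k passes to all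
    its refinements: refining never creates diagonal boxes.\<close>
  have W: "W k \<subseteq> offdiag_indices q m'" if k: "k \<in> offdiag_indices q m" for k
  proof
    fix k' assume k': "k' \<in> W k"
    have km: "k i < m" if "i < q" for i using offdiag_indicesD[OF k that] .
    have "k' i < m'" if "i < q" for i
    proof -
      have "k' i \<in> J (k i)" using k' that by (auto simp: W_def)
      moreover have "\<sigma> (Suc (k i)) \<le> m'" using \<sigma>(2)[of "Suc (k i)"] km[OF that] by simp
      ultimately show ?thesis by (auto simp: J_def)
    qed
    moreover have "inj_on k' {..<q}"
    proof (rule inj_onI)
      fix x y assume xy: "x \<in> {..<q}" "y \<in> {..<q}" "k' x = k' y"
      have "k' x \<in> J (k x)" "k' y \<in> J (k y)" using k' xy(1,2) by (auto simp: W_def)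
      then have "k' x \<in> J (k x)" "k' x \<in> J (k y)" by (simp_all only: xy(3))
      then have "k x = k y" by (rule disj) (use km xy in auto)
      then show "x = y" using k xy by (auto simp: offdiag_indices_def inj_on_def)
    qed
    ultimately show "k' \<in> offdiag_indices q m'"
      using k' by (auto simp: offdiag_indices_def W_def PiE_def Pi_def)
  qed
  have "grid_form q m t a \<phi> = grid_form q m' t' a' \<phi>" for \<phi>
  proof -
    define D where "D i j = \<phi> i (t' (Suc j)) - \<phi> i (t' j)" for i j
    have "grid_form q m t a \<phi> = (\<Sum>k\<in>offdiag_indices q m. a k * (\<Prod>i<q. \<Sum>j\<in>J (k i). D i j))"
      unfolding grid_form_def
    proof (intro sum.cong arg_cong2[where f="(*)"] prod.cong refl)
      fix k i assume k: "k \<in> offdiag_indices q m" and "i \<in> {..<q}"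
      then have km: "k i < m" using offdiag_indicesD[OF k] by auto
      then have "(\<Sum>j\<in>J (k i). D i j) = \<phi> i (t' (\<sigma> (Suc (k i)))) - \<phi> i (t' (\<sigma> (k i)))"
        unfolding J_def D_def using sum_Suc_diff'[of "\<sigma> (k i)" "\<sigma> (Suc (k i))" "\<lambda>j. \<phi> i (t' j)"]
          mono[of "k i" "Suc (k i)"] by simp
      then show "\<phi> i (t (Suc (k i))) - \<phi> i (t (k i)) = (\<Sum>j\<in>J (k i). D i j)"
        using km t by simp
    qed
    also have "\<dots> = (\<Sum>k\<in>offdiag_indices q m. a k * (\<Sum>k'\<in>W k. \<Prod>i<q. D i (k' i)))"
      unfolding W_def by (subst prod_sum_PiE) (auto simp: J_def)
    also have "\<dots> = (\<Sum>k\<in>offdiag_indices q m. \<Sum>k'\<in>offdiag_indices q m'.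
        (if k' \<in> W k then a k else 0) * (\<Prod>i<q. D i (k' i)))"
    proof (intro sum.cong refl)
      fix k assume k: "k \<in> offdiag_indices q m"
      have "(\<Sum>k'\<in>W k. a k * (\<Prod>i<q. D i (k' i))) =
         (\<Sum>k'\<in>offdiag_indices q m'. if k' \<in> W k then a k * (\<Prod>i<q. D i (k' i)) else 0)"
        using W[OF k] by (subst sum.inter_restrict[symmetric]) (auto simp: Int_absorb1)
      then show "a k * (\<Sum>k'\<in>W k. \<Prod>i<q. D i (k' i)) = (\<Sum>k'\<in>offdiag_indices q m'.
        (if k' \<in> W k then a k else 0) * (\<Prod>i<q. D i (k' i)))"
        by (simp add: sum_distrib_left if_distrib[of "\<lambda>x. x * _"] cong: if_cong)
    qed
    also have "\<dots> = grid_form q m' t' a' \<phi>"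
      unfolding grid_form_def a'_def D_def by (subst sum.swap) (simp add: sum_distrib_right)
    finally show ?thesis .
  qed
  then show ?thesis by blast
qed

text \<open>Grids are represented by finite sets of points, so that a common refinement is just a
  union. The number \<open>card T - 1\<close> seen below counts the cells between the points of
  T.\<close>

abbreviation enum_set :: "real set \<Rightarrow> nat \<Rightarrow> real" where
  "enum_set T \<equiv> (!) (sorted_list_of_set T)"

lemma strict_mono_on_enum_set:
  assumes "finite T" "T \<noteq> {}"
  shows "strict_mono_on {..card T - 1} (enum_set T)"
proof (rule strict_mono_onI)
  fix i j assume "i \<in> {..card T - 1}" "j \<in> {..card T - 1}" "i < j"
  moreover have "card T > 0" using assms by (simp add: card_gt_0_iff)
  ultimately show "enum_set T i < enum_set T j"
    using sorted_wrt_nth_less[OF strict_sorted_list_of_set[of T], of i j] by simp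
qed

lemma enum_set_surj:
  assumes "finite T" "x \<in> T"
  shows "\<exists>i\<le>card T - 1. enum_set T i = x"
proof -
  have "x \<in> set (sorted_list_of_set T)" using assms by simp
  then obtain i where "i < length (sorted_list_of_set T)" "enum_set T i = x"
    unfolding in_set_conv_nth by blast
  then show ?thesis by (intro exI[of _ i]) auto
qed

lemma grid_form_on_finite_set:
  assumes t: "strict_mono_on {..m} t" and T: "finite T" "t ` {..m} \<subseteq> T"
  shows "\<exists>a'. grid_form q m t a = grid_form q (card T - 1) (enum_set T) a'"
proof -
  have "\<forall>i. \<exists>j. i \<le> m \<longrightarrow> j \<le> card T - 1 \<and> t i = enum_set T j"
    using enum_set_surj[OF T(1)] T(2) by (metis atMost_iff image_subset_iff)
  then obtain \<sigma> where \<sigma>: "\<And>i. i \<le> m \<Longrightarrow> \<sigma> i \<le> card T - 1" "\<And>i. i \<le> m \<Longrightarrow> t i = enum_set T (\<sigma> i)"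
    by metis
  have "T \<noteq> {}" using T by auto
  show ?thesis
  proof (rule grid_form_refine[of m \<sigma>])
    fix i j assume ij: "i < j" "j \<le> m"
    show "\<sigma> i < \<sigma> j"
    proof (rule ccontr)
      assume "\<not> \<sigma> i < \<sigma> j"
      then have "enum_set T (\<sigma> j) \<le> enum_set T (\<sigma> i)"
        using strict_mono_on_grid_le[OF strict_mono_on_enum_set[OF T(1) \<open>T \<noteq> {}\<close>], of "\<sigma> j" "\<sigma> i"] \<sigma>(1)[of i] ij by auto
      then show False using \<sigma>(2)[of i] \<sigma>(2)[of j] ij strict_mono_on_grid_less[OF t ij] by simp
    qed
  qed (use \<sigma> in auto)
qed

text \<open>The conclusion covers all finite supersets of T, so several forms and additional
  prescribed points can be put on one grid by taking unions.\<close>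

lemma elementary_forms_grid:
  assumes "s \<in> elementary_forms q"
  obtains T where "finite T" "T \<noteq> {}"
    "\<And>T'. finite T' \<Longrightarrow> T \<subseteq> T' \<Longrightarrow> \<exists>a. s = grid_form q (card T' - 1) (enum_set T') a"
proof -
  from assms obtain m t a where *: "strict_mono_on {..m} t" "s = grid_form q m t a"
    by (auto simp: elementary_forms_def)
  show ?thesis
  proof (rule that[of "t ` {..m}"])
    fix T' assume "finite T'" "t ` {..m} \<subseteq> T'"
    then show "\<exists>a. s = grid_form q (card T' - 1) (enum_set T') a"
      using grid_form_on_finite_set[OF *(1)] *(2) by blast
  qed auto
qed

lemma enum_grid_in_elementary_forms:
  "finite T \<Longrightarrow> T \<noteq> {} \<Longrightarrow> grid_form q (card T - 1) (enum_set T) a \<in> elementary_forms q"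
  unfolding elementary_forms_def using strict_mono_on_enum_set by blast

text \<open>The set P is there to force the end points of a truncation window into the grid.\<close>

lemma elementary_forms_common_grid:
  assumes "s \<in> elementary_forms q" "s' \<in> elementary_forms q" "finite P"
  obtains T a a' where "finite T" "T \<noteq> {}" "P \<subseteq> T"
    "s = grid_form q (card T - 1) (enum_set T) a" "s' = grid_form q (card T - 1) (enum_set T) a'"
proof -
  from elementary_forms_grid[OF assms(1)] obtain T1 where T1: "finite T1" "T1 \<noteq> {}"
    "\<And>T'. finite T' \<Longrightarrow> T1 \<subseteq> T' \<Longrightarrow> \<exists>a. s = grid_form q (card T' - 1) (enum_set T') a" by metis
  from elementary_forms_grid[OF assms(2)] obtain T2 where T2: "finite T2" "T2 \<noteq> {}"
    "\<And>T'. finite T' \<Longrightarrow> T2 \<subseteq> T' \<Longrightarrow> \<exists>a. s' = grid_form q (card T' - 1) (enum_set T') a" by metis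
  define T where "T = T1 \<union> T2 \<union> P"
  have T: "finite T" "T \<noteq> {}" "P \<subseteq> T" "T1 \<subseteq> T" "T2 \<subseteq> T" using T1 T2 assms(3) by (auto simp: T_def)
  from T1(3)[OF T(1) T(4)] T2(3)[OF T(1) T(5)] show ?thesis using that[OF T(1-3)] by blast
qed

lemma grid_form_lincomb:
  "c * grid_form q m t a \<phi> + c' * grid_form q m t a' \<phi> = grid_form q m t (\<lambda>k. c * a k + c' * a' k) \<phi>"
  unfolding grid_form_def by (simp add: sum_distrib_left sum.distrib algebra_simps)

lemma elementary_forms_lincomb:
  assumes "s \<in> elementary_forms q" "s' \<in> elementary_forms q"
  shows "(\<lambda>\<phi>. c * s \<phi> + c' * s' \<phi>) \<in> elementary_forms q"
proof -
  obtain T a a' where T: "finite T" "T \<noteq> {}"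
    "s = grid_form q (card T - 1) (enum_set T) a" "s' = grid_form q (card T - 1) (enum_set T) a'"
    by (rule elementary_forms_common_grid[OF assms finite.emptyI])
  show ?thesis
    unfolding T(3,4) grid_form_lincomb by (rule enum_grid_in_elementary_forms[OF T(1,2)])
qed

text \<open>The integrator is made constant outside \<open>[lo, hi]\<close> by composing it with the
  projection onto this interval. Its increments then vanish elsewhere, which amounts to restricting
  the kernel to the cube over \<open>(lo, hi]\<close>.\<close>

definition clamp_form ::
  "real \<Rightarrow> real \<Rightarrow> ((nat \<Rightarrow> real \<Rightarrow> real) \<Rightarrow> real) \<Rightarrow> (nat \<Rightarrow> real \<Rightarrow> real) \<Rightarrow> real" where
  "clamp_form lo hi s \<phi> = s (\<lambda>i \<tau>. \<phi> i (max lo (min hi \<tau>)))"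

text \<open>As \<open>lo\<close> and \<open>hi\<close> are grid points, no cell straddles an end of
  the interval. A cell outside is mapped to a single point, and one vanishing difference kills the
  whole product.\<close>

lemma clamp_form_grid_form:
  assumes q: "q \<ge> 1" and T: "finite T" "lo \<in> T" "hi \<in> T" "lo \<le> hi"
  shows "clamp_form lo hi (grid_form q (card T - 1) (enum_set T) a) =
    grid_form q (card T - 1) (enum_set T)
      (\<lambda>k. if \<forall>i<q. lo \<le> enum_set T (k i) \<and> enum_set T (Suc (k i)) \<le> hi then a k else 0)"
proof
  fix \<phi>
  let ?t = "enum_set T" let ?c = "\<lambda>\<tau>. max lo (min hi \<tau>)"
  have "T \<noteq> {}" using T by auto
  note sm = strict_mono_on_enum_set[OF T(1) \<open>T \<noteq> {}\<close>]
  obtain il ih where il: "il \<le> card T - 1" "?t il = lo" and ih: "ih \<le> card T - 1" "?t ih = hi"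
    using enum_set_surj T by metis
  show "clamp_form lo hi (grid_form q (card T - 1) ?t a) \<phi> =
    grid_form q (card T - 1) ?t
      (\<lambda>k. if \<forall>i<q. lo \<le> enum_set T (k i) \<and> enum_set T (Suc (k i)) \<le> hi then a k else 0) \<phi>"
    unfolding clamp_form_def grid_form_def
  proof (intro sum.cong refl)
    fix k assume k: "k \<in> offdiag_indices q (card T - 1)"
    have lt: "?t (k i) < ?t (Suc (k i))" "k i < card T - 1" if "i < q" for i
      using strict_mono_on_grid_less[OF sm, of "k i" "Suc (k i)"] offdiag_indicesD[OF k that] by auto
    show "a k * (\<Prod>i<q. \<phi> i (?c (?t (Suc (k i)))) - \<phi> i (?c (?t (k i)))) =
      (if \<forall>i<q. lo \<le> enum_set T (k i) \<and> enum_set T (Suc (k i)) \<le> hi then a k else 0) *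
      (\<Prod>i<q. \<phi> i (?t (Suc (k i))) - \<phi> i (?t (k i)))"
    proof (cases "\<forall>i<q. lo \<le> ?t (k i) \<and> ?t (Suc (k i)) \<le> hi")
      case True
      have "?c (?t (Suc (k i))) = ?t (Suc (k i))" "?c (?t (k i)) = ?t (k i)" if "i < q" for i
        using True that lt[OF that] T by fastforce+
      then show ?thesis using True by (auto intro!: prod.cong)
    next
      case False
      then obtain i where i: "i < q" "\<not> (lo \<le> ?t (k i) \<and> ?t (Suc (k i)) \<le> hi)" by auto
      have "?c (?t (Suc (k i))) = ?c (?t (k i))"
      proof (cases "lo \<le> ?t (k i)")
        case False
        \<comment> \<open>The left end of the cell is below the grid point \<open>lo\<close>, hence
          its right end is at most \<open>lo\<close>.\<close>
        then have "k i < il" using strict_mono_on_grid_le[OF sm, of il "k i"] il lt(2)[OF i(1)] by force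
        then have "?t (Suc (k i)) \<le> lo" using strict_mono_on_grid_le[OF sm, of "Suc (k i)" il] il by auto
        then show ?thesis using False T by auto
      next
        case True
        then have "\<not> Suc (k i) \<le> ih" using i strict_mono_on_grid_le[OF sm, of "Suc (k i)" ih] ih by auto
        then have "hi \<le> ?t (k i)" using strict_mono_on_grid_le[OF sm, of ih "k i"] ih lt(2)[OF i(1)] by auto
        then show ?thesis using lt(1)[OF i(1)] by auto
      qed
      then have "(\<Prod>i<q. \<phi> i (?c (?t (Suc (k i)))) - \<phi> i (?c (?t (k i)))) = 0"
        using i(1) by (intro prod_zero bexI[of _ i]) simp_all
      then show ?thesis using False by auto
    qed
  qed
qed

subsection \<open>Moments of Gaussian chaos\<close>

abbreviation gauss :: "real measure" where
  "gauss \<equiv> density lborel (\<lambda>x. ennreal (std_normal_density x))"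

interpretation gauss: prob_space gauss
  by (rule prob_space_normal_density) simp

interpretation gauss_product: product_sigma_finite "\<lambda>_::nat. gauss"
  by standard

text \<open>In the binomial expansion the odd Gaussian moments vanish, and
  \<open>fact (2 * i) / (2 ^ i * fact i)\<close> is the moment of order 2i.\<close>

lemma nn_integral_gauss_even_power:
  "(\<integral>\<^sup>+z. ennreal ((A + z * B) ^ (2 * r)) \<partial>gauss) =
    ennreal (\<Sum>i\<le>r. real (2 * r choose (2 * i)) * (fact (2 * i) / (2 ^ i * fact i)) * (A ^ (2 * (r - i)) * B ^ (2 * i)))"
proof -
  define mom :: "nat \<Rightarrow> real" where "mom k = (if even k then fact k / (2 ^ (k div 2) * fact (k div 2)) else 0)" for k
  have mom: "has_bochner_integral lborel (\<lambda>z. std_normal_density z * z ^ k) (mom k)" for k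
  proof (cases "even k")
    case True
    then obtain j where "k = 2 * j" by (rule evenE)
    then show ?thesis using std_normal_moment_even[of j] by (simp add: mom_def)
  next
    case False
    then obtain j where "k = 2 * j + 1" by (rule oddE)
    then show ?thesis using std_normal_moment_odd[of j] by (simp add: mom_def)
  qed
  have "has_bochner_integral lborel
      (\<lambda>z. \<Sum>k\<le>2*r. (real (2 * r choose k) * (B ^ k * A ^ (2 * r - k))) * (std_normal_density z * z ^ k))
      (\<Sum>k\<le>2*r. (real (2 * r choose k) * (B ^ k * A ^ (2 * r - k))) * mom k)"
    by (intro has_bochner_integral_sum has_bochner_integral_mult_right mom)
  moreover have "(\<Sum>k\<le>2*r. (real (2 * r choose k) * (B ^ k * A ^ (2 * r - k))) * (std_normal_density z * z ^ k))
      = std_normal_density z * (A + z * B) ^ (2 * r)" for z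
    by (subst add.commute, subst binomial_ring)
      (auto simp: sum_distrib_left power_mult_distrib algebra_simps intro!: sum.cong)
  moreover have "(\<Sum>k\<le>2*r. (real (2 * r choose k) * (B ^ k * A ^ (2 * r - k))) * mom k) =
      (\<Sum>i\<le>r. real (2 * r choose (2 * i)) * (fact (2 * i) / (2 ^ i * fact i)) * (A ^ (2 * (r - i)) * B ^ (2 * i)))"
  proof -
    have "(\<Sum>k\<le>2*r. (real (2 * r choose k) * (B ^ k * A ^ (2 * r - k))) * mom k) =
      (\<Sum>k\<in>(\<lambda>i. 2 * i) ` {..r}. (real (2 * r choose k) * (B ^ k * A ^ (2 * r - k))) * mom k)"
    proof (rule sum.mono_neutral_right)
      show "\<forall>i\<in>{..2 * r} - (\<lambda>i. 2 * i) ` {..r}. (real (2 * r choose i) * (B ^ i * A ^ (2 * r - i))) * mom i = 0"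
        by (auto simp: mom_def elim!: evenE)
    qed auto
    also have "\<dots> = (\<Sum>i\<le>r. (real (2 * r choose (2*i)) * (B ^ (2*i) * A ^ (2 * r - 2*i))) * mom (2*i))"
      by (subst sum.reindex) (auto simp: inj_on_def)
    finally show ?thesis
      by (simp add: mom_def diff_mult_distrib diff_mult_distrib2 mult_ac)
  qed
  ultimately have hb: "has_bochner_integral lborel (\<lambda>z. std_normal_density z * (A + z * B) ^ (2 * r))
      (\<Sum>i\<le>r. real (2 * r choose (2 * i)) * (fact (2 * i) / (2 ^ i * fact i)) * (A ^ (2 * (r - i)) * B ^ (2 * i)))"
    by simp
  have "(\<integral>\<^sup>+z. ennreal ((A + z * B) ^ (2 * r)) \<partial>gauss) =
      (\<integral>\<^sup>+z. ennreal (std_normal_density z * (A + z * B) ^ (2 * r)) \<partial>lborel)"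
    by (subst nn_integral_density) (auto simp: ennreal_mult'[symmetric] normal_density_nonneg)
  also have "\<dots> = ennreal (\<Sum>i\<le>r. real (2 * r choose (2 * i)) * (fact (2 * i) / (2 ^ i * fact i)) * (A ^ (2 * (r - i)) * B ^ (2 * i)))"
    using hb by (subst nn_integral_eq_integral) (auto simp: has_bochner_integral_iff normal_density_nonneg power_mult)
  finally show ?thesis .
qed

text \<open>The elementary inequality u^(r-i) v^i \<le> u^r + v^r, applied to f^2/a and g^2/b,
  replaces the inequality of Hoelder; its two summands are the source of the factor 2.\<close>

lemma nn_integral_mixed_moment_le:
  fixes f g :: "'a \<Rightarrow> real" and a b :: real
  assumes [measurable]: "f \<in> borel_measurable M" "g \<in> borel_measurable M"
    and f: "(\<integral>\<^sup>+x. ennreal (f x ^ (2 * r)) \<partial>M) \<le> ennreal (a ^ r)"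
    and g: "(\<integral>\<^sup>+x. ennreal (g x ^ (2 * r)) \<partial>M) \<le> ennreal (b ^ r)"
    and ab: "a \<ge> 0" "b \<ge> 0" and i: "1 \<le> i" "i \<le> r"
  shows "(\<integral>\<^sup>+x. ennreal (f x ^ (2 * (r - i)) * g x ^ (2 * i)) \<partial>M) \<le> ennreal (2 * (a ^ (r - i) * b ^ i))"
proof -
  have zero: "AE x in M. u x = 0" if [measurable]: "u \<in> borel_measurable M"
    and "(\<integral>\<^sup>+x. ennreal (u x ^ (2 * r)) \<partial>M) \<le> ennreal (0 ^ r)" for u :: "'a \<Rightarrow> real"
  proof -
    have "(\<integral>\<^sup>+x. ennreal (u x ^ (2 * r)) \<partial>M) = 0" using that(2) i by (auto simp: power_0_left)
    then have "AE x in M. ennreal (u x ^ (2 * r)) = 0" by (subst (asm) nn_integral_0_iff_AE) auto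
    then show ?thesis
    proof eventually_elim
      case (elim x)
      then have "u x ^ (2 * r) = 0"
        using zero_le_power[OF zero_le_power2[of "u x"], of r] by (simp only: ennreal_eq_0_iff power_mult)
      then show ?case by simp
    qed
  qed
  \<comment> \<open>Normalising requires positive a and b. If one of them is 0, the corresponding
    function vanishes almost everywhere and the integrand with it, provided its exponent is
    positive; this is why i = r stands apart.\<close>
  consider "i = r" | "i < r" "a = 0 \<or> b = 0" | "a > 0" "b > 0" "i < r" using ab i by linarith
  then show ?thesis
  proof cases
    case 1
    have "ennreal (b ^ r) \<le> ennreal (2 * b ^ r)" using ab by (intro ennreal_leI) simp
    then show ?thesis using 1 g by (auto intro: order_trans)
  next
    case 2
    then have "AE x in M. f x = 0 \<or> g x = 0"
      using zero[of f] zero[of g] f g by (auto elim: eventually_mono)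
    then have "AE x in M. ennreal (f x ^ (2 * (r - i)) * g x ^ (2 * i)) = 0"
      by eventually_elim (use 2 i in \<open>auto simp: power_0_left\<close>)
    then have "(\<integral>\<^sup>+x. ennreal (f x ^ (2 * (r - i)) * g x ^ (2 * i)) \<partial>M) = 0"
      by (subst nn_integral_0_iff_AE) auto
    then show ?thesis by simp
  next
    case 3
    have young: "u ^ (r - i) * v ^ i \<le> u ^ r + v ^ r" if "u \<ge> 0" "v \<ge> 0" for u v :: real
    proof -
      have "u ^ (r - i) * v ^ i \<le> max u v ^ (r - i) * max u v ^ i"
        using that by (intro mult_mono power_mono) auto
      also have "\<dots> = max u v ^ r" using i by (simp add: power_add[symmetric])
      also have "\<dots> \<le> u ^ r + v ^ r" using that by (cases "u \<le> v") (auto simp: max_def)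
      finally show ?thesis .
    qed
    have "f x ^ (2 * (r - i)) * g x ^ (2 * i) \<le>
        a ^ (r - i) * b ^ i / a ^ r * f x ^ (2 * r) + a ^ (r - i) * b ^ i / b ^ r * g x ^ (2 * r)" for x
    proof -
      have "((f x)\<^sup>2 / a) ^ (r - i) * ((g x)\<^sup>2 / b) ^ i \<le> ((f x)\<^sup>2 / a) ^ r + ((g x)\<^sup>2 / b) ^ r"
        using 3 by (intro young) auto
      from mult_left_mono[OF this, of "a ^ (r - i) * b ^ i"]
      have "a ^ (r - i) * b ^ i * (((f x)\<^sup>2 / a) ^ (r - i) * ((g x)\<^sup>2 / b) ^ i) \<le>
          a ^ (r - i) * b ^ i * (((f x)\<^sup>2 / a) ^ r + ((g x)\<^sup>2 / b) ^ r)"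
        using 3 by simp
      moreover have "a ^ (r - i) * b ^ i * (((f x)\<^sup>2 / a) ^ (r - i) * ((g x)\<^sup>2 / b) ^ i) =
          ((f x)\<^sup>2) ^ (r - i) * ((g x)\<^sup>2) ^ i"
        using 3 by (simp add: power_divide)
      ultimately show ?thesis by (simp add: power_mult power_divide distrib_left)
    qed
    then have "(\<integral>\<^sup>+x. ennreal (f x ^ (2 * (r - i)) * g x ^ (2 * i)) \<partial>M) \<le>
       (\<integral>\<^sup>+x. ennreal (a ^ (r - i) * b ^ i / a ^ r) * ennreal (f x ^ (2 * r)) +
           ennreal (a ^ (r - i) * b ^ i / b ^ r) * ennreal (g x ^ (2 * r)) \<partial>M)"
      using 3 by (intro nn_integral_mono)
        (simp add: ennreal_mult''[symmetric] power_mult flip: ennreal_plus)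
    also have "\<dots> = ennreal (a ^ (r - i) * b ^ i / a ^ r) * (\<integral>\<^sup>+x. ennreal (f x ^ (2 * r)) \<partial>M) +
           ennreal (a ^ (r - i) * b ^ i / b ^ r) * (\<integral>\<^sup>+x. ennreal (g x ^ (2 * r)) \<partial>M)"
      by (subst nn_integral_add) (auto simp: nn_integral_cmult)
    also have "\<dots> \<le> ennreal (a ^ (r - i) * b ^ i / a ^ r) * ennreal (a ^ r) +
           ennreal (a ^ (r - i) * b ^ i / b ^ r) * ennreal (b ^ r)"
      using f g by (intro add_mono mult_left_mono) auto
    also have "\<dots> = ennreal (2 * (a ^ (r - i) * b ^ i))"
      using 3 by (simp add: ennreal_mult''[symmetric] flip: ennreal_plus)
    finally show ?thesis .
  qed
qed

text \<open>The induction requires a number K \<ge> 1 with 2 w_i \<le> K^i for 1 \<le> i \<le> r,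
  where w_i is the weight of the i-th term in the Gaussian expansion. One plus the sum of all 2 w_i
  is a crude choice.\<close>

definition bonami_const :: "nat \<Rightarrow> real" where
  "bonami_const r = 1 + (\<Sum>i\<le>r. 2 * (real (2 * r choose (2 * i)) * (fact (2 * i) / (2 ^ i * fact i))))"

lemma bonami_const_ge_1: "bonami_const r \<ge> 1"
  unfolding bonami_const_def by (auto intro!: sum_nonneg)

lemma bonami_const_bound:
  assumes "1 \<le> i" "i \<le> r"
  shows "2 * (real (2 * r choose (2 * i)) * (fact (2 * i) / (2 ^ i * fact i))) \<le> bonami_const r ^ i"
proof -
  have "2 * (real (2 * r choose (2 * i)) * (fact (2 * i) / (2 ^ i * fact i))) \<le>
     (\<Sum>i\<le>r. 2 * (real (2 * r choose (2 * i)) * (fact (2 * i) / (2 ^ i * fact i))))"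
    using assms by (intro member_le_sum) auto
  also have "\<dots> \<le> bonami_const r ^ 1" by (simp add: bonami_const_def)
  also have "\<dots> \<le> bonami_const r ^ i" using bonami_const_ge_1 assms by (intro power_increasing) auto
  finally show ?thesis .
qed

text \<open>
  Weighting the coefficient of each monomial by \<open>K\<^bsup>|S|\<^esup>\<close> makes the induction on the number of variables
  close: for \<open>f + z g\<close> with a new variable \<open>z\<close> only the even moments of \<open>z\<close> survive, and the right-hand
  side becomes \<open>(a + K b)\<^sup>r\<close>.
\<close>

lemma nn_integral_gauss_multilinear_power_le:
  fixes c :: "nat set \<Rightarrow> real"
  assumes "finite I" "r \<ge> 1"
  shows "(\<integral>\<^sup>+x. ennreal ((\<Sum>S\<in>Pow I. c S * (\<Prod>j\<in>S. x j)) ^ (2 * r)) \<partial>PiM I (\<lambda>_. gauss))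
    \<le> ennreal ((\<Sum>S\<in>Pow I. bonami_const r ^ card S * (c S)\<^sup>2) ^ r)"
  using assms(1)
proof (induction I arbitrary: c rule: finite_induct)
  case empty
  show ?case by (subst gauss_product.nn_integral_empty) (auto simp: power_mult)
next
  case (insert n I)
  let ?K = "bonami_const r"
  define f where "f x = (\<Sum>S\<in>Pow I. c S * (\<Prod>j\<in>S. x j))" for x :: "nat \<Rightarrow> real"
  define g where "g x = (\<Sum>S\<in>Pow I. c (insert n S) * (\<Prod>j\<in>S. x j))" for x :: "nat \<Rightarrow> real"
  define a where "a = (\<Sum>S\<in>Pow I. ?K ^ card S * (c S)\<^sup>2)"
  define b where "b = (\<Sum>S\<in>Pow I. ?K ^ card S * (c (insert n S))\<^sup>2)"
  define w where "w i = real (2 * r choose (2 * i)) * (fact (2 * i) / (2 ^ i * fact i))" for i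
  note [simp] = \<open>finite I\<close>
  have K: "?K \<ge> 1" by (rule bonami_const_ge_1)
  have ab: "a \<ge> 0" "b \<ge> 0" using K by (auto simp: a_def b_def intro!: sum_nonneg)
  have inj: "inj_on (insert n) (Pow I)"
  proof (rule inj_onI)
    fix S T assume "S \<in> Pow I" "T \<in> Pow I" "insert n S = insert n T"
    moreover from this have "n \<notin> S" "n \<notin> T" using insert.hyps(2) by auto
    ultimately show "S = T" by (metis Diff_insert_absorb)
  qed
  \<comment> \<open>Sorting the subsets by whether they contain n writes the polynomial as f + z g,
    with f and g in the old variables.\<close>
  have split: "(\<Sum>S\<in>Pow (insert n I). h S) = (\<Sum>S\<in>Pow I. h S) + (\<Sum>S\<in>Pow I. h (insert n S))"
    for h :: "nat set \<Rightarrow> real"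
    unfolding Pow_insert
    by (subst sum.union_disjoint, simp, simp, use insert.hyps(2) in blast) (simp add: sum.reindex[OF inj])
  have prod_measurable: "(\<lambda>x. \<Prod>j\<in>S. x j) \<in> borel_measurable (PiM J (\<lambda>_. gauss))" if "S \<subseteq> J" for S J :: "nat set"
    using that by (intro borel_measurable_prod) auto
  have [measurable]: "f \<in> borel_measurable (PiM I (\<lambda>_. gauss))" "g \<in> borel_measurable (PiM I (\<lambda>_. gauss))"
    unfolding f_def[abs_def] g_def[abs_def]
    by (auto intro!: borel_measurable_sum borel_measurable_times prod_measurable)
  have [measurable]: "(\<lambda>x. \<Sum>S\<in>Pow (insert n I). c S * (\<Prod>j\<in>S. x j)) \<in> borel_measurable (PiM (insert n I) (\<lambda>_. gauss))"
    by (auto intro!: borel_measurable_sum borel_measurable_times prod_measurable)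
  have upd: "(\<Sum>S\<in>Pow (insert n I). c S * (\<Prod>j\<in>S. (x(n := z)) j)) = f x + z * g x" for x z
  proof -
    have "(\<Prod>j\<in>S. (x(n := z)) j) = (\<Prod>j\<in>S. x j)" if "S \<in> Pow I" for S
      using that insert.hyps(2) by (intro prod.cong) auto
    moreover have "(\<Prod>j\<in>insert n S. (x(n := z)) j) = z * (\<Prod>j\<in>S. x j)" if S: "S \<in> Pow I" for S
    proof -
      have "finite S" "n \<notin> S" using S insert.hyps(2) by (auto intro: finite_subset)
      then have "(\<Prod>j\<in>insert n S. (x(n := z)) j) = z * (\<Prod>j\<in>S. (x(n := z)) j)" by (subst prod.insert) auto
      also have "(\<Prod>j\<in>S. (x(n := z)) j) = (\<Prod>j\<in>S. x j)" using \<open>n \<notin> S\<close> by (intro prod.cong) auto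
      finally show ?thesis .
    qed
    ultimately show ?thesis
      unfolding split f_def g_def by (simp add: sum_distrib_left algebra_simps)
  qed
  have "(\<integral>\<^sup>+x. ennreal ((\<Sum>S\<in>Pow (insert n I). c S * (\<Prod>j\<in>S. x j)) ^ (2 * r)) \<partial>PiM (insert n I) (\<lambda>_. gauss))
     = (\<integral>\<^sup>+x. \<integral>\<^sup>+z. ennreal ((f x + z * g x) ^ (2 * r)) \<partial>gauss \<partial>PiM I (\<lambda>_. gauss))"
    by (subst gauss_product.product_nn_integral_insert)
      (use insert.hyps(2) in \<open>simp_all only: upd \<open>finite I\<close>\<close>, measurable)
  also have "\<dots> = (\<integral>\<^sup>+x. (\<Sum>i\<le>r. ennreal (w i) * ennreal (f x ^ (2 * (r - i)) * g x ^ (2 * i))) \<partial>PiM I (\<lambda>_. gauss))"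
    unfolding nn_integral_gauss_even_power w_def[symmetric]
  proof (intro nn_integral_cong)
    fix x
    have w: "w i \<ge> 0" for i by (simp add: w_def)
    have nn: "0 \<le> f x ^ (2 * (r - i)) * g x ^ (2 * i)" for i
      by (intro mult_nonneg_nonneg zero_le_even_power) auto
    show "ennreal (\<Sum>i\<le>r. w i * (f x ^ (2 * (r - i)) * g x ^ (2 * i))) =
        (\<Sum>i\<le>r. ennreal (w i) * ennreal (f x ^ (2 * (r - i)) * g x ^ (2 * i)))"
      unfolding ennreal_mult[OF w nn, symmetric] by (intro sum_ennreal[symmetric] mult_nonneg_nonneg w nn)
  qed
  also have "\<dots> = (\<Sum>i\<le>r. ennreal (w i) * (\<integral>\<^sup>+x. ennreal (f x ^ (2 * (r - i)) * g x ^ (2 * i)) \<partial>PiM I (\<lambda>_. gauss)))"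
    by (subst nn_integral_sum) (auto simp: nn_integral_cmult)
  also have "\<dots> \<le> (\<Sum>i\<le>r. ennreal (real (r choose i) * ((?K * b) ^ i * a ^ (r - i))))"
  proof (rule sum_mono)
    fix i assume i: "i \<in> {..r}"
    show "ennreal (w i) * (\<integral>\<^sup>+x. ennreal (f x ^ (2 * (r - i)) * g x ^ (2 * i)) \<partial>PiM I (\<lambda>_. gauss))
      \<le> ennreal (real (r choose i) * ((?K * b) ^ i * a ^ (r - i)))"
    \<comment> \<open>The comparison with the binomial expansion of (a + K b)^r is term by term. For
      i = 0 the bound must hold without any loss, as a factor here would be repeated for every new
      variable; the factor 2 of the mixed terms is absorbed by K^i.\<close>
    proof (cases "i = 0")
      case True
      then show ?thesis using insert.IH[of c] by (simp add: w_def f_def a_def)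
    next
      case False
      have "w i \<ge> 0" by (simp add: w_def)
      have "ennreal (w i) * (\<integral>\<^sup>+x. ennreal (f x ^ (2 * (r - i)) * g x ^ (2 * i)) \<partial>PiM I (\<lambda>_. gauss))
         \<le> ennreal (w i) * ennreal (2 * (a ^ (r - i) * b ^ i))"
        using insert.IH[of c, folded f_def a_def] insert.IH[of "\<lambda>S. c (insert n S)", folded g_def b_def] ab i False
        by (intro mult_left_mono nn_integral_mixed_moment_le) auto
      also have "\<dots> = ennreal ((2 * w i) * (a ^ (r - i) * b ^ i))"
        using \<open>w i \<ge> 0\<close> by (simp add: ennreal_mult'[symmetric] mult_ac)
      also have "\<dots> \<le> ennreal (?K ^ i * (a ^ (r - i) * b ^ i))"
        using bonami_const_bound[of i r] i False ab
        by (intro ennreal_leI mult_right_mono) (auto simp: w_def)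
      also have "\<dots> \<le> ennreal (real (r choose i) * ((?K * b) ^ i * a ^ (r - i)))"
      proof -
        have "1 \<le> real (r choose i)" using i by (simp add: Suc_leI)
        then have "1 * ((?K * b) ^ i * a ^ (r - i)) \<le> real (r choose i) * ((?K * b) ^ i * a ^ (r - i))"
          using ab K by (intro mult_right_mono) auto
        then show ?thesis by (intro ennreal_leI) (simp add: power_mult_distrib mult_ac)
      qed
      finally show ?thesis .
    qed
  qed
  also have "\<dots> = ennreal ((?K * b + a) ^ r)"
    using ab K by (subst sum_ennreal) (auto simp: binomial_ring mult.assoc)
  also have "?K * b + a = (\<Sum>S\<in>Pow (insert n I). ?K ^ card S * (c S)\<^sup>2)"
  proof -
    have "card (insert n S) = Suc (card S)" if "S \<in> Pow I" for S
      using that insert.hyps(2) by (subst card_insert_disjoint) (auto intro: finite_subset)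
    then show ?thesis unfolding split by (simp add: a_def b_def sum_distrib_left mult_ac)
  qed
  finally show ?case .
qed

subsection \<open>Elementary integrals as Gaussian chaos\<close>

abbreviation lborel_pi :: "nat \<Rightarrow> (nat \<Rightarrow> real) measure" where
  "lborel_pi q \<equiv> PiM {..<q} (\<lambda>_. lborel)"

interpretation lborel_product: product_sigma_finite "\<lambda>_::nat. lborel :: real measure"
  by standard

definition grid_norm2 :: "nat \<Rightarrow> nat \<Rightarrow> (nat \<Rightarrow> real) \<Rightarrow> ((nat \<Rightarrow> nat) \<Rightarrow> real) \<Rightarrow> real" where
  "grid_norm2 q m t a = (\<Sum>k\<in>offdiag_indices q m. (a k)\<^sup>2 * (\<Prod>i<q. t (Suc (k i)) - t (k i)))"

text \<open>This is the integral expressed in standardised increments: the standard deviations of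
  the cells move into the coefficients, and injectivity of k makes every monomial
  squarefree.\<close>

definition grid_polynomial ::
  "nat \<Rightarrow> nat \<Rightarrow> (nat \<Rightarrow> real) \<Rightarrow> ((nat \<Rightarrow> nat) \<Rightarrow> real) \<Rightarrow> (nat \<Rightarrow> real) \<Rightarrow> real" where
  "grid_polynomial q m t a x =
     (\<Sum>k\<in>offdiag_indices q m. (a k * (\<Prod>i<q. sqrt (t (Suc (k i)) - t (k i)))) * (\<Prod>i<q. x (k i)))"

lemma sum_power2_orthogonal:
  fixes a b :: "'k \<Rightarrow> real"
  assumes "finite K" "\<And>k. k \<in> K \<Longrightarrow> b k * b k = b k"
    and "\<And>k l. k \<in> K \<Longrightarrow> l \<in> K \<Longrightarrow> k \<noteq> l \<Longrightarrow> b k * b l = 0"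
  shows "(\<Sum>k\<in>K. a k * b k)\<^sup>2 = (\<Sum>k\<in>K. (a k)\<^sup>2 * b k)"
proof -
  have "(\<Sum>k\<in>K. a k * b k)\<^sup>2 = (\<Sum>k\<in>K. \<Sum>l\<in>K. (a k * b k) * (a l * b l))"
    by (simp add: power2_eq_square sum_product)
  also have "\<dots> = (\<Sum>k\<in>K. \<Sum>l\<in>K. if l = k then (a k)\<^sup>2 * b k else 0)"
  proof (intro sum.cong refl)
    fix k l assume kl: "k \<in> K" "l \<in> K"
    have "(a k * b k) * (a l * b l) = a k * a l * (b k * b l)" by simp
    then show "(a k * b k) * (a l * b l) = (if l = k then (a k)\<^sup>2 * b k else 0)"
      using assms(2)[OF kl(1)] assms(3)[OF kl] by (cases "l = k") (auto simp: power2_eq_square)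
  qed
  also have "\<dots> = (\<Sum>k\<in>K. (a k)\<^sup>2 * b k)" using assms(1) by simp
  finally show ?thesis .
qed

lemma form_kernel_grid_form_eq:
  assumes "strict_mono_on {..m} t"
  shows "form_kernel (grid_form q m t a) y =
    (\<Sum>k\<in>offdiag_indices q m. a k * (\<Prod>i<q. indicator {t (k i)<..t (Suc (k i))} (y i)))"
  using elementary_kernel_eq_form_kernel[OF assms, of q a] by (simp add: elementary_kernel_def fun_eq_iff)

lemma borel_measurable_form_kernel:
  assumes "s \<in> elementary_forms q"
  shows "form_kernel s \<in> borel_measurable (lborel_pi q)"
proof -
  from assms obtain m t a where t: "strict_mono_on {..m} t" and s: "s = grid_form q m t a"
    by (auto simp: elementary_forms_def)
  show ?thesis unfolding s form_kernel_grid_form_eq[OF t, abs_def]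
    by (intro borel_measurable_sum borel_measurable_times borel_measurable_prod) auto
qed

lemma grid_cell_less:
  "strict_mono_on {..m} (t :: nat \<Rightarrow> real) \<Longrightarrow> k \<in> offdiag_indices q m \<Longrightarrow> i < q \<Longrightarrow> t (k i) < t (Suc (k i))"
  using strict_mono_on_grid_less[of m t "k i" "Suc (k i)"] offdiag_indicesD[of k q m i] by (simp add: Suc_leI)

lemma grid_cells_unique:
  assumes t: "strict_mono_on {..m} (t :: nat \<Rightarrow> real)" and "i < m" "j < m"
    and "x \<in> {t i<..t (Suc i)}" "x \<in> {t j<..t (Suc j)}"
  shows "i = j"
proof (rule ccontr)
  assume "i \<noteq> j"
  then consider "Suc i \<le> j" | "Suc j \<le> i" by linarith
  then show False
    using assms strict_mono_on_grid_le[OF t, of "Suc i" j] strict_mono_on_grid_le[OF t, of "Suc j" i]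
    by cases auto
qed

text \<open>Distinct boxes of a grid are disjoint, so squaring produces no cross terms and only the
  volumes of the boxes remain.\<close>

lemma nn_integral_form_kernel_power2:
  assumes t: "strict_mono_on {..m} t"
  shows "(\<integral>\<^sup>+y. ennreal ((form_kernel (grid_form q m t a) y)\<^sup>2) \<partial>lborel_pi q) = ennreal (grid_norm2 q m t a)"
proof -
  define b :: "(nat \<Rightarrow> real) \<Rightarrow> (nat \<Rightarrow> nat) \<Rightarrow> real"
    where "b y k = (\<Prod>i<q. indicator {t (k i)<..t (Suc (k i))} (y i))" for y k
  have b01: "b y k * b y k = b y k" for y k
    unfolding b_def prod.distrib[symmetric] by (intro prod.cong) (auto simp: indicator_def)
  have orth: "b y k * b y l = 0" if k: "k \<in> offdiag_indices q m" and l: "l \<in> offdiag_indices q m" and "k \<noteq> l" for y k l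
  proof (rule ccontr)
    assume "b y k * b y l \<noteq> 0"
    then have "\<forall>i<q. y i \<in> {t (k i)<..t (Suc (k i))}" "\<forall>i<q. y i \<in> {t (l i)<..t (Suc (l i))}"
      unfolding b_def by (auto simp: indicator_def split: if_splits)
    then have "\<forall>i<q. k i = l i"
      using grid_cells_unique[OF t] offdiag_indicesD[OF k] offdiag_indicesD[OF l] by blast
    then have "k = l" using k l by (intro PiE_ext[of k "{..<q}" "\<lambda>_. {..<m}" l]) (auto simp: offdiag_indices_def)
    with \<open>k \<noteq> l\<close> show False by simp
  qed
  have len: "0 \<le> t (Suc (k i)) - t (k i)" if "k \<in> offdiag_indices q m" "i < q" for k i
    using grid_cell_less[OF t that] by simp
  have "(\<integral>\<^sup>+y. ennreal ((form_kernel (grid_form q m t a) y)\<^sup>2) \<partial>lborel_pi q) =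
      (\<integral>\<^sup>+y. (\<Sum>k\<in>offdiag_indices q m. ennreal ((a k)\<^sup>2) *
          (\<Prod>i<q. indicator {t (k i)<..t (Suc (k i))} (y i))) \<partial>lborel_pi q)"
  proof (intro nn_integral_cong)
    fix y
    have "(form_kernel (grid_form q m t a) y)\<^sup>2 = (\<Sum>k\<in>offdiag_indices q m. (a k)\<^sup>2 * b y k)"
      unfolding form_kernel_grid_form_eq[OF t] b_def[symmetric]
      by (rule sum_power2_orthogonal) (use b01 orth in auto)
    also have "ennreal \<dots> = (\<Sum>k\<in>offdiag_indices q m. ennreal ((a k)\<^sup>2 * b y k))"
      by (intro sum_ennreal[symmetric] mult_nonneg_nonneg) (auto simp: b_def intro!: prod_nonneg)
    also have "\<dots> = (\<Sum>k\<in>offdiag_indices q m. ennreal ((a k)\<^sup>2) *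
          (\<Prod>i<q. indicator {t (k i)<..t (Suc (k i))} (y i)))"
      unfolding b_def
      by (intro sum.cong refl) (simp add: ennreal_mult prod_nonneg prod_ennreal[symmetric] ennreal_indicator)
    finally show "ennreal ((form_kernel (grid_form q m t a) y)\<^sup>2) = (\<Sum>k\<in>offdiag_indices q m. ennreal ((a k)\<^sup>2) *
          (\<Prod>i<q. indicator {t (k i)<..t (Suc (k i))} (y i)))" .
  qed
  also have "\<dots> = (\<Sum>k\<in>offdiag_indices q m. \<integral>\<^sup>+y. ennreal ((a k)\<^sup>2) *
          (\<Prod>i<q. indicator {t (k i)<..t (Suc (k i))} (y i)) \<partial>lborel_pi q)"
    by (intro nn_integral_sum borel_measurable_times borel_measurable_prod) auto
  also have "\<dots> = (\<Sum>k\<in>offdiag_indices q m. ennreal ((a k)\<^sup>2) *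
      (\<integral>\<^sup>+y. (\<Prod>i<q. indicator {t (k i)<..t (Suc (k i))} (y i)) \<partial>lborel_pi q))"
    by (intro sum.cong refl nn_integral_cmult borel_measurable_prod) auto
  also have "\<dots> = (\<Sum>k\<in>offdiag_indices q m. ennreal ((a k)\<^sup>2 * (\<Prod>i<q. t (Suc (k i)) - t (k i))))"
  proof (intro sum.cong refl)
    fix k assume k: "k \<in> offdiag_indices q m"
    have "(\<integral>\<^sup>+y. (\<Prod>i<q. indicator {t (k i)<..t (Suc (k i))} (y i)) \<partial>lborel_pi q) =
       (\<Prod>i<q. \<integral>\<^sup>+x. indicator {t (k i)<..t (Suc (k i))} x \<partial>lborel)"
      by (intro lborel_product.product_nn_integral_prod) auto
    also have "\<dots> = (\<Prod>i<q. ennreal (t (Suc (k i)) - t (k i)))"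
      using len[OF k] by (intro prod.cong) auto
    also have "\<dots> = ennreal (\<Prod>i<q. t (Suc (k i)) - t (k i))"
      using len[OF k] by (intro prod_ennreal) auto
    finally show "ennreal ((a k)\<^sup>2) * (\<integral>\<^sup>+y. (\<Prod>i<q. indicator {t (k i)<..t (Suc (k i))} (y i)) \<partial>lborel_pi q) =
       ennreal ((a k)\<^sup>2 * (\<Prod>i<q. t (Suc (k i)) - t (k i)))"
      using len[OF k] by (subst ennreal_mult) (auto intro!: prod_nonneg)
  qed
  also have "\<dots> = ennreal (grid_norm2 q m t a)"
    unfolding grid_norm2_def using len by (intro sum_ennreal mult_nonneg_nonneg prod_nonneg) auto
  finally show ?thesis .
qed

text \<open>The factor \<open>bonami_const r ^ q\<close> comes from the weight of a monomial of
  degree q, and \<open>q ^ q\<close> bounds the number of multi-indices that give the same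
  monomial.\<close>

definition chaos_const :: "nat \<Rightarrow> nat \<Rightarrow> real" where
  "chaos_const q r = (bonami_const r ^ q * real (q ^ q)) ^ r"

lemma chaos_const_nonneg: "chaos_const q r \<ge> 0"
  using bonami_const_ge_1[of r] by (auto simp: chaos_const_def)

text \<open>Kernels are not symmetric, so the coefficient of the monomial over a set S collects all
  multi-indices with image S. Cauchy-Schwarz replaces the square of this sum by the sum of the
  squares at the cost of their number.\<close>

lemma nn_integral_grid_polynomial_power_le:
  assumes t: "strict_mono_on {..m} t" and r: "r \<ge> 1"
  shows "(\<integral>\<^sup>+x. ennreal (grid_polynomial q m t a x ^ (2 * r)) \<partial>PiM {..<m} (\<lambda>_. gauss))
    \<le> ennreal (chaos_const q r * grid_norm2 q m t a ^ r)"
proof -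
  define w where "w k = a k * (\<Prod>i<q. sqrt (t (Suc (k i)) - t (k i)))" for k
  define F where "F S = {k \<in> offdiag_indices q m. k ` {..<q} = S}" for S
  define c where "c S = (\<Sum>k\<in>F S. w k)" for S
  let ?K = "bonami_const r"
  have K: "?K \<ge> 1" by (rule bonami_const_ge_1)
  have im: "k ` {..<q} \<in> Pow {..<m}" if "k \<in> offdiag_indices q m" for k
    using offdiag_indicesD[OF that] by auto
  have len: "0 \<le> t (Suc (k i)) - t (k i)" if "k \<in> offdiag_indices q m" "i < q" for k i
    using grid_cell_less[OF t that] by simp
  have poly: "grid_polynomial q m t a x = (\<Sum>S\<in>Pow {..<m}. c S * (\<Prod>j\<in>S. x j))" for x
  proof -
    have "grid_polynomial q m t a x = (\<Sum>k\<in>offdiag_indices q m. w k * (\<Prod>j\<in>k ` {..<q}. x j))"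
      unfolding grid_polynomial_def w_def
      by (intro sum.cong refl arg_cong2[where f="(*)"])
        (auto simp: prod.reindex offdiag_indices_def)
    also have "\<dots> = (\<Sum>S\<in>Pow {..<m}. \<Sum>k\<in>F S. w k * (\<Prod>j\<in>k ` {..<q}. x j))"
      unfolding F_def using im by (intro sum.group[symmetric]) auto
    also have "\<dots> = (\<Sum>S\<in>Pow {..<m}. c S * (\<Prod>j\<in>S. x j))"
      unfolding c_def by (intro sum.cong refl) (auto simp: sum_distrib_right F_def)
    finally show ?thesis .
  qed
  have card_F: "card (F S) \<le> q ^ q" for S
  proof (cases "F S = {}")
    case False
    then have "card S \<le> q" "finite S"
      by (auto simp: F_def card_image intro!: card_image_le[of "{..<q}", simplified])
    moreover have "F S \<subseteq> {..<q} \<rightarrow>\<^sub>E S" by (auto simp: F_def offdiag_indices_def PiE_def)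
    then have "card (F S) \<le> card ({..<q} \<rightarrow>\<^sub>E S)" using \<open>finite S\<close> by (intro card_mono finite_PiE) auto
    ultimately show ?thesis
      by (auto simp: card_PiE intro: order_trans[OF _ power_mono])
  qed auto
  have "(\<Sum>S\<in>Pow {..<m}. ?K ^ card S * (c S)\<^sup>2) \<le>
     (\<Sum>S\<in>Pow {..<m}. ?K ^ q * (real (q ^ q) * (\<Sum>k\<in>F S. (w k)\<^sup>2)))"
  proof (rule sum_mono)
    fix S
    show "?K ^ card S * (c S)\<^sup>2 \<le> ?K ^ q * (real (q ^ q) * (\<Sum>k\<in>F S. (w k)\<^sup>2))"
    proof (cases "F S = {}")
      case True
      then show ?thesis by (simp add: c_def)
    next
      case False
      \<comment> \<open>Only images of q-element index sets carry a coefficient, and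
        \<open>bonami_const r\<close> is at least 1, so the weight is at most its q-th
        power.\<close>
      then have "card S \<le> q" by (auto simp: F_def intro!: card_image_le[of "{..<q}", simplified])
      have "(c S)\<^sup>2 \<le> (\<Sum>k\<in>F S. (w k)\<^sup>2) * real (card (F S))"
        unfolding c_def by (rule sum_squared_le_sum_of_squares)
      also have "\<dots> \<le> (\<Sum>k\<in>F S. (w k)\<^sup>2) * real (q ^ q)"
        using card_F[of S] by (intro mult_left_mono sum_nonneg) (auto simp flip: of_nat_power)
      finally have "(c S)\<^sup>2 \<le> real (q ^ q) * (\<Sum>k\<in>F S. (w k)\<^sup>2)" by (simp add: mult.commute)
      then show ?thesis using K \<open>card S \<le> q\<close> by (intro mult_mono power_increasing) auto
    qed
  qed
  also have "\<dots> = ?K ^ q * real (q ^ q) * (\<Sum>S\<in>Pow {..<m}. \<Sum>k\<in>F S. (w k)\<^sup>2)"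
    by (simp add: sum_distrib_left mult_ac)
  also have "(\<Sum>S\<in>Pow {..<m}. \<Sum>k\<in>F S. (w k)\<^sup>2) = (\<Sum>k\<in>offdiag_indices q m. (w k)\<^sup>2)"
    unfolding F_def using im by (intro sum.group) auto
  also have "\<dots> = grid_norm2 q m t a"
    unfolding grid_norm2_def w_def power_mult_distrib prod_power_distrib
    by (intro sum.cong refl arg_cong2[where f="(*)"] prod.cong real_sqrt_pow2 len) auto
  finally have le: "(\<Sum>S\<in>Pow {..<m}. ?K ^ card S * (c S)\<^sup>2) \<le> ?K ^ q * real (q ^ q) * grid_norm2 q m t a" .
  have "(\<integral>\<^sup>+x. ennreal (grid_polynomial q m t a x ^ (2 * r)) \<partial>PiM {..<m} (\<lambda>_. gauss))
    \<le> ennreal ((\<Sum>S\<in>Pow {..<m}. ?K ^ card S * (c S)\<^sup>2) ^ r)"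
    unfolding poly by (rule nn_integral_gauss_multilinear_power_le) (use r in auto)
  also have "\<dots> \<le> ennreal ((?K ^ q * real (q ^ q) * grid_norm2 q m t a) ^ r)"
    using le K by (intro ennreal_leI power_mono sum_nonneg) auto
  finally show ?thesis by (simp add: chaos_const_def power_mult_distrib mult_ac)
qed

section \<open>Moments, scaling and independence of elementary integrals\<close>

locale brownian_motion =
  fixes M :: "'a measure" and B :: "real \<Rightarrow> 'a \<Rightarrow> real"
  assumes bm: "two_sided_brownian_motion M B"
begin

sublocale prob_space M
  using bm by (simp add: two_sided_brownian_motion_def)

lemma measurable_B [measurable]: "B t \<in> borel_measurable M"
  using bm by (simp add: two_sided_brownian_motion_def)

definition std_increment :: "(nat \<Rightarrow> real) \<Rightarrow> nat \<Rightarrow> 'a \<Rightarrow> real" where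
  "std_increment t j \<omega> = (B (t (Suc j)) \<omega> - B (t j) \<omega>) / sqrt (t (Suc j) - t j)"

lemma measurable_std_increment [measurable]: "std_increment t j \<in> borel_measurable M"
  unfolding std_increment_def[abs_def] by measurable

lemma distr_std_increment:
  assumes "t j < t (Suc j)"
  shows "distr M borel (std_increment t j) = gauss"
proof -
  have "distributed M lborel (\<lambda>\<omega>. B (t (Suc j)) \<omega> - B (t j) \<omega>) (normal_density 0 (sqrt (t (Suc j) - t j)))"
    using bm assms by (simp add: two_sided_brownian_motion_def)
  then have "distributed M lborel (std_increment t j) std_normal_density"
    unfolding std_increment_def[abs_def] using assms by (subst (asm) normal_standard_normal_convert) auto
  then have "distr M lborel (std_increment t j) = gauss" by (simp add: distributed_def)
  then show ?thesis by (metis distr_cong sets_lborel)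
qed

lemma indep_vars_std_increment:
  assumes "strict_mono_on {..m} t"
  shows "indep_vars (\<lambda>_. borel) (std_increment t) {..<m}"
proof -
  have "indep_vars (\<lambda>_. borel) (\<lambda>i \<omega>. B (t (Suc i)) \<omega> - B (t i) \<omega>) {..<m}"
    using bm assms by (simp add: two_sided_brownian_motion_def)
  then have "indep_vars (\<lambda>_. borel) (\<lambda>i \<omega>. (\<lambda>x. x / sqrt (t (Suc i) - t i)) (B (t (Suc i)) \<omega> - B (t i) \<omega>)) {..<m}"
    by (rule indep_vars_compose2) auto
  then show ?thesis by (simp add: std_increment_def[abs_def])
qed

lemma distr_std_increments:
  assumes t: "strict_mono_on {..m} t"
  shows "distr M (PiM {..<m} (\<lambda>_. borel)) (\<lambda>\<omega>. \<lambda>j\<in>{..<m}. std_increment t j \<omega>) = PiM {..<m} (\<lambda>_. gauss)"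
proof (cases "m = 0")
  \<comment> \<open>A grid with a single point has no increments: both sides are the point mass of
    the one-point product space.\<close>
  case True
  have "distr M (PiM {} (\<lambda>_. borel)) (\<lambda>\<omega> _. undefined) = PiM {} (\<lambda>_::nat. gauss)"
  proof (subst distr_const)
    show "return (PiM {} (\<lambda>_. borel)) (\<lambda>_. undefined) = PiM {} (\<lambda>_::nat. gauss)"
    proof (rule measure_eqI)
      fix A assume "A \<in> sets (return (PiM {} (\<lambda>_::nat. borel :: real measure)) (\<lambda>_. undefined))"
      then consider "A = {}" | "A = {\<lambda>_. undefined}" by (auto simp: sets_PiM_empty)
      then show "emeasure (return (PiM {} (\<lambda>_. borel)) (\<lambda>_. undefined)) A = emeasure (PiM {} (\<lambda>_::nat. gauss)) A"
        by cases (auto simp: sets_PiM_empty emeasure_PiM_empty)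
    qed (simp add: sets_PiM_empty)
  qed (simp add: space_PiM_empty)
  then show ?thesis using True by (simp add: restrict_def)
next
  case False
  then have "distr M (PiM {..<m} (\<lambda>_. borel)) (\<lambda>\<omega>. \<lambda>j\<in>{..<m}. std_increment t j \<omega>) =
      PiM {..<m} (\<lambda>j. distr M borel (std_increment t j))"
    using indep_vars_std_increment[OF t] by (subst (asm) indep_vars_iff_distr_eq_PiM) auto
  also have "\<dots> = PiM {..<m} (\<lambda>_. gauss)"
    by (intro PiM_cong distr_std_increment) (auto intro!: strict_mono_on_grid_less[OF t])
  finally show ?thesis .
qed

lemma form_integral_grid_form_eq:
  assumes t: "strict_mono_on {..m} t"
  shows "form_integral B (grid_form q m t a) \<omega> = grid_polynomial q m t a (\<lambda>j\<in>{..<m}. std_increment t j \<omega>)"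
  unfolding form_integral_def grid_form_def grid_polynomial_def mult.assoc prod.distrib[symmetric]
proof (intro sum.cong refl arg_cong2[where f="(*)"] prod.cong)
  fix k i assume k: "k \<in> offdiag_indices q m" and "i \<in> {..<q}"
  then have "k i < m" "t (k i) < t (Suc (k i))"
    using grid_cell_less[OF t k] offdiag_indicesD[OF k] by auto
  then show "B (t (Suc (k i))) \<omega> - B (t (k i)) \<omega> =
      sqrt (t (Suc (k i)) - t (k i)) * (\<lambda>j\<in>{..<m}. std_increment t j \<omega>) (k i)"
    by (simp add: std_increment_def)
qed

lemma measurable_form_integral:
  assumes "s \<in> elementary_forms q"
  shows "form_integral B s \<in> borel_measurable M"
proof -
  from assms obtain m t a where "s = grid_form q m t a" by (auto simp: elementary_forms_def)
  then show ?thesis unfolding form_integral_def[abs_def] grid_form_def by simp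
qed

lemma borel_measurable_grid_polynomial [measurable]:
  "grid_polynomial q m t a \<in> borel_measurable (PiM {..<m} (\<lambda>_. borel))"
  unfolding grid_polynomial_def[abs_def]
  by (intro borel_measurable_sum borel_measurable_times borel_measurable_prod
      measurable_component_singleton) (auto dest: offdiag_indicesD)

text \<open>The integral has the law of its polynomial under the Gaussian product measure. The bound
  involves the kernel alone and not the grid, which lets it pass to limits of elementary
  kernels.\<close>

lemma form_integral_power_le:
  assumes s: "s \<in> elementary_forms q" and r: "r \<ge> 1"
  shows "(\<integral>\<^sup>+\<omega>. ennreal (form_integral B s \<omega> ^ (2 * r)) \<partial>M) \<le>
    ennreal (chaos_const q r) * (\<integral>\<^sup>+y. ennreal ((form_kernel s y)\<^sup>2) \<partial>lborel_pi q) ^ r"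
proof -
  from s obtain m t a where t: "strict_mono_on {..m} t" and s: "s = grid_form q m t a"
    by (auto simp: elementary_forms_def)
  have n2: "grid_norm2 q m t a \<ge> 0"
    unfolding grid_norm2_def using strict_mono_on_grid_le[OF t] offdiag_indicesD
    by (intro sum_nonneg mult_nonneg_nonneg prod_nonneg) (auto simp: Suc_leI)
  have [measurable]: "(\<lambda>\<omega>. \<lambda>j\<in>{..<m}. std_increment t j \<omega>) \<in> measurable M (PiM {..<m} (\<lambda>_. borel))"
    by measurable
  have "(\<integral>\<^sup>+\<omega>. ennreal (form_integral B s \<omega> ^ (2 * r)) \<partial>M) =
     (\<integral>\<^sup>+x. ennreal (grid_polynomial q m t a x ^ (2 * r)) \<partial>PiM {..<m} (\<lambda>_. gauss))"
    unfolding s form_integral_grid_form_eq[OF t] distr_std_increments[OF t, symmetric]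
    by (subst nn_integral_distr) auto
  also have "\<dots> \<le> ennreal (chaos_const q r * grid_norm2 q m t a ^ r)"
    by (rule nn_integral_grid_polynomial_power_le[OF t r])
  also have "\<dots> = ennreal (chaos_const q r) * (\<integral>\<^sup>+y. ennreal ((form_kernel s y)\<^sup>2) \<partial>lborel_pi q) ^ r"
    unfolding s nn_integral_form_kernel_power2[OF t]
    using n2 chaos_const_nonneg by (simp add: ennreal_mult ennreal_power)
  finally show ?thesis .
qed

lemma affine_in_elementary_forms:
  assumes "s \<in> elementary_forms q" "e > 0"
  shows "(\<lambda>\<phi>. c * s (\<lambda>i \<tau>. \<phi> i (x + e * \<tau>))) \<in> elementary_forms q"
proof -
  from assms obtain m t a where t: "strict_mono_on {..m} t" and s: "s = grid_form q m t a"
    by (auto simp: elementary_forms_def)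
  have "strict_mono_on {..m} (\<lambda>i. x + e * t i)"
    using strict_mono_onD[OF t] assms(2) by (intro strict_mono_onI) auto
  moreover have "(\<lambda>\<phi>. c * s (\<lambda>i \<tau>. \<phi> i (x + e * \<tau>))) = grid_form q m (\<lambda>i. x + e * t i) (\<lambda>k. c * a k)"
    by (simp add: fun_eq_iff s grid_form_def sum_distrib_left mult_ac)
  ultimately show ?thesis unfolding elementary_forms_def by blast
qed

text \<open>Brownian scaling: an affine map of the grid multiplies all cell lengths by e, hence the
  polynomial by \<open>sqrt e ^ q\<close>, while the standardised increments keep their joint
  law.\<close>

lemma distr_form_integral_affine:
  assumes "s \<in> elementary_forms q" "e > 0"
  shows "distr M borel (form_integral B (\<lambda>\<phi>. s (\<lambda>i \<tau>. \<phi> i (x + e * \<tau>)))) =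
    distr M borel (\<lambda>\<omega>. sqrt e ^ q * form_integral B s \<omega>)"
proof -
  from assms obtain m t a where t: "strict_mono_on {..m} t" and s: "s = grid_form q m t a"
    by (auto simp: elementary_forms_def)
  let ?t = "\<lambda>i. x + e * t i"
  have t': "strict_mono_on {..m} ?t"
    using strict_mono_onD[OF t] assms(2) by (intro strict_mono_onI) auto
  have poly: "grid_polynomial q m ?t a = (\<lambda>z. sqrt e ^ q * grid_polynomial q m t a z)"
  proof
    fix z
    have "(\<Prod>i<q. sqrt (?t (Suc (k i)) - ?t (k i))) = sqrt e ^ q * (\<Prod>i<q. sqrt (t (Suc (k i)) - t (k i)))" for k :: "nat \<Rightarrow> nat"
      by (simp add: right_diff_distrib[symmetric] real_sqrt_mult prod.distrib)
    then show "grid_polynomial q m ?t a z = sqrt e ^ q * grid_polynomial q m t a z"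
      by (simp add: grid_polynomial_def sum_distrib_left mult_ac)
  qed
  have 1: "(\<lambda>\<phi>. s (\<lambda>i \<tau>. \<phi> i (x + e * \<tau>))) = grid_form q m ?t a"
    by (simp add: fun_eq_iff s grid_form_def)
  have "distr M borel (form_integral B (grid_form q m ?t a)) =
     distr M borel (grid_polynomial q m ?t a \<circ> (\<lambda>\<omega>. \<lambda>j\<in>{..<m}. std_increment ?t j \<omega>))"
    by (intro distr_cong) (auto simp: form_integral_grid_form_eq[OF t'])
  also have "\<dots> = distr (PiM {..<m} (\<lambda>_. gauss)) borel (\<lambda>z. sqrt e ^ q * grid_polynomial q m t a z)"
    unfolding distr_std_increments[OF t', symmetric] poly
    by (rule distr_distr[symmetric]) measurable
  also have "\<dots> = distr M borel ((\<lambda>z. sqrt e ^ q * grid_polynomial q m t a z) \<circ> (\<lambda>\<omega>. \<lambda>j\<in>{..<m}. std_increment t j \<omega>))"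
    unfolding distr_std_increments[OF t, symmetric]
    by (rule distr_distr) measurable
  also have "\<dots> = distr M borel (\<lambda>\<omega>. sqrt e ^ q * form_integral B s \<omega>)"
    by (intro distr_cong) (auto simp: s form_integral_grid_form_eq[OF t])
  finally show ?thesis unfolding 1 .
qed

lemma clamp_form_in_elementary_forms:
  assumes q: "q \<ge> 1" and s: "s \<in> elementary_forms q" and le: "lo \<le> hi"
  shows "clamp_form lo hi s \<in> elementary_forms q"
proof -
  obtain T a where T: "finite T" "T \<noteq> {}" "{lo, hi} \<subseteq> T" "s = grid_form q (card T - 1) (enum_set T) a"
    using elementary_forms_common_grid[OF s s, of "{lo, hi}"] by blast
  show ?thesis unfolding T(4)
    by (subst clamp_form_grid_form[OF q T(1) _ _ le])
      (use T(3) enum_grid_in_elementary_forms[OF T(1,2)] in auto)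
qed

text \<open>On a grid containing all four end points, the two integrals are functions
  \<open>G\<close> of the standardised increments over disjoint sets of cells.\<close>

lemma indep_var_form_integral_clamp:
  assumes q: "q \<ge> 1" and s: "s \<in> elementary_forms q" "s' \<in> elementary_forms q"
    and le: "lo \<le> hi" "hi \<le> lo'" "lo' \<le> hi'"
  shows "indep_var borel (form_integral B (clamp_form lo hi s)) borel (form_integral B (clamp_form lo' hi' s'))"
proof -
  obtain T a a' where T: "finite T" "T \<noteq> {}" "{lo, hi, lo', hi'} \<subseteq> T"
    and s_eq: "s = grid_form q (card T - 1) (enum_set T) a" "s' = grid_form q (card T - 1) (enum_set T) a'"
    using elementary_forms_common_grid[OF s, of "{lo, hi, lo', hi'}"] by blast
  define m where "m = card T - 1"
  define t where "t = enum_set T"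
  have t: "strict_mono_on {..m} t" unfolding m_def t_def by (rule strict_mono_on_enum_set[OF T(1,2)])
  define A where "A = {j. j < m \<and> lo \<le> t j \<and> t (Suc j) \<le> hi}"
  define A' where "A' = {j. j < m \<and> lo' \<le> t j \<and> t (Suc j) \<le> hi'}"
  define G :: "((nat \<Rightarrow> nat) \<Rightarrow> real) \<Rightarrow> nat set \<Rightarrow> (nat \<Rightarrow> real) \<Rightarrow> real"
    where "G a A x = (\<Sum>k\<in>{k\<in>offdiag_indices q m. \<forall>i<q. k i \<in> A}.
    (a k * (\<Prod>i<q. sqrt (t (Suc (k i)) - t (k i)))) * (\<Prod>i<q. x (k i)))" for a A x
  \<comment> \<open>The intervals may touch; a cell in both would have to lie left and right of the
    common point, but cells have positive length.\<close>
  have disj: "A \<inter> A' = {}"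
  proof (rule equals0I)
    fix j assume "j \<in> A \<inter> A'"
    moreover from this have "t j < t (Suc j)"
      by (intro strict_mono_on_grid_less[OF t]) (auto simp: A_def)
    ultimately show False using le by (simp add: A_def A'_def)
  qed
  have G_measurable: "G a A \<in> borel_measurable (PiM A (\<lambda>_. borel))" for a A
    unfolding G_def by (intro borel_measurable_sum borel_measurable_times borel_measurable_prod
      measurable_component_singleton) auto
  have G_eq: "form_integral B (clamp_form lo hi (grid_form q m t a)) =
      G a {j. j < m \<and> lo \<le> t j \<and> t (Suc j) \<le> hi} \<circ>
      (\<lambda>\<omega>. \<lambda>j\<in>{j. j < m \<and> lo \<le> t j \<and> t (Suc j) \<le> hi}. std_increment t j \<omega>)"
    if "lo \<in> T" "hi \<in> T" "lo \<le> hi" for lo hi a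
  proof
    fix \<omega>
    let ?A = "{j. j < m \<and> lo \<le> t j \<and> t (Suc j) \<le> hi}"
    define a' where "a' k = (if \<forall>i<q. lo \<le> t (k i) \<and> t (Suc (k i)) \<le> hi then a k else 0)" for k
    have "clamp_form lo hi (grid_form q m t a) = grid_form q m t a'"
      unfolding m_def t_def a'_def using clamp_form_grid_form[OF q T(1) that] by simp
    then have "form_integral B (clamp_form lo hi (grid_form q m t a)) \<omega> =
        grid_polynomial q m t a' (\<lambda>j\<in>{..<m}. std_increment t j \<omega>)"
      using form_integral_grid_form_eq[OF t] by simp
    also have "\<dots> = G a ?A (\<lambda>j\<in>?A. std_increment t j \<omega>)"
      unfolding grid_polynomial_def G_def
    proof (rule sum.mono_neutral_cong_right)
      show "\<forall>k\<in>offdiag_indices q m - {k \<in> offdiag_indices q m. \<forall>i<q. k i \<in> ?A}.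
         a' k * (\<Prod>i<q. sqrt (t (Suc (k i)) - t (k i))) * (\<Prod>i<q. (\<lambda>j\<in>{..<m}. std_increment t j \<omega>) (k i)) = 0"
        using offdiag_indicesD by (auto simp: a'_def)
    next
      fix k assume k: "k \<in> {k \<in> offdiag_indices q m. \<forall>i<q. k i \<in> ?A}"
      then have "a' k = a k" by (auto simp: a'_def)
      moreover have "(\<Prod>i<q. (\<lambda>j\<in>{..<m}. std_increment t j \<omega>) (k i)) = (\<Prod>i<q. (\<lambda>j\<in>?A. std_increment t j \<omega>) (k i))"
        using k by (intro prod.cong) auto
      ultimately show "a' k * (\<Prod>i<q. sqrt (t (Suc (k i)) - t (k i))) * (\<Prod>i<q. (\<lambda>j\<in>{..<m}. std_increment t j \<omega>) (k i)) =
        a k * (\<Prod>i<q. sqrt (t (Suc (k i)) - t (k i))) * (\<Prod>i<q. (\<lambda>j\<in>?A. std_increment t j \<omega>) (k i))"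
        by simp
    qed auto
    finally show "form_integral B (clamp_form lo hi (grid_form q m t a)) \<omega> = (G a ?A \<circ> (\<lambda>\<omega>. \<lambda>j\<in>?A. std_increment t j \<omega>)) \<omega>"
      by simp
  qed
  have "indep_var (PiM A (\<lambda>_. borel)) (\<lambda>\<omega>. \<lambda>j\<in>A. std_increment t j \<omega>) (PiM A' (\<lambda>_. borel)) (\<lambda>\<omega>. \<lambda>j\<in>A'. std_increment t j \<omega>)"
    by (rule indep_var_restrict[OF indep_vars_std_increment[OF t]]) (use disj in \<open>auto simp: A_def A'_def\<close>)
  from indep_var_compose[OF this G_measurable[of a A] G_measurable[of a' A']]
  show ?thesis
    using G_eq[of lo hi a] G_eq[of lo' hi' a'] T(3) le unfolding s_eq m_def[symmetric] t_def[symmetric] A_def A'_def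
    by simp
qed

end

subsection \<open>Square integrable functions\<close>

text \<open>The squared L^2 norm takes extended values, so it applies to kernels and random
  variables whose square integrability is still to be shown.\<close>

definition sqnorm :: "'b measure \<Rightarrow> ('b \<Rightarrow> real) \<Rightarrow> ennreal" where
  "sqnorm M f = (\<integral>\<^sup>+x. ennreal ((f x)\<^sup>2) \<partial>M)"

lemma sqnorm_mono_AE:
  "(AE x in M. \<bar>f x\<bar> \<le> \<bar>g x\<bar>) \<Longrightarrow> sqnorm M f \<le> sqnorm M g"
  unfolding sqnorm_def by (rule nn_integral_mono_AE) (auto elim!: eventually_mono simp: abs_le_square_iff)

lemma sqnorm_cong_AE: "(AE x in M. f x = g x) \<Longrightarrow> sqnorm M f = sqnorm M g"
  by (intro antisym sqnorm_mono_AE) (auto elim: eventually_mono)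

lemma sqnorm_cmult:
  assumes [measurable]: "u \<in> borel_measurable M"
  shows "sqnorm M (\<lambda>x. c * u x) = ennreal (c\<^sup>2) * sqnorm M u"
  unfolding sqnorm_def by (subst nn_integral_cmult[symmetric]) (auto simp: power_mult_distrib ennreal_mult)

text \<open>The inequality (cx + dy)^2 \<le> 2 c^2 x^2 + 2 d^2 y^2 replaces the triangle inequality
  for squared norms; the factors 2 and 4 in later bounds come from here.\<close>

lemma sqnorm_lincomb_le:
  assumes [measurable]: "u \<in> borel_measurable M" "v \<in> borel_measurable M"
    and u: "sqnorm M u \<le> ennreal a" and v: "sqnorm M v \<le> ennreal b" and ab: "a \<ge> 0" "b \<ge> 0"
  shows "sqnorm M (\<lambda>x. c * u x + d * v x) \<le> ennreal (2 * c\<^sup>2 * a + 2 * d\<^sup>2 * b)"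
proof -
  have "(c * x + d * y)\<^sup>2 \<le> 2 * c\<^sup>2 * x\<^sup>2 + 2 * d\<^sup>2 * y\<^sup>2" for x y :: real
    using zero_le_power2[of "c * x - d * y"] by (simp add: power2_eq_square algebra_simps)
  then have "sqnorm M (\<lambda>x. c * u x + d * v x) \<le>
      (\<integral>\<^sup>+x. ennreal (2 * c\<^sup>2) * ennreal ((u x)\<^sup>2) + ennreal (2 * d\<^sup>2) * ennreal ((v x)\<^sup>2) \<partial>M)"
    unfolding sqnorm_def
    by (intro nn_integral_mono) (simp add: ennreal_mult[symmetric] flip: ennreal_plus)
  also have "\<dots> = ennreal (2 * c\<^sup>2) * sqnorm M u + ennreal (2 * d\<^sup>2) * sqnorm M v"
    unfolding sqnorm_def by (subst nn_integral_add) (auto simp: nn_integral_cmult)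
  also have "\<dots> \<le> ennreal (2 * c\<^sup>2) * ennreal a + ennreal (2 * d\<^sup>2) * ennreal b"
    by (intro add_mono mult_left_mono u v) auto
  also have "\<dots> = ennreal (2 * c\<^sup>2 * a + 2 * d\<^sup>2 * b)"
    using ab by (simp add: ennreal_mult[symmetric] flip: ennreal_plus)
  finally show ?thesis .
qed

lemma lincomb_tolerance:
  fixes c d \<epsilon> :: real
  assumes "\<epsilon> > 0"
  shows "\<exists>e>0. ennreal (2 * c\<^sup>2 * e + 2 * d\<^sup>2 * e) \<le> ennreal \<epsilon>"
proof (intro exI[of _ "\<epsilon> / (2 * c\<^sup>2 + 2 * d\<^sup>2 + 1)"] conjI ennreal_leI)
  have pos: "2 * c\<^sup>2 + 2 * d\<^sup>2 + 1 > 0" by (intro add_nonneg_pos) auto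
  then show e: "\<epsilon> / (2 * c\<^sup>2 + 2 * d\<^sup>2 + 1) > 0" using assms by simp
  have "2 * c\<^sup>2 * e + 2 * d\<^sup>2 * e \<le> (2 * c\<^sup>2 + 2 * d\<^sup>2 + 1) * e" if "e > 0" for e
    using that by (simp add: algebra_simps)
  from this[OF e] show "2 * c\<^sup>2 * (\<epsilon> / (2 * c\<^sup>2 + 2 * d\<^sup>2 + 1)) + 2 * d\<^sup>2 * (\<epsilon> / (2 * c\<^sup>2 + 2 * d\<^sup>2 + 1)) \<le> \<epsilon>"
    using pos by simp
qed

text \<open>Arguments by approximation need a positive tolerance, while a norm bound D may be 0.
  They are carried out for every d > D, and continuity gives the bound at D.\<close>

lemma ennreal_le_at_right_limit:
  fixes g :: "real \<Rightarrow> real"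
  assumes "\<And>d. d > D \<Longrightarrow> x \<le> ennreal (g d)" "continuous (at_right D) g"
  shows "x \<le> ennreal (g D)"
proof (rule tendsto_lowerbound)
  show "((\<lambda>d. ennreal (g d)) \<longlongrightarrow> ennreal (g D)) (at_right D)"
    using assms(2) by (intro tendsto_ennrealI) (simp add: continuous_within)
  show "\<forall>\<^sub>F d in at_right D. x \<le> ennreal (g d)"
    using assms(1) by (auto simp: eventually_at_filter)
qed simp

context prob_space
begin

lemma sqnorm_bound_integrable:
  assumes [measurable]: "u \<in> borel_measurable M" and u: "sqnorm M u \<le> ennreal D" and D: "D \<ge> 0"
  shows "integrable M (\<lambda>x. (u x)\<^sup>2)" "integrable M u" "(\<integral>x. (u x)\<^sup>2 \<partial>M) \<le> D"
    "(\<integral>x. \<bar>u x\<bar> \<partial>M) \<le> sqrt D"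
proof -
  have "(\<integral>\<^sup>+x. ennreal ((u x)\<^sup>2) \<partial>M) < \<infinity>"
    using u unfolding sqnorm_def by (auto intro: le_less_trans)
  then show 1: "integrable M (\<lambda>x. (u x)\<^sup>2)" by (intro integrableI_nonneg) auto
  then show 2: "integrable M u" by (rule square_integrable_imp_integrable[rotated]) auto
  have "ennreal (\<integral>x. (u x)\<^sup>2 \<partial>M) \<le> ennreal D"
    using u 1 by (subst nn_integral_eq_integral[symmetric]) (auto simp: sqnorm_def)
  then show 3: "(\<integral>x. (u x)\<^sup>2 \<partial>M) \<le> D" using D by simp
  \<comment> \<open>Nonnegativity of the variance of |u| is the inequality between the first and
    second absolute moment.\<close>
  have "0 \<le> variance (\<lambda>x. \<bar>u x\<bar>)" by (rule variance_positive)
  also have "\<dots> = (\<integral>x. \<bar>u x\<bar>\<^sup>2 \<partial>M) - (\<integral>x. \<bar>u x\<bar> \<partial>M)\<^sup>2"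
    using 1 2 by (intro variance_eq) auto
  finally have "(\<integral>x. \<bar>u x\<bar> \<partial>M)\<^sup>2 \<le> D" using 3 by simp
  then show "(\<integral>x. \<bar>u x\<bar> \<partial>M) \<le> sqrt D" by (rule real_le_rsqrt)
qed

lemma sqnorm_bound_mult:
  assumes [measurable]: "u \<in> borel_measurable M" "v \<in> borel_measurable M"
    and u: "sqnorm M u \<le> ennreal D" and v: "sqnorm M v \<le> ennreal E" and D: "D \<ge> 0" and E: "E \<ge> 0"
  shows "integrable M (\<lambda>x. u x * v x)" "(\<integral>x. \<bar>u x * v x\<bar> \<partial>M) \<le> sqrt (D * E)"
proof -
  have "(\<integral>\<^sup>+x. ennreal \<bar>u x\<bar> * ennreal \<bar>v x\<bar> \<partial>M)\<^sup>2 \<le>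
      (\<integral>\<^sup>+x. (ennreal \<bar>u x\<bar>)\<^sup>2 \<partial>M) * (\<integral>\<^sup>+x. (ennreal \<bar>v x\<bar>)\<^sup>2 \<partial>M)"
    by (rule Cauchy_Schwarz_nn_integral) auto
  also have "\<dots> = sqnorm M u * sqnorm M v" by (simp add: sqnorm_def ennreal_power)
  also have "\<dots> \<le> ennreal D * ennreal E" by (intro mult_mono u v) auto
  finally have *: "(\<integral>\<^sup>+x. ennreal \<bar>u x * v x\<bar> \<partial>M)\<^sup>2 \<le> ennreal (D * E)"
    using D E by (simp add: ennreal_mult abs_mult)
  then have "(\<integral>\<^sup>+x. ennreal \<bar>u x * v x\<bar> \<partial>M)\<^sup>2 < \<infinity>" by (rule le_less_trans) simp
  then have "(\<integral>\<^sup>+x. ennreal \<bar>u x * v x\<bar> \<partial>M) < \<infinity>" by (simp add: power_less_top_ennreal)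
  then show 1: "integrable M (\<lambda>x. u x * v x)" by (simp add: integrable_iff_bounded)
  have "(\<integral>\<^sup>+x. ennreal \<bar>u x * v x\<bar> \<partial>M) = ennreal (\<integral>x. \<bar>u x * v x\<bar> \<partial>M)"
    using 1 by (intro nn_integral_eq_integral) auto
  with * have "ennreal ((\<integral>x. \<bar>u x * v x\<bar> \<partial>M)\<^sup>2) \<le> ennreal (D * E)"
    by (simp add: ennreal_power)
  then have "(\<integral>x. \<bar>u x * v x\<bar> \<partial>M)\<^sup>2 \<le> D * E"
    using D E by simp
  then show "(\<integral>x. \<bar>u x * v x\<bar> \<partial>M) \<le> sqrt (D * E)" by (rule real_le_rsqrt)
qed

text \<open>The inequality |y| \<le> 2^n y^2 + 2^(-n) converts squared norms of order 4^(-n) into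
  L^1 norms of order 2^(-n), which are summable.\<close>

lemma AE_summable_of_sqnorm:
  assumes [measurable]: "\<And>n. u n \<in> borel_measurable M"
    and u: "\<And>n. sqnorm M (u n) \<le> ennreal (C * (1 / 4) ^ n)" and C: "C \<ge> 0"
  shows "AE x in M. summable (\<lambda>n. \<bar>u n x\<bar>)"
proof -
  have *: "(\<integral>\<^sup>+x. ennreal \<bar>u n x\<bar> \<partial>M) \<le> ennreal ((C + 1) * (1 / 2) ^ n)" for n
  proof -
    have "\<bar>y\<bar> \<le> 2 ^ n * y\<^sup>2 + (1 / 2) ^ n" for y :: real
    proof -
      have "0 \<le> (2 ^ n * \<bar>y\<bar> - 1)\<^sup>2" by simp
      then have "2 * (2 ^ n * \<bar>y\<bar>) \<le> (2 ^ n)\<^sup>2 * y\<^sup>2 + 1"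
        by (simp add: power2_diff power_mult_distrib)
      then have "2 ^ n * \<bar>y\<bar> \<le> (2 ^ n)\<^sup>2 * y\<^sup>2 + 1" by (smt (verit) zero_le_mult_iff zero_le_power abs_ge_zero)
      also have "\<dots> = 2 ^ n * (2 ^ n * y\<^sup>2 + (1 / 2) ^ n)"
        by (simp add: power2_eq_square distrib_left power_one_over)
      finally show ?thesis by simp
    qed
    then have "(\<integral>\<^sup>+x. ennreal \<bar>u n x\<bar> \<partial>M) \<le>
        (\<integral>\<^sup>+x. ennreal (2 ^ n) * ennreal ((u n x)\<^sup>2) + ennreal ((1 / 2) ^ n) \<partial>M)"
      by (intro nn_integral_mono) (simp add: ennreal_mult[symmetric] flip: ennreal_plus)
    also have "\<dots> = ennreal (2 ^ n) * sqnorm M (u n) + ennreal ((1 / 2) ^ n)"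
      unfolding sqnorm_def by (subst nn_integral_add) (auto simp: nn_integral_cmult emeasure_space_1)
    also have "\<dots> \<le> ennreal (2 ^ n) * ennreal (C * (1 / 4) ^ n) + ennreal ((1 / 2) ^ n)"
      by (intro add_mono mult_left_mono u) auto
    also have "\<dots> = ennreal (2 ^ n * (C * (1 / 4) ^ n) + (1 / 2) ^ n)"
      using C by (simp add: ennreal_mult[symmetric] flip: ennreal_plus)
    also have "2 ^ n * (C * (1 / 4) ^ n) + (1 / 2) ^ n = (C + 1) * (1 / 2) ^ n"
    proof -
      have "(1 / 4 :: real) ^ n = (1 / 2) ^ n * (1 / 2) ^ n" by (simp add: power_mult_distrib[symmetric])
      then show ?thesis by (simp add: power_one_over field_simps)
    qed
    finally show ?thesis .
  qed
  have "(\<integral>\<^sup>+x. (\<Sum>n. ennreal \<bar>u n x\<bar>) \<partial>M) = (\<Sum>n. \<integral>\<^sup>+x. ennreal \<bar>u n x\<bar> \<partial>M)"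
    by (rule nn_integral_suminf) auto
  also have "\<dots> \<le> (\<Sum>n. ennreal ((C + 1) * (1 / 2) ^ n))" by (intro suminf_le *) auto
  also have "\<dots> = ennreal (\<Sum>n. (C + 1) * (1 / 2) ^ n)"
    using C by (intro suminf_ennreal_eq summable_sums summable_mult summable_geometric) auto
  also have "\<dots> < \<infinity>" by simp
  finally have "AE x in M. (\<Sum>n. ennreal \<bar>u n x\<bar>) \<noteq> \<infinity>"
    by (intro nn_integral_noteq_infinite) auto
  then show ?thesis
    by eventually_elim (rule summable_suminf_not_top, auto)
qed

end

abbreviation ksqnorm :: "nat \<Rightarrow> ((nat \<Rightarrow> real) \<Rightarrow> real) \<Rightarrow> ennreal" where
  "ksqnorm q \<equiv> sqnorm (lborel_pi q)"

subsection \<open>Multiple Wiener-Ito integrals\<close>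

locale wiener_chaos = brownian_motion +
  fixes q :: nat
  assumes q: "q \<ge> 1"
begin

abbreviation has_wi :: "((nat \<Rightarrow> real) \<Rightarrow> real) \<Rightarrow> ('a \<Rightarrow> real) \<Rightarrow> bool" where
  "has_wi f X \<equiv> has_wiener_ito_integral M B q f X"

lemma has_wi_measurable: "has_wi f X \<Longrightarrow> f \<in> borel_measurable (lborel_pi q)" "has_wi f X \<Longrightarrow> X \<in> borel_measurable M"
  by (auto simp: has_wiener_ito_integral_def)

text \<open>One approximating form for each tolerance is equivalent to a sequence of grids and
  coefficients, and it is the form of the definition that all closure properties use.\<close>

lemma has_wi_iff:
  "has_wi f X \<longleftrightarrow> f \<in> borel_measurable (lborel_pi q) \<and> X \<in> borel_measurable M \<and>
    (\<forall>\<epsilon>>0. \<exists>s\<in>elementary_forms q. ksqnorm q (\<lambda>y. f y - form_kernel s y) \<le> ennreal \<epsilon> \<and>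
        sqnorm M (\<lambda>\<omega>. X \<omega> - form_integral B s \<omega>) \<le> ennreal \<epsilon>)"
  (is "_ \<longleftrightarrow> ?meas1 \<and> ?meas2 \<and> ?approx")
proof
  assume h: "has_wi f X"
  then obtain m t a where t: "\<And>n::nat. strict_mono_on {..m n} (t n)"
    and lim: "(\<lambda>n. ksqnorm q (\<lambda>y. f y - elementary_kernel q (m n) (t n) (a n) y)) \<longlonglongrightarrow> 0"
      "(\<lambda>n. sqnorm M (\<lambda>\<omega>. X \<omega> - elementary_integral B q (m n) (t n) (a n) \<omega>)) \<longlonglongrightarrow> 0"
    unfolding has_wiener_ito_integral_def sqnorm_def by blast
  have ?approx
  proof (intro allI impI)
    fix \<epsilon> :: real assume "\<epsilon> > 0"
    then have "0 < ennreal \<epsilon>" by simp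
    from order_tendstoD(2)[OF lim(1) this] order_tendstoD(2)[OF lim(2) this]
    have "\<forall>\<^sub>F n in sequentially. ksqnorm q (\<lambda>y. f y - elementary_kernel q (m n) (t n) (a n) y) < ennreal \<epsilon> \<and>
       sqnorm M (\<lambda>\<omega>. X \<omega> - elementary_integral B q (m n) (t n) (a n) \<omega>) < ennreal \<epsilon>"
      by (rule eventually_conj)
    then have "\<exists>n. ksqnorm q (\<lambda>y. f y - elementary_kernel q (m n) (t n) (a n) y) < ennreal \<epsilon> \<and>
       sqnorm M (\<lambda>\<omega>. X \<omega> - elementary_integral B q (m n) (t n) (a n) \<omega>) < ennreal \<epsilon>"
      by (rule eventually_happens'[OF sequentially_bot])
    then obtain n where "ksqnorm q (\<lambda>y. f y - elementary_kernel q (m n) (t n) (a n) y) < ennreal \<epsilon>"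
       "sqnorm M (\<lambda>\<omega>. X \<omega> - elementary_integral B q (m n) (t n) (a n) \<omega>) < ennreal \<epsilon>"
      by (elim exE conjE)
    then show "\<exists>s\<in>elementary_forms q. ksqnorm q (\<lambda>y. f y - form_kernel s y) \<le> ennreal \<epsilon> \<and>
        sqnorm M (\<lambda>\<omega>. X \<omega> - form_integral B s \<omega>) \<le> ennreal \<epsilon>"
      using t[of n] unfolding elementary_kernel_eq_form_kernel[OF t] elementary_integral_eq_form_integral
      by (intro bexI[of _ "grid_form q (m n) (t n) (a n)"]) (auto simp: elementary_forms_def)
  qed
  then show "?meas1 \<and> ?meas2 \<and> ?approx" using has_wi_measurable[OF h] by blast
next
  assume h: "?meas1 \<and> ?meas2 \<and> ?approx"
  have "\<forall>n. \<exists>s. s \<in> elementary_forms q \<and>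
      ksqnorm q (\<lambda>y. f y - form_kernel s y) \<le> ennreal (inverse (real (Suc n))) \<and>
      sqnorm M (\<lambda>\<omega>. X \<omega> - form_integral B s \<omega>) \<le> ennreal (inverse (real (Suc n)))"
  proof
    fix n
    have "0 < inverse (real (Suc n))" by simp
    with h show "\<exists>s. s \<in> elementary_forms q \<and>
      ksqnorm q (\<lambda>y. f y - form_kernel s y) \<le> ennreal (inverse (real (Suc n))) \<and>
      sqnorm M (\<lambda>\<omega>. X \<omega> - form_integral B s \<omega>) \<le> ennreal (inverse (real (Suc n)))" by blast
  qed
  from choice[OF this] obtain s where s: "\<forall>n. s n \<in> elementary_forms q \<and>
      ksqnorm q (\<lambda>y. f y - form_kernel (s n) y) \<le> ennreal (inverse (real (Suc n))) \<and>
      sqnorm M (\<lambda>\<omega>. X \<omega> - form_integral B (s n) \<omega>) \<le> ennreal (inverse (real (Suc n)))" ..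
  have "\<forall>n. \<exists>z. strict_mono_on {..fst z} (fst (snd z)) \<and> s n = grid_form q (fst z) (fst (snd z)) (snd (snd z))"
    using s by (simp add: elementary_forms_def)
  from choice[OF this] obtain z where z: "\<forall>n. strict_mono_on {..fst (z n)} (fst (snd (z n))) \<and>
      s n = grid_form q (fst (z n)) (fst (snd (z n))) (snd (snd (z n)))" ..
  define m where "m n = fst (z n)" for n
  define t where "t n = fst (snd (z n))" for n
  define a where "a n = snd (snd (z n))" for n
  have t: "strict_mono_on {..m n} (t n)" and s_eq: "grid_form q (m n) (t n) (a n) = s n" for n
    using z by (simp_all add: m_def t_def a_def)
  have lim: "(\<lambda>n. ennreal (inverse (real (Suc n)))) \<longlonglongrightarrow> 0"
    using tendsto_ennrealI[OF LIMSEQ_inverse_real_of_nat] by simp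
  have "(\<lambda>n. ksqnorm q (\<lambda>y. f y - elementary_kernel q (m n) (t n) (a n) y)) \<longlonglongrightarrow> 0"
    "(\<lambda>n. sqnorm M (\<lambda>\<omega>. X \<omega> - elementary_integral B q (m n) (t n) (a n) \<omega>)) \<longlonglongrightarrow> 0"
    unfolding elementary_kernel_eq_form_kernel[OF t] elementary_integral_eq_form_integral s_eq
    by (rule tendsto_sandwich[OF _ _ tendsto_const lim]; use s in simp)+
  then show "has_wi f X"
    unfolding has_wiener_ito_integral_def sqnorm_def using h t by blast
qed

lemma has_wiE:
  assumes "has_wi f X" "\<epsilon> > 0"
  obtains s where "s \<in> elementary_forms q" "ksqnorm q (\<lambda>y. f y - form_kernel s y) \<le> ennreal \<epsilon>"
    "sqnorm M (\<lambda>\<omega>. X \<omega> - form_integral B s \<omega>) \<le> ennreal \<epsilon>"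
  using assms has_wi_iff by blast

lemma has_wi_form: "s \<in> elementary_forms q \<Longrightarrow> has_wi (form_kernel s) (form_integral B s)"
  unfolding has_wi_iff
  by (auto intro!: bexI[of _ s] borel_measurable_form_kernel measurable_form_integral simp: sqnorm_def)

lemma has_wi_cong_AE:
  assumes "has_wi f X" and [measurable]: "g \<in> borel_measurable (lborel_pi q)" "Y \<in> borel_measurable M"
    and fg: "AE y in lborel_pi q. f y = g y" and XY: "AE \<omega> in M. X \<omega> = Y \<omega>"
  shows "has_wi g Y"
proof -
  have "ksqnorm q (\<lambda>y. g y - form_kernel s y) = ksqnorm q (\<lambda>y. f y - form_kernel s y)"
    "sqnorm M (\<lambda>\<omega>. Y \<omega> - form_integral B s \<omega>) = sqnorm M (\<lambda>\<omega>. X \<omega> - form_integral B s \<omega>)" for s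
    using fg XY by (auto intro!: sqnorm_cong_AE)
  then show ?thesis using assms(1) unfolding has_wi_iff by simp
qed

lemma has_wi_lincomb:
  assumes f: "has_wi f X" and g: "has_wi g Y"
  shows "has_wi (\<lambda>y. c * f y + d * g y) (\<lambda>\<omega>. c * X \<omega> + d * Y \<omega>)"
proof -
  note [measurable] = has_wi_measurable[OF f] has_wi_measurable[OF g]
  have "\<exists>s\<in>elementary_forms q. ksqnorm q (\<lambda>y. (c * f y + d * g y) - form_kernel s y) \<le> ennreal \<epsilon> \<and>
        sqnorm M (\<lambda>\<omega>. (c * X \<omega> + d * Y \<omega>) - form_integral B s \<omega>) \<le> ennreal \<epsilon>" if "\<epsilon> > 0" for \<epsilon>
  proof -
    obtain e where e: "e > 0" and le: "ennreal (2 * c\<^sup>2 * e + 2 * d\<^sup>2 * e) \<le> ennreal \<epsilon>"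
      using lincomb_tolerance[OF \<open>\<epsilon> > 0\<close>] by blast
    obtain s where s: "s \<in> elementary_forms q" "ksqnorm q (\<lambda>y. f y - form_kernel s y) \<le> ennreal e"
      "sqnorm M (\<lambda>\<omega>. X \<omega> - form_integral B s \<omega>) \<le> ennreal e" using has_wiE[OF f e] .
    obtain s' where s': "s' \<in> elementary_forms q" "ksqnorm q (\<lambda>y. g y - form_kernel s' y) \<le> ennreal e"
      "sqnorm M (\<lambda>\<omega>. Y \<omega> - form_integral B s' \<omega>) \<le> ennreal e" using has_wiE[OF g e] .
    note [measurable] = borel_measurable_form_kernel[OF s(1)] borel_measurable_form_kernel[OF s'(1)]
      measurable_form_integral[OF s(1)] measurable_form_integral[OF s'(1)]
    have 1: "ksqnorm q (\<lambda>y. c * (f y - form_kernel s y) + d * (g y - form_kernel s' y)) \<le> ennreal \<epsilon>"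
      by (rule order_trans[OF sqnorm_lincomb_le le]) (use s s' e in auto)
    have 2: "sqnorm M (\<lambda>\<omega>. c * (X \<omega> - form_integral B s \<omega>) + d * (Y \<omega> - form_integral B s' \<omega>)) \<le> ennreal \<epsilon>"
      by (rule order_trans[OF sqnorm_lincomb_le le]) (use s s' e in auto)
    show ?thesis
    proof (rule bexI[OF _ elementary_forms_lincomb[OF s(1) s'(1), of c d]])
      show "ksqnorm q (\<lambda>y. c * f y + d * g y - form_kernel (\<lambda>\<phi>. c * s \<phi> + d * s' \<phi>) y) \<le> ennreal \<epsilon> \<and>
        sqnorm M (\<lambda>\<omega>. c * X \<omega> + d * Y \<omega> - form_integral B (\<lambda>\<phi>. c * s \<phi> + d * s' \<phi>) \<omega>) \<le> ennreal \<epsilon>"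
        using 1 2 by (simp add: form_kernel_def form_integral_def algebra_simps)
    qed
  qed
  then show ?thesis unfolding has_wi_iff by auto
qed

lemma has_wi_cmult: "has_wi f X \<Longrightarrow> has_wi (\<lambda>y. c * f y) (\<lambda>\<omega>. c * X \<omega>)"
  using has_wi_lincomb[of f X f X c 0] by simp

lemma has_wi_diff: "has_wi f X \<Longrightarrow> has_wi g Y \<Longrightarrow> has_wi (\<lambda>y. f y - g y) (\<lambda>\<omega>. X \<omega> - Y \<omega>)"
  using has_wi_lincomb[of f X g Y 1 "-1"] by simp

text \<open>The factor \<open>4 ^ r\<close> is the price of the limit: the approximating kernels
  have squared norm at most four times the bound for the limit kernel.\<close>

definition wi_const :: "nat \<Rightarrow> real" where
  "wi_const r = chaos_const q r * 4 ^ r"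

lemma wi_const_nonneg: "wi_const r \<ge> 0"
  by (simp add: wi_const_def chaos_const_nonneg)

text \<open>A fast approximating sequence of elementary integrals converges almost surely, and the
  lemma of Fatou carries over their uniform moment bound.\<close>

lemma has_wi_power_le:
  assumes X: "has_wi f X" and r: "r \<ge> 1" and D: "ksqnorm q f \<le> ennreal D" "D \<ge> 0"
  shows "(\<integral>\<^sup>+\<omega>. ennreal (X \<omega> ^ (2 * r)) \<partial>M) \<le> ennreal (wi_const r * D ^ r)"
proof (rule ennreal_le_at_right_limit[where g = "\<lambda>d. wi_const r * d ^ r"])
  note [measurable] = has_wi_measurable[OF X]
  show "continuous (at_right D) (\<lambda>d. wi_const r * d ^ r)" by (intro continuous_intros)
  fix d assume "D < d"
  then have d: "d > 0" "ksqnorm q f \<le> ennreal d"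
    using D by (auto intro: order_trans ennreal_leI)
  \<comment> \<open>The minimum serves two purposes: (1/4)^n gives almost sure convergence, and d
    keeps the norms of the approximating kernels below 4 d.\<close>
  have "\<forall>n. \<exists>s. s \<in> elementary_forms q \<and>
      ksqnorm q (\<lambda>y. f y - form_kernel s y) \<le> ennreal (min d ((1/4)^n)) \<and>
      sqnorm M (\<lambda>\<omega>. X \<omega> - form_integral B s \<omega>) \<le> ennreal (min d ((1/4)^n))"
  proof
    fix n
    have "0 < min d ((1/4)^n)" using d by simp
    then show "\<exists>s. s \<in> elementary_forms q \<and>
      ksqnorm q (\<lambda>y. f y - form_kernel s y) \<le> ennreal (min d ((1/4)^n)) \<and>
      sqnorm M (\<lambda>\<omega>. X \<omega> - form_integral B s \<omega>) \<le> ennreal (min d ((1/4)^n))"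
      using has_wiE[OF X] by blast
  qed
  from choice[OF this] obtain s where s: "\<And>n. s n \<in> elementary_forms q"
      "\<And>n. ksqnorm q (\<lambda>y. f y - form_kernel (s n) y) \<le> ennreal (min d ((1/4)^n))"
      "\<And>n. sqnorm M (\<lambda>\<omega>. X \<omega> - form_integral B (s n) \<omega>) \<le> ennreal (min d ((1/4)^n))"
    by blast
  note [measurable] = borel_measurable_form_kernel[OF s(1)] measurable_form_integral[OF s(1)]
  have "AE \<omega> in M. summable (\<lambda>n. \<bar>X \<omega> - form_integral B (s n) \<omega>\<bar>)"
    by (rule AE_summable_of_sqnorm[where C=1]) (auto intro: order_trans[OF s(3)] ennreal_leI)
  then have lim: "AE \<omega> in M. (\<lambda>n. form_integral B (s n) \<omega>) \<longlonglongrightarrow> X \<omega>"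
  proof eventually_elim
    case (elim \<omega>)
    then have "(\<lambda>n. X \<omega> - form_integral B (s n) \<omega>) \<longlonglongrightarrow> 0"
      using summable_LIMSEQ_zero tendsto_rabs_zero_iff by blast
    from tendsto_diff[OF tendsto_const[of "X \<omega>"] this] show ?case by simp
  qed
  have kernel: "ksqnorm q (form_kernel (s n)) \<le> ennreal (4 * d)" for n
  proof -
    have e: "ksqnorm q (\<lambda>y. f y - form_kernel (s n) y) \<le> ennreal d"
      using s(2)[of n] by (rule order_trans) (simp add: ennreal_leI)
    have "ksqnorm q (\<lambda>y. 1 * f y + (-1) * (f y - form_kernel (s n) y)) \<le> ennreal (2 * 1\<^sup>2 * d + 2 * (-1)\<^sup>2 * d)"
      using d e by (intro sqnorm_lincomb_le) auto
    then show ?thesis by simp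
  qed
  have bound: "(\<integral>\<^sup>+\<omega>. ennreal (form_integral B (s n) \<omega> ^ (2 * r)) \<partial>M) \<le> ennreal (wi_const r * d ^ r)" for n
  proof -
    have "(\<integral>\<^sup>+\<omega>. ennreal (form_integral B (s n) \<omega> ^ (2 * r)) \<partial>M) \<le>
      ennreal (chaos_const q r) * ksqnorm q (form_kernel (s n)) ^ r"
      unfolding sqnorm_def by (rule form_integral_power_le[OF s(1) r])
    also have "\<dots> \<le> ennreal (chaos_const q r) * ennreal (4 * d) ^ r"
      by (intro mult_left_mono power_mono kernel) auto
    also have "\<dots> = ennreal (wi_const r * d ^ r)"
      using d chaos_const_nonneg by (simp add: wi_const_def ennreal_power ennreal_mult[symmetric] power_mult_distrib mult_ac)
    finally show ?thesis .
  qed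
  have "(\<integral>\<^sup>+\<omega>. ennreal (X \<omega> ^ (2 * r)) \<partial>M) = (\<integral>\<^sup>+\<omega>. liminf (\<lambda>n. ennreal (form_integral B (s n) \<omega> ^ (2 * r))) \<partial>M)"
  proof (rule nn_integral_cong_AE)
    show "AE \<omega> in M. ennreal (X \<omega> ^ (2 * r)) = liminf (\<lambda>n. ennreal (form_integral B (s n) \<omega> ^ (2 * r)))"
      using lim
    proof eventually_elim
      case (elim \<omega>)
      then have "(\<lambda>n. ennreal (form_integral B (s n) \<omega> ^ (2 * r))) \<longlonglongrightarrow> ennreal (X \<omega> ^ (2 * r))"
        by (intro tendsto_ennrealI tendsto_power)
      then show ?case by (rule lim_imp_Liminf[symmetric, rotated]) simp
    qed
  qed
  also have "\<dots> \<le> liminf (\<lambda>n. \<integral>\<^sup>+\<omega>. ennreal (form_integral B (s n) \<omega> ^ (2 * r)) \<partial>M)"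
    by (rule nn_integral_liminf) measurable
  also have "\<dots> \<le> liminf (\<lambda>n. ennreal (wi_const r * d ^ r))"
    by (intro Liminf_mono) (simp add: bound)
  also have "\<dots> = ennreal (wi_const r * d ^ r)" by (simp add: Liminf_const)
  finally show "(\<integral>\<^sup>+\<omega>. ennreal (X \<omega> ^ (2 * r)) \<partial>M) \<le> ennreal (wi_const r * d ^ r)" .
qed

lemma has_wi_sqnorm_le:
  assumes "has_wi f X" "ksqnorm q f \<le> ennreal D" "D \<ge> 0"
  shows "sqnorm M X \<le> ennreal (wi_const 1 * D)"
  using has_wi_power_le[OF assms(1) order_refl assms(2,3)] by (simp add: sqnorm_def)

text \<open>An integrable kernel lies within distance 1 of an elementary one, whose norm is
  finite.\<close>

lemma has_wi_sqnorm_finite: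
  assumes X: "has_wi f X"
  obtains D where "D \<ge> 0" "ksqnorm q f \<le> ennreal D"
proof -
  note [measurable] = has_wi_measurable[OF X]
  obtain s where s: "s \<in> elementary_forms q" "ksqnorm q (\<lambda>y. f y - form_kernel s y) \<le> ennreal 1"
    using has_wiE[OF X, of 1] by auto
  note [measurable] = borel_measurable_form_kernel[OF s(1)]
  from s(1) obtain m t a where t: "strict_mono_on {..m} t" and s_eq: "s = grid_form q m t a"
    by (auto simp: elementary_forms_def)
  define E where "E = \<bar>grid_norm2 q m t a\<bar>"
  have E: "E \<ge> 0" "ksqnorm q (form_kernel s) \<le> ennreal E"
    unfolding s_eq sqnorm_def nn_integral_form_kernel_power2[OF t] E_def by (auto intro: ennreal_leI)
  have "ksqnorm q (\<lambda>y. 1 * (f y - form_kernel s y) + 1 * form_kernel s y) \<le> ennreal (2 * 1\<^sup>2 * 1 + 2 * 1\<^sup>2 * E)"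
    using s E by (intro sqnorm_lincomb_le) auto
  then show ?thesis using E by (intro that[of "2 + 2 * E"]) auto
qed

text \<open>Elementary integrals of fast converging kernels form an L^2 Cauchy sequence by the
  second-moment bound. Its pointwise limit, taken almost surely, is the integral.\<close>

lemma has_wi_exists:
  assumes [measurable]: "f \<in> borel_measurable (lborel_pi q)"
    and approx: "\<And>\<epsilon>. \<epsilon> > 0 \<Longrightarrow> \<exists>s\<in>elementary_forms q. ksqnorm q (\<lambda>y. f y - form_kernel s y) \<le> ennreal \<epsilon>"
  shows "\<exists>X. has_wi f X"
proof -
  have "\<forall>n. \<exists>s. s \<in> elementary_forms q \<and> ksqnorm q (\<lambda>y. f y - form_kernel s y) \<le> ennreal ((1/4)^n)"
    using approx[of "(1/4)^_"] by auto
  from choice[OF this] obtain s where s: "\<And>n. s n \<in> elementary_forms q"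
      "\<And>n. ksqnorm q (\<lambda>y. f y - form_kernel (s n) y) \<le> ennreal ((1/4)^n)"
    by blast
  note [measurable] = borel_measurable_form_kernel[OF s(1)] measurable_form_integral[OF s(1)]
  define I where "I n = form_integral B (s n)" for n
  have [measurable]: "I n \<in> borel_measurable M" for n unfolding I_def by measurable
  have cauchy: "sqnorm M (\<lambda>\<omega>. I k \<omega> - I n \<omega>) \<le> ennreal (4 * wi_const 1 * (1/4)^n)" if "n \<le> k" for n k
  proof -
    have "ksqnorm q (\<lambda>y. 1 * (f y - form_kernel (s n) y) + (-1) * (f y - form_kernel (s k) y)) \<le>
        ennreal (2 * 1\<^sup>2 * (1/4)^n + 2 * (-1)\<^sup>2 * (1/4)^k)"
      using s(2) by (intro sqnorm_lincomb_le) auto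
    also have "\<dots> \<le> ennreal (4 * (1/4)^n)"
    proof (rule ennreal_leI)
      have "(1/4::real)^k \<le> (1/4)^n" using that by (intro power_decreasing) auto
      then show "2 * 1\<^sup>2 * (1/4)^n + 2 * (-1)\<^sup>2 * (1/4)^k \<le> (4 * (1/4)^n :: real)" by simp
    qed
    finally have "ksqnorm q (\<lambda>y. form_kernel (s k) y - form_kernel (s n) y) \<le> ennreal (4 * (1/4)^n)"
      by simp
    from has_wi_sqnorm_le[OF has_wi_diff[OF has_wi_form[OF s(1)] has_wi_form[OF s(1)]] this]
    show ?thesis by (simp add: I_def mult_ac)
  qed
  have "AE \<omega> in M. summable (\<lambda>n. \<bar>I (Suc n) \<omega> - I n \<omega>\<bar>)"
    by (rule AE_summable_of_sqnorm[OF _ cauchy]) (auto simp: wi_const_nonneg)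
  then have conv: "AE \<omega> in M. convergent (\<lambda>n. I n \<omega>)"
  proof eventually_elim
    case (elim \<omega>)
    then have "summable (\<lambda>n. I (Suc n) \<omega> - I n \<omega>)" by (rule summable_rabs_cancel)
    then have "convergent (\<lambda>n. \<Sum>k<n. I (Suc k) \<omega> - I k \<omega>)" by (simp add: summable_iff_convergent)
    then have "convergent (\<lambda>n. (\<Sum>k<n. I (Suc k) \<omega> - I k \<omega>) + I 0 \<omega>)" by (intro convergent_add convergent_const)
    then show ?case using sum_lessThan_telescope[of "\<lambda>k. I k \<omega>"] by simp
  qed
  define X where "X \<omega> = lim (\<lambda>n. I n \<omega>)" for \<omega>
  have [measurable]: "X \<in> borel_measurable M" unfolding X_def[abs_def] by (rule borel_measurable_lim_metric) measurable
  have lim: "AE \<omega> in M. (\<lambda>n. I n \<omega>) \<longlonglongrightarrow> X \<omega>"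
    using conv by eventually_elim (simp add: X_def convergent_LIMSEQ_iff)
  \<comment> \<open>The Cauchy estimate with k to infinity; Fatou turns the pointwise limit into an
    L^2 bound.\<close>
  have XI: "sqnorm M (\<lambda>\<omega>. X \<omega> - I n \<omega>) \<le> ennreal (4 * wi_const 1 * (1/4)^n)" for n
  proof -
    have "sqnorm M (\<lambda>\<omega>. X \<omega> - I n \<omega>) = (\<integral>\<^sup>+\<omega>. liminf (\<lambda>k. ennreal ((I (n + k) \<omega> - I n \<omega>)\<^sup>2)) \<partial>M)"
      unfolding sqnorm_def
    proof (rule nn_integral_cong_AE)
      show "AE \<omega> in M. ennreal ((X \<omega> - I n \<omega>)\<^sup>2) = liminf (\<lambda>k. ennreal ((I (n + k) \<omega> - I n \<omega>)\<^sup>2))"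
        using lim
      proof eventually_elim
        case (elim \<omega>)
        then have "(\<lambda>k. I (n + k) \<omega>) \<longlonglongrightarrow> X \<omega>" by (subst add.commute) (rule LIMSEQ_ignore_initial_segment)
        then have "(\<lambda>k. ennreal ((I (n + k) \<omega> - I n \<omega>)\<^sup>2)) \<longlonglongrightarrow> ennreal ((X \<omega> - I n \<omega>)\<^sup>2)"
          by (intro tendsto_ennrealI tendsto_power tendsto_diff tendsto_const)
        then show ?case by (rule lim_imp_Liminf[symmetric, rotated]) simp
      qed
    qed
    also have "\<dots> \<le> liminf (\<lambda>k. \<integral>\<^sup>+\<omega>. ennreal ((I (n + k) \<omega> - I n \<omega>)\<^sup>2) \<partial>M)"
      by (rule nn_integral_liminf) measurable
    also have "\<dots> \<le> liminf (\<lambda>k. ennreal (4 * wi_const 1 * (1/4)^n))"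
      by (intro Liminf_mono always_eventually allI) (use cauchy in \<open>simp add: sqnorm_def\<close>)
    finally show ?thesis by (simp add: Liminf_const)
  qed
  have "has_wi f X" unfolding has_wi_iff
  proof (intro conjI allI impI)
    fix \<epsilon> :: real assume "\<epsilon> > 0"
    define C where "C = 4 * wi_const 1 + 1"
    have C: "C \<ge> 1" using wi_const_nonneg[of 1] by (simp add: C_def)
    obtain n where n: "(1/4)^n < \<epsilon> / C"
      using real_arch_pow_inv[of "\<epsilon> / C" "1/4"] \<open>\<epsilon> > 0\<close> C by auto
    then have "C * (1/4)^n \<le> \<epsilon>" using C by (simp add: field_simps)
    moreover have "4 * wi_const 1 * (1/4)^n \<le> C * (1/4)^n" by (intro mult_right_mono) (auto simp: C_def)
    moreover have "1 * (1/4)^n \<le> C * (1/4)^n" using C by (intro mult_right_mono) auto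
    ultimately have "(1/4)^n \<le> \<epsilon>" "4 * wi_const 1 * (1/4)^n \<le> \<epsilon>" by linarith+
    then show "\<exists>s\<in>elementary_forms q. ksqnorm q (\<lambda>y. f y - form_kernel s y) \<le> ennreal \<epsilon> \<and>
        sqnorm M (\<lambda>\<omega>. X \<omega> - form_integral B s \<omega>) \<le> ennreal \<epsilon>"
      using s(1)[of n] s(2)[of n] XI[of n] unfolding I_def
      by (intro bexI[of _ "s n"]) (auto intro: order_trans ennreal_leI)
  qed auto
  then show ?thesis by blast
qed

end

text \<open>In the factorisation of x^p - y^p the second factor has p terms; Cauchy-Schwarz gives
  one factor p, summing over the terms the other, and each squared term is at most the larger of
  x^(2(p-1)) and y^(2(p-1)).\<close>

lemma power_diff_square_le:
  fixes x y :: real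
  assumes "p \<ge> 1"
  shows "(x ^ p - y ^ p)\<^sup>2 \<le> (x - y)\<^sup>2 * ((real p)\<^sup>2 * (x ^ (2 * (p - 1)) + y ^ (2 * (p - 1))))"
proof -
  define S where "S = (\<Sum>i<p. y ^ (p - Suc i) * x ^ i)"
  have term_le: "(y ^ (p - Suc i) * x ^ i)\<^sup>2 \<le> x ^ (2 * (p - 1)) + y ^ (2 * (p - 1))" if "i < p" for i
  proof -
    have "(y ^ (p - Suc i) * x ^ i)\<^sup>2 = (y\<^sup>2) ^ (p - Suc i) * (x\<^sup>2) ^ i"
      by (simp add: power_mult_distrib power_mult[symmetric] mult.commute)
    also have "\<dots> \<le> max (x\<^sup>2) (y\<^sup>2) ^ (p - Suc i) * max (x\<^sup>2) (y\<^sup>2) ^ i"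
      by (intro mult_mono power_mono) (auto intro!: zero_le_power simp: le_max_iff_disj)
    also have "\<dots> = max (x\<^sup>2) (y\<^sup>2) ^ (p - 1)" using that by (simp add: power_add[symmetric])
    also have "\<dots> \<le> (x\<^sup>2) ^ (p - 1) + (y\<^sup>2) ^ (p - 1)"
      by (cases "x\<^sup>2 \<le> y\<^sup>2") (simp_all add: max_def)
    finally show ?thesis by (simp add: power_mult)
  qed
  have "S\<^sup>2 \<le> (\<Sum>i<p. (y ^ (p - Suc i) * x ^ i)\<^sup>2) * real (card {..<p})"
    unfolding S_def by (rule sum_squared_le_sum_of_squares)
  also have "\<dots> \<le> (\<Sum>i<p. x ^ (2 * (p - 1)) + y ^ (2 * (p - 1))) * real (card {..<p})"
    by (intro mult_right_mono sum_mono term_le) auto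
  also have "\<dots> = (real p)\<^sup>2 * (x ^ (2 * (p - 1)) + y ^ (2 * (p - 1)))"
    by (simp add: power2_eq_square)
  finally have "S\<^sup>2 \<le> (real p)\<^sup>2 * (x ^ (2 * (p - 1)) + y ^ (2 * (p - 1)))" .
  then have "(x - y)\<^sup>2 * S\<^sup>2 \<le> (x - y)\<^sup>2 * ((real p)\<^sup>2 * (x ^ (2 * (p - 1)) + y ^ (2 * (p - 1))))"
    by (rule mult_left_mono) simp
  then show ?thesis
    by (simp add: power_diff_sumr2[of x p y] S_def power_mult_distrib)
qed

text \<open>The one-dimensional substitution is applied to one coordinate at a time. The argument of
  g is restricted to I because points of the product space are extensional functions.\<close>

lemma nn_integral_lborel_PiM_affine:
  assumes "finite I" "e > 0" "g \<in> borel_measurable (PiM I (\<lambda>_. lborel))"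
  shows "(\<integral>\<^sup>+y. g (\<lambda>i\<in>I. (y i - x) / e) \<partial>PiM I (\<lambda>_::nat. lborel)) =
    ennreal (e ^ card I) * (\<integral>\<^sup>+y. g y \<partial>PiM I (\<lambda>_. lborel))"
  using assms(1,3)
proof (induction I arbitrary: g rule: finite_induct)
  case empty
  show ?case by (subst (1 2) lborel_product.nn_integral_empty) (simp_all add: restrict_def)
next
  case (insert n I)
  note [measurable] = insert.prems
  define h where "h u = (\<integral>\<^sup>+w. g (u(n := w)) \<partial>lborel)" for u
  have h [measurable]: "h \<in> borel_measurable (PiM I (\<lambda>_. lborel))"
    unfolding h_def by measurable
  have "(\<integral>\<^sup>+y. g (\<lambda>i\<in>insert n I. (y i - x) / e) \<partial>PiM (insert n I) (\<lambda>_. lborel)) =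
      (\<integral>\<^sup>+y. \<integral>\<^sup>+z. g (\<lambda>i\<in>insert n I. ((y(n := z)) i - x) / e) \<partial>lborel \<partial>PiM I (\<lambda>_. lborel))"
    by (rule lborel_product.product_nn_integral_insert[OF insert.hyps(1,2)]) measurable
  also have "\<dots> = (\<integral>\<^sup>+y. ennreal e * h (\<lambda>i\<in>I. (y i - x) / e) \<partial>PiM I (\<lambda>_. lborel))"
  proof (rule nn_integral_cong)
    fix y :: "nat \<Rightarrow> real"
    define u where "u = (\<lambda>i\<in>I. (y i - x) / e)"
    have u: "u \<in> space (PiM I (\<lambda>_. lborel))" by (simp add: u_def space_PiM)
    have [measurable]: "(\<lambda>w. g (u(n := w))) \<in> borel_measurable lborel"
      by (rule measurable_compose[OF measurable_fun_upd[where J=I and I="insert n I"] insert.prems]) (use u in auto)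
    have "(\<lambda>i\<in>insert n I. ((y(n := z)) i - x) / e) = u(n := (z - x) / e)" for z
      using insert.hyps(2) by (auto simp: u_def fun_eq_iff)
    then have "(\<integral>\<^sup>+z. g (\<lambda>i\<in>insert n I. ((y(n := z)) i - x) / e) \<partial>lborel) =
       (\<integral>\<^sup>+z. g (u(n := (z - x) / e)) \<partial>lborel)" by simp
    also have "\<dots> = ennreal \<bar>e\<bar> * (\<integral>\<^sup>+z. g (u(n := ((x + e * z) - x) / e)) \<partial>lborel)"
      using \<open>e > 0\<close> by (subst nn_integral_real_affine[where c=e and t=x]) auto
    also have "\<dots> = ennreal e * h u" using \<open>e > 0\<close> by (simp add: h_def)
    finally show "(\<integral>\<^sup>+z. g (\<lambda>i\<in>insert n I. ((y(n := z)) i - x) / e) \<partial>lborel) = ennreal e * h (\<lambda>i\<in>I. (y i - x) / e)"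
      by (simp add: u_def)
  qed
  also have "\<dots> = ennreal e * (\<integral>\<^sup>+y. h (\<lambda>i\<in>I. (y i - x) / e) \<partial>PiM I (\<lambda>_. lborel))"
    by (rule nn_integral_cmult) measurable
  also have "\<dots> = ennreal e * (ennreal (e ^ card I) * (\<integral>\<^sup>+y. h y \<partial>PiM I (\<lambda>_. lborel)))"
    by (simp add: insert.IH[OF h])
  also have "(\<integral>\<^sup>+y. h y \<partial>PiM I (\<lambda>_. lborel)) = (\<integral>\<^sup>+y. g y \<partial>PiM (insert n I) (\<lambda>_. lborel))"
    unfolding h_def by (rule lborel_product.product_nn_integral_insert[OF insert.hyps(1,2) insert.prems, symmetric])
  finally show ?case
    using insert.hyps \<open>e > 0\<close> by (simp add: mult.assoc[symmetric] ennreal_mult[symmetric])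
qed

text \<open>This is the unitary action on L^2 of the affine map that sends \<tau> to x + e \<tau> in
  each coordinate; the factor e^(-q/2) offsets the Jacobian e^q of the squared norm.\<close>

definition affine_kernel :: "nat \<Rightarrow> real \<Rightarrow> real \<Rightarrow> ((nat \<Rightarrow> real) \<Rightarrow> real) \<Rightarrow> (nat \<Rightarrow> real) \<Rightarrow> real" where
  "affine_kernel q x e f y = (1 / sqrt e) ^ q * f (\<lambda>i\<in>{..<q}. (y i - x) / e)"

lemma borel_measurable_affine_kernel [measurable]:
  assumes [measurable]: "f \<in> borel_measurable (lborel_pi q)"
  shows "affine_kernel q x e f \<in> borel_measurable (lborel_pi q)"
  unfolding affine_kernel_def[abs_def] by measurable

lemma sqnorm_affine_kernel:
  assumes [measurable]: "f \<in> borel_measurable (lborel_pi q)" and e: "e > 0"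
  shows "ksqnorm q (affine_kernel q x e f) = ksqnorm q f"
proof -
  have "ksqnorm q (affine_kernel q x e f) =
     ennreal (((1 / sqrt e) ^ q)\<^sup>2) * (\<integral>\<^sup>+y. ennreal ((f (\<lambda>i\<in>{..<q}. (y i - x) / e))\<^sup>2) \<partial>lborel_pi q)"
    unfolding affine_kernel_def[abs_def] by (subst sqnorm_cmult) (auto simp: sqnorm_def)
  also have "\<dots> = ennreal (((1 / sqrt e) ^ q)\<^sup>2) * (ennreal (e ^ q) * ksqnorm q f)"
    using nn_integral_lborel_PiM_affine[of "{..<q}" e "\<lambda>y. ennreal ((f y)\<^sup>2)" x] e by (simp add: sqnorm_def)
  also have "\<dots> = ennreal (((1 / sqrt e) ^ q)\<^sup>2 * e ^ q) * ksqnorm q f"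
    using e by (simp add: ennreal_mult mult.assoc)
  also have "((1 / sqrt e) ^ q)\<^sup>2 * e ^ q = (((1 / sqrt e))\<^sup>2 * e) ^ q"
    by (simp add: power_mult_distrib power_mult[symmetric] mult.commute)
  also have "\<dots> = 1" using e by (simp add: power_divide)
  finally show ?thesis by simp
qed

lemma form_eq_0_if_constant:
  assumes "s \<in> elementary_forms q" "i < q" "\<And>\<tau>. \<phi> i \<tau> = c"
  shows "s \<phi> = 0"
proof -
  from assms(1) obtain m t a where s: "s = grid_form q m t a" by (auto simp: elementary_forms_def)
  have "(\<Prod>i<q. \<phi> i (t (Suc (k i))) - \<phi> i (t (k i))) = 0" for k :: "nat \<Rightarrow> nat"
    using assms(2,3) by (intro prod_zero bexI[of _ i]) simp_all
  then show ?thesis unfolding s grid_form_def by (simp only: mult_zero_right sum.neutral_const)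
qed

lemma form_cong:
  assumes "s \<in> elementary_forms q" "\<And>i. i < q \<Longrightarrow> \<phi> i = \<psi> i"
  shows "s \<phi> = s \<psi>"
proof -
  from assms(1) obtain m t a where s: "s = grid_form q m t a" by (auto simp: elementary_forms_def)
  show ?thesis unfolding s grid_form_def using assms(2) by (intro sum.cong arg_cong2[where f="(*)"] prod.cong) auto
qed

text \<open>The step function at \<open>y i\<close>, clamped, is constantly 1 if \<open>y i\<close>
  is at most \<open>lo\<close>, constantly 0 if it exceeds both ends, and unchanged in between. A
  constant path contributes only zero increments.\<close>

lemma form_kernel_clamp:
  assumes s: "s \<in> elementary_forms q"
  shows "form_kernel (clamp_form lo hi s) y = (if \<forall>i<q. lo < y i \<and> y i \<le> hi then form_kernel s y else 0)"
proof (cases "\<forall>i<q. lo < y i \<and> y i \<le> hi")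
  case True
  then show ?thesis unfolding form_kernel_def clamp_form_def
    by (simp, intro form_cong[OF s]) (fastforce simp: fun_eq_iff indicator_def)
next
  case False
  then obtain i where i: "i < q" "y i \<le> lo \<or> hi < y i" by (auto simp: not_less not_le)
  have "s (\<lambda>i \<tau>. indicator {y i..} (max lo (min hi \<tau>))) = 0"
  proof (cases "y i \<le> lo")
    case True
    then show ?thesis by (intro form_eq_0_if_constant[OF s i(1), where c=1]) (auto simp: indicator_def)
  next
    case False
    then show ?thesis using i(2) by (intro form_eq_0_if_constant[OF s i(1), where c=0]) (auto simp: indicator_def)
  qed
  then show ?thesis using False by (auto simp: form_kernel_def clamp_form_def)
qed

lemma form_kernel_affine:
  assumes s: "s \<in> elementary_forms q" and e: "e > 0"
  shows "form_kernel (\<lambda>\<phi>. c * s (\<lambda>i \<tau>. \<phi> i (x + e * \<tau>))) y = c * form_kernel s (\<lambda>i\<in>{..<q}. (y i - x) / e)"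
proof -
  have "s (\<lambda>i \<tau>. indicator {y i..} (x + e * \<tau>)) = s (\<lambda>i \<tau>. indicator {(\<lambda>i\<in>{..<q}. (y i - x) / e) i..} \<tau>)"
    using e by (intro form_cong[OF s]) (auto simp: fun_eq_iff indicator_def field_simps)
  then show ?thesis by (simp add: form_kernel_def)
qed

section \<open>Stability of p-th moments under L^2 perturbations of the kernel\<close>

context wiener_chaos
begin

text \<open>The first summand comes from the fourth moment of the difference, the second from the
  moments of order 4(p-1) of the two integrals, whose squared kernel norms are bounded by R.\<close>

definition power_diff_const :: "nat \<Rightarrow> real \<Rightarrow> real" where
  "power_diff_const p R = wi_const 2 + 4 * (real p) ^ 4 * (wi_const (2 * (p - 1)) * R ^ (2 * (p - 1)))"

lemma power_diff_const_nonneg: "R \<ge> 0 \<Longrightarrow> power_diff_const p R \<ge> 0"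
  by (simp add: power_diff_const_def wi_const_nonneg)

text \<open>The square of x^p - y^p is a product a b with a = (x - y)^2 and b of degree 2(p-1). The
  split a b \<le> a^2/d + d b^2 is balanced: the expectation of a^2 is of order d^2, so both parts
  are of order d.\<close>

lemma has_wi_power_diff_le:
  assumes X: "has_wi f X" and Y: "has_wi g Y" and p: "p \<ge> 2" and R: "R \<ge> 0"
    and f: "ksqnorm q f \<le> ennreal R" and g: "ksqnorm q g \<le> ennreal R"
    and \<delta>: "\<delta> \<ge> 0" and fg: "ksqnorm q (\<lambda>y. f y - g y) \<le> ennreal \<delta>"
  shows "sqnorm M (\<lambda>\<omega>. X \<omega> ^ p - Y \<omega> ^ p) \<le> ennreal (power_diff_const p R * \<delta>)"
proof (rule ennreal_le_at_right_limit[where g = "\<lambda>d. power_diff_const p R * d"])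
  note [measurable] = has_wi_measurable[OF X] has_wi_measurable[OF Y]
  show "continuous (at_right \<delta>) (\<lambda>d. power_diff_const p R * d)" by (intro continuous_intros)
  fix d assume "\<delta> < d"
  then have d: "d > 0" "ksqnorm q (\<lambda>y. f y - g y) \<le> ennreal d"
    using fg \<delta> by (auto intro: order_trans ennreal_leI)
  let ?r = "2 * (p - 1)"
  \<comment> \<open>This is d times the square of the factor p^2 in b, times 2 from (s + t)^2 \<le>
    2 (s^2 + t^2).\<close>
  define w where "w = 2 * d * (real p) ^ 4"
  have w: "w \<ge> 0" using d by (simp add: w_def)
  have pw: "(x ^ p - y ^ p)\<^sup>2 \<le> 1 / d * (x - y) ^ (2 * 2) + w * (x ^ (2 * ?r) + y ^ (2 * ?r))" for x y :: real
  proof -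
    define a where "a = (x - y)\<^sup>2"
    define b where "b = (real p)\<^sup>2 * (x ^ ?r + y ^ ?r)"
    have "(x ^ p - y ^ p)\<^sup>2 \<le> a * b"
      unfolding a_def b_def using p by (intro power_diff_square_le) simp
    also have "\<dots> \<le> 1 / d * a\<^sup>2 + d * b\<^sup>2"
    proof -
      have "0 \<le> (a - d * b)\<^sup>2" "0 \<le> a\<^sup>2 + (d * b)\<^sup>2" by simp_all
      moreover from this have "2 * (d * (a * b)) \<le> a\<^sup>2 + (d * b)\<^sup>2" by (simp add: power2_diff mult_ac)
      ultimately have "d * (a * b) \<le> a\<^sup>2 + (d * b)\<^sup>2" by linarith
      also have "\<dots> = d * (1 / d * a\<^sup>2 + d * b\<^sup>2)"
        using d by (simp add: power2_eq_square field_simps)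
      finally show ?thesis using d by simp
    qed
    also have "d * b\<^sup>2 \<le> w * (x ^ (2 * ?r) + y ^ (2 * ?r))"
    proof -
      have "(x ^ ?r + y ^ ?r)\<^sup>2 \<le> 2 * (x ^ (2 * ?r) + y ^ (2 * ?r))"
        using zero_le_power2[of "x ^ ?r - y ^ ?r"] power_mult[of x ?r 2] power_mult[of y ?r 2]
        by (simp add: power2_sum power2_diff mult.commute)
      then have "d * (real p) ^ 4 * (x ^ ?r + y ^ ?r)\<^sup>2 \<le> d * (real p) ^ 4 * (2 * (x ^ (2 * ?r) + y ^ (2 * ?r)))"
        using d by (intro mult_left_mono) auto
      moreover have "d * b\<^sup>2 = d * (real p) ^ 4 * (x ^ ?r + y ^ ?r)\<^sup>2"
        unfolding b_def power_mult_distrib by (simp flip: power_mult)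
      moreover have "d * (real p) ^ 4 * (2 * (x ^ (2 * ?r) + y ^ (2 * ?r))) = w * (x ^ (2 * ?r) + y ^ (2 * ?r))"
        by (simp only: w_def mult_ac)
      ultimately show ?thesis by linarith
    qed
    finally show ?thesis by (simp add: a_def power_mult)
  qed
  have "sqnorm M (\<lambda>\<omega>. X \<omega> ^ p - Y \<omega> ^ p) \<le> (\<integral>\<^sup>+\<omega>. ennreal (1 / d) * ennreal ((X \<omega> - Y \<omega>) ^ (2 * 2)) +
      ennreal w * (ennreal (X \<omega> ^ (2 * ?r)) + ennreal (Y \<omega> ^ (2 * ?r))) \<partial>M)"
    unfolding sqnorm_def
  proof (rule nn_integral_mono)
    fix \<omega>
    have nn: "0 \<le> (X \<omega> - Y \<omega>) ^ (2 * 2)" "0 \<le> X \<omega> ^ (2 * ?r)" "0 \<le> Y \<omega> ^ (2 * ?r)"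
      by (intro zero_le_even_power; simp)+
    have "ennreal ((X \<omega> ^ p - Y \<omega> ^ p)\<^sup>2) \<le> ennreal (1 / d * (X \<omega> - Y \<omega>) ^ (2 * 2) + w * (X \<omega> ^ (2 * ?r) + Y \<omega> ^ (2 * ?r)))"
      by (intro ennreal_leI pw)
    also have "\<dots> = ennreal (1 / d) * ennreal ((X \<omega> - Y \<omega>) ^ (2 * 2)) +
      ennreal w * (ennreal (X \<omega> ^ (2 * ?r)) + ennreal (Y \<omega> ^ (2 * ?r)))"
      using nn d w by (subst ennreal_plus, simp, simp, subst ennreal_mult, simp, simp, subst ennreal_mult, simp, simp,
        subst ennreal_plus, simp_all)
    finally show "ennreal ((X \<omega> ^ p - Y \<omega> ^ p)\<^sup>2) \<le> ennreal (1 / d) * ennreal ((X \<omega> - Y \<omega>) ^ (2 * 2)) +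
      ennreal w * (ennreal (X \<omega> ^ (2 * ?r)) + ennreal (Y \<omega> ^ (2 * ?r)))" .
  qed
  also have "\<dots> = ennreal (1 / d) * (\<integral>\<^sup>+\<omega>. ennreal ((X \<omega> - Y \<omega>) ^ (2 * 2)) \<partial>M) +
      ennreal w * ((\<integral>\<^sup>+\<omega>. ennreal (X \<omega> ^ (2 * ?r)) \<partial>M) + (\<integral>\<^sup>+\<omega>. ennreal (Y \<omega> ^ (2 * ?r)) \<partial>M))"
    by (simp add: nn_integral_add nn_integral_cmult)
  also have "\<dots> \<le> ennreal (1 / d) * ennreal (wi_const 2 * d ^ 2) +
      ennreal w * (ennreal (wi_const ?r * R ^ ?r) + ennreal (wi_const ?r * R ^ ?r))"
    using p d(1) by (intro add_mono mult_left_mono has_wi_power_le[OF has_wi_diff[OF X Y] _ d(2)]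
      has_wi_power_le[OF X _ f R] has_wi_power_le[OF Y _ g R]) auto
  also have "\<dots> = ennreal (1 / d * (wi_const 2 * d ^ 2) + w * (wi_const ?r * R ^ ?r + wi_const ?r * R ^ ?r))"
    using d w R wi_const_nonneg by (simp add: ennreal_mult[symmetric] flip: ennreal_plus)
  also have "1 / d * (wi_const 2 * d ^ 2) + w * (wi_const ?r * R ^ ?r + wi_const ?r * R ^ ?r) = power_diff_const p R * d"
    using d by (simp add: power_diff_const_def w_def power2_eq_square algebra_simps)
  finally show "sqnorm M (\<lambda>\<omega>. X \<omega> ^ p - Y \<omega> ^ p) \<le> ennreal (power_diff_const p R * d)" .
qed

lemma has_wi_power_sqnorm_le:
  assumes X: "has_wi f X" and p: "p \<ge> 1" and f: "ksqnorm q f \<le> ennreal R" and R: "R \<ge> 0"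
  shows "sqnorm M (\<lambda>\<omega>. X \<omega> ^ p) \<le> ennreal (wi_const p * R ^ p)"
proof -
  have "sqnorm M (\<lambda>\<omega>. X \<omega> ^ p) = (\<integral>\<^sup>+\<omega>. ennreal (X \<omega> ^ (2 * p)) \<partial>M)"
    by (simp add: sqnorm_def power_mult[symmetric] mult.commute)
  then show ?thesis using has_wi_power_le[OF X p f R] by simp
qed

lemma has_wi_integrable_power:
  assumes X: "has_wi f X" and p: "p \<ge> 1"
  shows "integrable M (\<lambda>\<omega>. X \<omega> ^ p)" "integrable M (\<lambda>\<omega>. (X \<omega> ^ p)\<^sup>2)"
proof -
  note [measurable] = has_wi_measurable[OF X]
  obtain D where D: "D \<ge> 0" "ksqnorm q f \<le> ennreal D" by (rule has_wi_sqnorm_finite[OF X])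
  have "wi_const p * D ^ p \<ge> 0" using D wi_const_nonneg by simp
  from sqnorm_bound_integrable(2,1)[OF _ has_wi_power_sqnorm_le[OF X p D(2,1)] this]
  show "integrable M (\<lambda>\<omega>. X \<omega> ^ p)" "integrable M (\<lambda>\<omega>. (X \<omega> ^ p)\<^sup>2)" by auto
qed

lemma has_wi_abs_power_diff_le:
  assumes X: "has_wi f X" and Y: "has_wi g Y" and p: "p \<ge> 2" and R: "R \<ge> 0"
    and f: "ksqnorm q f \<le> ennreal R" and g: "ksqnorm q g \<le> ennreal R"
    and \<delta>: "\<delta> \<ge> 0" and fg: "ksqnorm q (\<lambda>y. f y - g y) \<le> ennreal \<delta>"
  shows "(\<integral>\<omega>. \<bar>X \<omega> ^ p - Y \<omega> ^ p\<bar> \<partial>M) \<le> sqrt (power_diff_const p R * \<delta>)"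
    and "\<bar>(\<integral>\<omega>. X \<omega> ^ p \<partial>M) - (\<integral>\<omega>. Y \<omega> ^ p \<partial>M)\<bar> \<le> sqrt (power_diff_const p R * \<delta>)"
proof -
  note [measurable] = has_wi_measurable[OF X] has_wi_measurable[OF Y]
  show 1: "(\<integral>\<omega>. \<bar>X \<omega> ^ p - Y \<omega> ^ p\<bar> \<partial>M) \<le> sqrt (power_diff_const p R * \<delta>)"
    using has_wi_power_diff_le[OF assms] \<delta> power_diff_const_nonneg[OF R]
    by (intro sqnorm_bound_integrable(4)) auto
  have "\<bar>(\<integral>\<omega>. X \<omega> ^ p \<partial>M) - (\<integral>\<omega>. Y \<omega> ^ p \<partial>M)\<bar> = \<bar>\<integral>\<omega>. X \<omega> ^ p - Y \<omega> ^ p \<partial>M\<bar>"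
    using has_wi_integrable_power[OF X] has_wi_integrable_power[OF Y] p by simp
  also have "\<dots> \<le> (\<integral>\<omega>. \<bar>X \<omega> ^ p - Y \<omega> ^ p\<bar> \<partial>M)" by (rule integral_abs_bound)
  finally show "\<bar>(\<integral>\<omega>. X \<omega> ^ p \<partial>M) - (\<integral>\<omega>. Y \<omega> ^ p \<partial>M)\<bar> \<le> sqrt (power_diff_const p R * \<delta>)"
    using 1 by simp
qed

lemma has_wi_seq:
  assumes X: "has_wi f X"
  shows "\<exists>s. \<forall>n. s n \<in> elementary_forms q \<and>
    ksqnorm q (\<lambda>y. f y - form_kernel (s n) y) \<le> ennreal (inverse (real (Suc n)))"
proof -
  have "\<forall>n. \<exists>s. s \<in> elementary_forms q \<and> ksqnorm q (\<lambda>y. f y - form_kernel s y) \<le> ennreal (inverse (real (Suc n)))"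
  proof
    fix n
    have "0 < inverse (real (Suc n))" by simp
    then show "\<exists>s. s \<in> elementary_forms q \<and> ksqnorm q (\<lambda>y. f y - form_kernel s y) \<le> ennreal (inverse (real (Suc n)))"
      using has_wiE[OF X] by blast
  qed
  from choice[OF this] show ?thesis .
qed

lemma approx_sqnorm_le:
  assumes [measurable]: "f \<in> borel_measurable (lborel_pi q)" "g \<in> borel_measurable (lborel_pi q)"
    and "ksqnorm q f \<le> ennreal D" "D \<ge> 0"
    and "ksqnorm q (\<lambda>y. f y - g y) \<le> ennreal d" "0 \<le> d" "d \<le> 1"
  shows "ksqnorm q g \<le> ennreal (2 * D + 2)"
proof -
  have "ksqnorm q (\<lambda>y. 1 * f y + (-1) * (f y - g y)) \<le> ennreal (2 * 1\<^sup>2 * D + 2 * (-1)\<^sup>2 * d)"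
    using assms by (intro sqnorm_lincomb_le) auto
  also have "\<dots> \<le> ennreal (2 * D + 2)" using assms by (intro ennreal_leI) simp
  finally show ?thesis by simp
qed

text \<open>It reduces identities between p-th moments to elementary kernels: distances of at most 1
  keep all norms below a common R, so the perturbation bound applies with one constant.\<close>

lemma has_wi_moment_tendsto:
  assumes X: "has_wi f X" and Y: "\<And>n. has_wi (g n) (Y n)" and p: "p \<ge> 2"
    and \<delta>: "\<And>n. 0 \<le> \<delta> n" "\<And>n. \<delta> n \<le> 1" "\<delta> \<longlonglongrightarrow> 0"
    and fg: "\<And>n. ksqnorm q (\<lambda>y. f y - g n y) \<le> ennreal (\<delta> n)"
  shows "(\<lambda>n. \<integral>\<omega>. Y n \<omega> ^ p \<partial>M) \<longlonglongrightarrow> (\<integral>\<omega>. X \<omega> ^ p \<partial>M)"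
proof -
  note [measurable] = has_wi_measurable[OF X] has_wi_measurable[OF Y]
  obtain D where D: "D \<ge> 0" "ksqnorm q f \<le> ennreal D" by (rule has_wi_sqnorm_finite[OF X])
  define R where "R = 2 * D + 2"
  have R: "R \<ge> 0" "ksqnorm q f \<le> ennreal R" "ksqnorm q (g n) \<le> ennreal R" for n
  proof -
    have "ennreal D \<le> ennreal R" using D by (intro ennreal_leI) (simp add: R_def)
    then show "ksqnorm q f \<le> ennreal R" by (rule order_trans[OF D(2)])
    show "ksqnorm q (g n) \<le> ennreal R"
      unfolding R_def by (rule approx_sqnorm_le[OF _ _ D(2,1) fg \<delta>(1,2)]) measurable
  qed (use D in \<open>simp add: R_def\<close>)
  have "(\<lambda>n. sqrt (power_diff_const p R * \<delta> n)) \<longlonglongrightarrow> sqrt (power_diff_const p R * 0)"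
    by (intro tendsto_intros \<delta>)
  then have lim: "(\<lambda>n. sqrt (power_diff_const p R * \<delta> n)) \<longlonglongrightarrow> 0" by simp
  have "\<bar>(\<integral>\<omega>. Y n \<omega> ^ p \<partial>M) - (\<integral>\<omega>. X \<omega> ^ p \<partial>M)\<bar> \<le> sqrt (power_diff_const p R * \<delta> n)" for n
    using has_wi_abs_power_diff_le(2)[OF X Y p R(1,2,3) \<delta>(1) fg] by (simp add: abs_minus_commute)
  then have "(\<lambda>n. (\<integral>\<omega>. Y n \<omega> ^ p \<partial>M) - (\<integral>\<omega>. X \<omega> ^ p \<partial>M)) \<longlonglongrightarrow> 0"
    by (intro Lim_null_comparison[OF _ lim]) auto
  then show ?thesis by (simp add: LIM_zero_iff)
qed

lemma inverse_Suc_null: "(\<lambda>n. inverse (real (Suc n))) \<longlonglongrightarrow> 0" "inverse (real (Suc n)) \<le> 1" "0 \<le> inverse (real (Suc n))"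
  using LIMSEQ_inverse_real_of_nat by (auto simp: field_simps)

text \<open>For elementary kernels both integrals have the same law by Brownian scaling; convergence
  of moments extends the equality.\<close>

lemma has_wi_affine_moment:
  assumes X: "has_wi f X" and X': "has_wi (affine_kernel q x e f) X'" and e: "e > 0" and p: "p \<ge> 2"
  shows "(\<integral>\<omega>. X' \<omega> ^ p \<partial>M) = (\<integral>\<omega>. X \<omega> ^ p \<partial>M)"
proof -
  note [measurable] = has_wi_measurable[OF X]
  let ?c = "(1 / sqrt e) ^ q"
  obtain s where s: "\<And>n. s n \<in> elementary_forms q"
    "\<And>n. ksqnorm q (\<lambda>y. f y - form_kernel (s n) y) \<le> ennreal (inverse (real (Suc n)))"
    using has_wi_seq[OF X] by blast
  \<comment> \<open>\<open>s0\<close> is the form on the moved grid and \<open>s'\<close> the same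
    with the unitary factor, which cancels \<open>sqrt e ^ q\<close> from the scaling of the
    law.\<close>
  define s0 where "s0 n = (\<lambda>\<phi>. 1 * s n (\<lambda>i \<tau>. \<phi> i (x + e * \<tau>)))" for n
  define s' where "s' n = (\<lambda>\<phi>. ?c * s n (\<lambda>i \<tau>. \<phi> i (x + e * \<tau>)))" for n
  have s0: "s0 n \<in> elementary_forms q" and s': "s' n \<in> elementary_forms q" for n
    unfolding s0_def s'_def by (rule affine_in_elementary_forms[OF s(1) e])+
  note [measurable] = borel_measurable_form_kernel[OF s(1)] measurable_form_integral[OF s(1)]
    measurable_form_integral[OF s0]
  have "(\<lambda>y. affine_kernel q x e f y - form_kernel (s' n) y) = affine_kernel q x e (\<lambda>y. f y - form_kernel (s n) y)" for n
    unfolding s'_def form_kernel_affine[OF s(1) e] affine_kernel_def by (simp add: fun_eq_iff right_diff_distrib)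
  then have "ksqnorm q (\<lambda>y. affine_kernel q x e f y - form_kernel (s' n) y) \<le> ennreal (inverse (real (Suc n)))" for n
    using s(2)[of n] sqnorm_affine_kernel[OF _ e, of "\<lambda>y. f y - form_kernel (s n) y" q x] by simp
  then have 1: "(\<lambda>n. \<integral>\<omega>. form_integral B (s' n) \<omega> ^ p \<partial>M) \<longlonglongrightarrow> (\<integral>\<omega>. X' \<omega> ^ p \<partial>M)"
    by (intro has_wi_moment_tendsto[OF X' has_wi_form[OF s'] p inverse_Suc_null(3,2,1)])
  have 2: "(\<lambda>n. \<integral>\<omega>. form_integral B (s n) \<omega> ^ p \<partial>M) \<longlonglongrightarrow> (\<integral>\<omega>. X \<omega> ^ p \<partial>M)"
    using s(2) by (intro has_wi_moment_tendsto[OF X has_wi_form[OF s(1)] p inverse_Suc_null(3,2,1)])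
  have "(\<integral>\<omega>. form_integral B (s' n) \<omega> ^ p \<partial>M) = (\<integral>\<omega>. form_integral B (s n) \<omega> ^ p \<partial>M)" for n
  proof -
    have "(\<integral>\<omega>. form_integral B (s' n) \<omega> ^ p \<partial>M) = (\<integral>\<omega>. (?c * form_integral B (s0 n) \<omega>) ^ p \<partial>M)"
      by (simp add: form_integral_def s'_def s0_def)
    also have "\<dots> = (\<integral>z. (?c * z) ^ p \<partial>distr M borel (form_integral B (s0 n)))"
      by (subst integral_distr) auto
    also have "distr M borel (form_integral B (s0 n)) = distr M borel (\<lambda>\<omega>. sqrt e ^ q * form_integral B (s n) \<omega>)"
      using distr_form_integral_affine[OF s(1) e, of n x] by (simp add: s0_def)
    also have "(\<integral>z. (?c * z) ^ p \<partial>distr M borel (\<lambda>\<omega>. sqrt e ^ q * form_integral B (s n) \<omega>)) =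
       (\<integral>\<omega>. (?c * (sqrt e ^ q * form_integral B (s n) \<omega>)) ^ p \<partial>M)"
      by (subst integral_distr) auto
    also have "\<dots> = (\<integral>\<omega>. form_integral B (s n) \<omega> ^ p \<partial>M)"
      using e by (simp add: power_divide)
    finally show ?thesis .
  qed
  with 1 2 show ?thesis by (auto intro: LIMSEQ_unique)
qed

text \<open>Clamped elementary approximations are independent, so their product moment factorises,
  and both sides converge. The left side needs L^1 convergence of products, which Cauchy-Schwarz
  derives from the L^2 bounds for p-th powers.\<close>

lemma has_wi_disjoint_moment:
  assumes X: "has_wi f X" and Y: "has_wi g Y" and p: "p \<ge> 2"
    and supp: "\<And>y. f y \<noteq> 0 \<Longrightarrow> \<forall>i<q. lo < y i \<and> y i \<le> hi" "\<And>y. g y \<noteq> 0 \<Longrightarrow> \<forall>i<q. lo' < y i \<and> y i \<le> hi'"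
    and le: "lo \<le> hi" "hi \<le> lo'" "lo' \<le> hi'"
  shows "(\<integral>\<omega>. X \<omega> ^ p * Y \<omega> ^ p \<partial>M) = (\<integral>\<omega>. X \<omega> ^ p \<partial>M) * (\<integral>\<omega>. Y \<omega> ^ p \<partial>M)"
proof -
  note [measurable] = has_wi_measurable[OF X] has_wi_measurable[OF Y]
  obtain s where s: "\<And>n. s n \<in> elementary_forms q"
    "\<And>n. ksqnorm q (\<lambda>y. f y - form_kernel (s n) y) \<le> ennreal (inverse (real (Suc n)))"
    using has_wi_seq[OF X] by blast
  obtain s' where s': "\<And>n. s' n \<in> elementary_forms q"
    "\<And>n. ksqnorm q (\<lambda>y. g y - form_kernel (s' n) y) \<le> ennreal (inverse (real (Suc n)))"
    using has_wi_seq[OF Y] by blast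
  define c where "c n = clamp_form lo hi (s n)" for n
  define c' where "c' n = clamp_form lo' hi' (s' n)" for n
  have c: "c n \<in> elementary_forms q" and c': "c' n \<in> elementary_forms q" for n
    unfolding c_def c'_def using clamp_form_in_elementary_forms[OF q] s(1) s'(1) le by auto
  note [measurable] = borel_measurable_form_kernel[OF c] measurable_form_integral[OF c]
    borel_measurable_form_kernel[OF c'] measurable_form_integral[OF c']
  \<comment> \<open>Clamping does not increase the distance to f: inside the cube nothing changes,
    and outside both f and the clamped kernel vanish.\<close>
  have cf: "ksqnorm q (\<lambda>y. f y - form_kernel (c n) y) \<le> ennreal (inverse (real (Suc n)))" for n
  proof (rule order_trans[OF sqnorm_mono_AE s(2)], rule AE_I2)
    show "\<bar>f y - form_kernel (c n) y\<bar> \<le> \<bar>f y - form_kernel (s n) y\<bar>" for y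
      using supp(1)[of y] unfolding c_def form_kernel_clamp[OF s(1)] by (cases "f y = 0") auto
  qed
  have cg: "ksqnorm q (\<lambda>y. g y - form_kernel (c' n) y) \<le> ennreal (inverse (real (Suc n)))" for n
  proof (rule order_trans[OF sqnorm_mono_AE s'(2)], rule AE_I2)
    show "\<bar>g y - form_kernel (c' n) y\<bar> \<le> \<bar>g y - form_kernel (s' n) y\<bar>" for y
      using supp(2)[of y] unfolding c'_def form_kernel_clamp[OF s'(1)] by (cases "g y = 0") auto
  qed
  define I where "I n = form_integral B (c n)" for n
  define J where "J n = form_integral B (c' n)" for n
  have [measurable]: "I n \<in> borel_measurable M" "J n \<in> borel_measurable M" for n unfolding I_def J_def by measurable
  have I: "has_wi (form_kernel (c n)) (I n)" and J: "has_wi (form_kernel (c' n)) (J n)" for n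
    unfolding I_def J_def by (rule has_wi_form[OF c] has_wi_form[OF c'])+
  have p1: "p \<ge> 1" using p by simp
  have lim1: "(\<lambda>n. (\<integral>\<omega>. I n \<omega> ^ p \<partial>M) * (\<integral>\<omega>. J n \<omega> ^ p \<partial>M)) \<longlonglongrightarrow> (\<integral>\<omega>. X \<omega> ^ p \<partial>M) * (\<integral>\<omega>. Y \<omega> ^ p \<partial>M)"
    by (intro tendsto_mult has_wi_moment_tendsto[OF X I p inverse_Suc_null(3,2,1) cf]
      has_wi_moment_tendsto[OF Y J p inverse_Suc_null(3,2,1) cg])
  have indep: "(\<integral>\<omega>. I n \<omega> ^ p * J n \<omega> ^ p \<partial>M) = (\<integral>\<omega>. I n \<omega> ^ p \<partial>M) * (\<integral>\<omega>. J n \<omega> ^ p \<partial>M)" for n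
  proof (rule indep_var_lebesgue_integral)
    have "indep_var borel (I n) borel (J n)"
      unfolding I_def J_def c_def c'_def by (rule indep_var_form_integral_clamp[OF q s(1) s'(1) le])
    from indep_var_compose[OF this, of "\<lambda>x. x ^ p" borel "\<lambda>x. x ^ p" borel]
    show "indep_var borel (\<lambda>\<omega>. I n \<omega> ^ p) borel (\<lambda>\<omega>. J n \<omega> ^ p)" by (simp add: comp_def)
  qed (use has_wi_integrable_power[OF I p1] has_wi_integrable_power[OF J p1] in auto)
  obtain D1 where D1: "D1 \<ge> 0" "ksqnorm q f \<le> ennreal D1" by (rule has_wi_sqnorm_finite[OF X])
  obtain D2 where D2: "D2 \<ge> 0" "ksqnorm q g \<le> ennreal D2" by (rule has_wi_sqnorm_finite[OF Y])
  define R where "R = 2 * (D1 + D2) + 2"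
  define C where "C = power_diff_const p R"
  define K where "K = wi_const p * R ^ p"
  have R0: "R \<ge> 0" using D1 D2 by (simp add: R_def)
  have C: "C \<ge> 0" and K: "K \<ge> 0" using R0 power_diff_const_nonneg wi_const_nonneg by (auto simp: C_def K_def)
  have R: "ksqnorm q f \<le> ennreal R" "ksqnorm q g \<le> ennreal R"
    "ksqnorm q (form_kernel (c n)) \<le> ennreal R" "ksqnorm q (form_kernel (c' n)) \<le> ennreal R" for n
  proof -
    have "ennreal D1 \<le> ennreal R" "ennreal D2 \<le> ennreal R" "ennreal (2 * D1 + 2) \<le> ennreal R" "ennreal (2 * D2 + 2) \<le> ennreal R"
      by (intro ennreal_leI; use D1 D2 in \<open>simp add: R_def\<close>)+
    then show "ksqnorm q f \<le> ennreal R" "ksqnorm q g \<le> ennreal R"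
      "ksqnorm q (form_kernel (c n)) \<le> ennreal R" "ksqnorm q (form_kernel (c' n)) \<le> ennreal R"
      using D1 D2 approx_sqnorm_le[OF _ _ D1(2,1) cf inverse_Suc_null(3,2), of n]
        approx_sqnorm_le[OF _ _ D2(2,1) cg inverse_Suc_null(3,2), of n] by (auto intro: order_trans)
  qed
  \<comment> \<open>The products are compared by changing one factor at a time, so each error term
    is a difference of p-th powers times a p-th power of bounded norm.\<close>
  have est: "\<bar>(\<integral>\<omega>. I n \<omega> ^ p * J n \<omega> ^ p \<partial>M) - (\<integral>\<omega>. X \<omega> ^ p * Y \<omega> ^ p \<partial>M)\<bar> \<le>
      sqrt (K * (C * inverse (real (Suc n)))) + sqrt (C * inverse (real (Suc n)) * K)" for n
  proof -
    let ?d = "C * inverse (real (Suc n))"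
    have d: "?d \<ge> 0" using C by simp
    have a1: "sqnorm M (\<lambda>\<omega>. X \<omega> ^ p) \<le> ennreal K" "sqnorm M (\<lambda>\<omega>. J n \<omega> ^ p) \<le> ennreal K" "sqnorm M (\<lambda>\<omega>. Y \<omega> ^ p) \<le> ennreal K"
      unfolding K_def by (rule has_wi_power_sqnorm_le[OF X p1 R(1) R0] has_wi_power_sqnorm_le[OF J p1 R(4) R0]
        has_wi_power_sqnorm_le[OF Y p1 R(2) R0])+
    have a2: "sqnorm M (\<lambda>\<omega>. Y \<omega> ^ p - J n \<omega> ^ p) \<le> ennreal ?d"
      unfolding C_def by (rule has_wi_power_diff_le[OF Y J p R0 R(2,4) inverse_Suc_null(3) cg])
    have a3: "sqnorm M (\<lambda>\<omega>. X \<omega> ^ p - I n \<omega> ^ p) \<le> ennreal ?d"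
      unfolding C_def by (rule has_wi_power_diff_le[OF X I p R0 R(1,3) inverse_Suc_null(3) cf])
    note i1 = sqnorm_bound_mult[OF _ _ a1(1) a2 K d, simplified]
    note i2 = sqnorm_bound_mult[OF _ _ a3 a1(2) d K, simplified]
    note i3 = sqnorm_bound_mult(1)[OF _ _ a1(1) a1(3) K K, simplified]
    have int: "integrable M (\<lambda>\<omega>. X \<omega> ^ p * (Y \<omega> ^ p - J n \<omega> ^ p))" "integrable M (\<lambda>\<omega>. (X \<omega> ^ p - I n \<omega> ^ p) * J n \<omega> ^ p)"
      "integrable M (\<lambda>\<omega>. X \<omega> ^ p * Y \<omega> ^ p)"
      using i1(1) i2(1) i3 by simp_all
    have eq: "I n \<omega> ^ p * J n \<omega> ^ p = X \<omega> ^ p * Y \<omega> ^ p - X \<omega> ^ p * (Y \<omega> ^ p - J n \<omega> ^ p) - (X \<omega> ^ p - I n \<omega> ^ p) * J n \<omega> ^ p" for \<omega>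
      by (simp add: algebra_simps)
    have "(\<integral>\<omega>. I n \<omega> ^ p * J n \<omega> ^ p \<partial>M) - (\<integral>\<omega>. X \<omega> ^ p * Y \<omega> ^ p \<partial>M) =
      - (\<integral>\<omega>. X \<omega> ^ p * (Y \<omega> ^ p - J n \<omega> ^ p) \<partial>M) - (\<integral>\<omega>. (X \<omega> ^ p - I n \<omega> ^ p) * J n \<omega> ^ p \<partial>M)"
      unfolding eq using int by (subst Bochner_Integration.integral_diff, simp, simp, subst Bochner_Integration.integral_diff) auto
    also have "\<bar>\<dots>\<bar> \<le> (\<integral>\<omega>. \<bar>X \<omega> ^ p * (Y \<omega> ^ p - J n \<omega> ^ p)\<bar> \<partial>M) + (\<integral>\<omega>. \<bar>(X \<omega> ^ p - I n \<omega> ^ p) * J n \<omega> ^ p\<bar> \<partial>M)"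
      using integral_abs_bound[of M "\<lambda>\<omega>. X \<omega> ^ p * (Y \<omega> ^ p - J n \<omega> ^ p)"]
        integral_abs_bound[of M "\<lambda>\<omega>. (X \<omega> ^ p - I n \<omega> ^ p) * J n \<omega> ^ p"] by linarith
    also have "\<dots> \<le> sqrt (K * ?d) + sqrt (?d * K)"
      by (intro add_mono sqnorm_bound_mult(2)[OF _ _ a1(1) a2 K d] sqnorm_bound_mult(2)[OF _ _ a3 a1(2) d K]) auto
    finally show ?thesis .
  qed
  have "(\<lambda>n. sqrt (K * (C * inverse (real (Suc n)))) + sqrt (C * inverse (real (Suc n)) * K)) \<longlonglongrightarrow>
      sqrt (K * (C * 0)) + sqrt (C * 0 * K)"
    by (intro tendsto_intros inverse_Suc_null)
  then have "(\<lambda>n. (\<integral>\<omega>. I n \<omega> ^ p * J n \<omega> ^ p \<partial>M) - (\<integral>\<omega>. X \<omega> ^ p * Y \<omega> ^ p \<partial>M)) \<longlonglongrightarrow> 0"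
    by (intro Lim_null_comparison[OF always_eventually, OF allI, OF est[folded real_norm_def]]) simp
  then have "(\<lambda>n. \<integral>\<omega>. I n \<omega> ^ p * J n \<omega> ^ p \<partial>M) \<longlonglongrightarrow> (\<integral>\<omega>. X \<omega> ^ p * Y \<omega> ^ p \<partial>M)"
    by (simp add: LIM_zero_iff)
  then show ?thesis using lim1 unfolding indep by (rule LIMSEQ_unique)
qed

end

subsection \<open>Density of elementary kernels\<close>

text \<open>This is the part of integrability that concerns only the kernel; it makes the density
  argument independent of the Brownian motion.\<close>

definition approximable :: "nat \<Rightarrow> ((nat \<Rightarrow> real) \<Rightarrow> real) \<Rightarrow> bool" where
  "approximable q f \<longleftrightarrow> f \<in> borel_measurable (lborel_pi q) \<and>
    (\<forall>\<epsilon>>0. \<exists>s\<in>elementary_forms q. ksqnorm q (\<lambda>y. f y - form_kernel s y) \<le> ennreal \<epsilon>)"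

lemma approximable_measurable: "approximable q f \<Longrightarrow> f \<in> borel_measurable (lborel_pi q)"
  by (simp add: approximable_def)

lemma approximable_form_kernel: "s \<in> elementary_forms q \<Longrightarrow> approximable q (form_kernel s)"
  unfolding approximable_def by (auto intro!: bexI[of _ s] simp: sqnorm_def borel_measurable_form_kernel)

lemma approximable_lincomb:
  assumes "approximable q f" "approximable q g"
  shows "approximable q (\<lambda>y. c * f y + d * g y)"
  unfolding approximable_def
proof (intro conjI allI impI)
  note [measurable] = assms[THEN approximable_measurable]
  show "(\<lambda>y. c * f y + d * g y) \<in> borel_measurable (lborel_pi q)" by measurable
  fix \<epsilon> :: real assume "\<epsilon> > 0"
  obtain e where e: "e > 0" and le: "ennreal (2 * c\<^sup>2 * e + 2 * d\<^sup>2 * e) \<le> ennreal \<epsilon>"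
    using lincomb_tolerance[OF \<open>\<epsilon> > 0\<close>] by blast
  obtain s where s: "s \<in> elementary_forms q" "ksqnorm q (\<lambda>y. f y - form_kernel s y) \<le> ennreal e"
    using assms(1) e unfolding approximable_def by blast
  obtain s' where s': "s' \<in> elementary_forms q" "ksqnorm q (\<lambda>y. g y - form_kernel s' y) \<le> ennreal e"
    using assms(2) e unfolding approximable_def by blast
  note [measurable] = borel_measurable_form_kernel[OF s(1)] borel_measurable_form_kernel[OF s'(1)]
  have 1: "ksqnorm q (\<lambda>y. c * (f y - form_kernel s y) + d * (g y - form_kernel s' y)) \<le> ennreal \<epsilon>"
    by (rule order_trans[OF sqnorm_lincomb_le le]) (use s s' e in auto)
  show "\<exists>s\<in>elementary_forms q. ksqnorm q (\<lambda>y. c * f y + d * g y - form_kernel s y) \<le> ennreal \<epsilon>"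
    using 1 by (intro bexI[OF _ elementary_forms_lincomb[OF s(1) s'(1), of c d]])
      (simp add: form_kernel_def algebra_simps)
qed

lemma approximable_limit:
  assumes [measurable]: "f \<in> borel_measurable (lborel_pi q)"
    and "\<And>\<epsilon>. \<epsilon> > 0 \<Longrightarrow> \<exists>g. approximable q g \<and> ksqnorm q (\<lambda>y. f y - g y) \<le> ennreal \<epsilon>"
  shows "approximable q f"
  unfolding approximable_def
proof (intro conjI allI impI)
  fix \<epsilon> :: real assume "\<epsilon> > 0"
  then obtain g where g: "approximable q g" "ksqnorm q (\<lambda>y. f y - g y) \<le> ennreal (\<epsilon> / 4)"
    using assms(2)[of "\<epsilon> / 4"] by auto
  then obtain s where s: "s \<in> elementary_forms q" "ksqnorm q (\<lambda>y. g y - form_kernel s y) \<le> ennreal (\<epsilon> / 4)"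
    using \<open>\<epsilon> > 0\<close> unfolding approximable_def by (metis zero_less_divide_iff zero_less_numeral)
  note [measurable] = borel_measurable_form_kernel[OF s(1)] approximable_measurable[OF g(1)]
  have "ksqnorm q (\<lambda>y. 1 * (f y - g y) + 1 * (g y - form_kernel s y)) \<le>
      ennreal (2 * 1\<^sup>2 * (\<epsilon> / 4) + 2 * 1\<^sup>2 * (\<epsilon> / 4))"
    using g s \<open>\<epsilon> > 0\<close> by (intro sqnorm_lincomb_le) auto
  then show "\<exists>s\<in>elementary_forms q. ksqnorm q (\<lambda>y. f y - form_kernel s y) \<le> ennreal \<epsilon>"
    using s(1) by (intro bexI[of _ s]) auto
qed measurable

lemma approximable_cong:
  assumes f: "approximable q f" and eq: "\<And>y. y \<in> space (lborel_pi q) \<Longrightarrow> f y = g y"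
  shows "approximable q g"
proof -
  have "g \<in> borel_measurable (lborel_pi q)"
    using approximable_measurable[OF f] eq by (simp cong: measurable_cong)
  moreover have "ksqnorm q (\<lambda>y. g y - k y) = ksqnorm q (\<lambda>y. f y - k y)" for k
    using eq by (intro sqnorm_cong_AE AE_I2) simp
  ultimately show ?thesis using f by (simp add: approximable_def)
qed

lemma sqnorm_dominated_tendsto:
  assumes [measurable]: "f \<in> borel_measurable N" "\<And>n. g n \<in> borel_measurable N" "w \<in> borel_measurable N"
    and w: "sqnorm N w < \<infinity>"
    and f: "AE y in N. \<bar>f y\<bar> \<le> w y" and g: "\<And>n. AE y in N. \<bar>g n y\<bar> \<le> w y"
    and lim: "AE y in N. (\<lambda>n. g n y) \<longlonglongrightarrow> f y"
  shows "(\<lambda>n. sqnorm N (\<lambda>y. f y - g n y)) \<longlonglongrightarrow> 0"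
proof -
  have "(\<lambda>n. \<integral>\<^sup>+y. ennreal ((f y - g n y)\<^sup>2) \<partial>N) \<longlonglongrightarrow> (\<integral>\<^sup>+y. 0 \<partial>N)"
  proof (rule nn_integral_dominated_convergence)
    show "AE y in N. ennreal ((f y - g n y)\<^sup>2) \<le> ennreal 4 * ennreal ((w y)\<^sup>2)" for n
      using f g[of n]
    proof eventually_elim
      case (elim y)
      then have "\<bar>f y - g n y\<bar> \<le> \<bar>2 * w y\<bar>" by linarith
      then have "(f y - g n y)\<^sup>2 \<le> (2 * w y)\<^sup>2" by (simp only: abs_le_square_iff)
      then show ?case by (simp add: ennreal_mult[symmetric] power_mult_distrib ennreal_leI del: ennreal_numeral)
    qed
    show "(\<integral>\<^sup>+y. ennreal 4 * ennreal ((w y)\<^sup>2) \<partial>N) < \<infinity>"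
      using w by (simp add: nn_integral_cmult sqnorm_def ennreal_mult_less_top)
    show "AE y in N. (\<lambda>n. ennreal ((f y - g n y)\<^sup>2)) \<longlonglongrightarrow> 0"
      using lim
    proof eventually_elim
      case (elim y)
      then have "(\<lambda>n. (f y - g n y)\<^sup>2) \<longlonglongrightarrow> (f y - f y)\<^sup>2" by (intro tendsto_intros)
      from tendsto_ennrealI[OF this] show ?case by simp
    qed
  qed measurable
  then show ?thesis by (simp add: sqnorm_def)
qed

lemma approximable_dominated:
  assumes [measurable]: "f \<in> borel_measurable (lborel_pi q)" "w \<in> borel_measurable (lborel_pi q)"
    and g: "\<And>n. approximable q (g n)" and w: "ksqnorm q w < \<infinity>"
    and bound: "AE y in lborel_pi q. \<bar>f y\<bar> \<le> w y" "\<And>n. AE y in lborel_pi q. \<bar>g n y\<bar> \<le> w y"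
    and lim: "AE y in lborel_pi q. (\<lambda>n. g n y) \<longlonglongrightarrow> f y"
  shows "approximable q f"
proof (rule approximable_limit)
  fix \<epsilon> :: real assume "\<epsilon> > 0"
  note [measurable] = approximable_measurable[OF g]
  have "(\<lambda>n. ksqnorm q (\<lambda>y. f y - g n y)) \<longlonglongrightarrow> 0"
    by (rule sqnorm_dominated_tendsto[OF _ _ _ w bound lim]) measurable
  from order_tendstoD(2)[OF this, of "ennreal \<epsilon>"] \<open>\<epsilon> > 0\<close>
  have "\<forall>\<^sub>F n in sequentially. ksqnorm q (\<lambda>y. f y - g n y) < ennreal \<epsilon>" by simp
  then have "\<exists>n. ksqnorm q (\<lambda>y. f y - g n y) < ennreal \<epsilon>"
    by (rule eventually_happens'[OF sequentially_bot])
  then show "\<exists>g. approximable q g \<and> ksqnorm q (\<lambda>y. f y - g y) \<le> ennreal \<epsilon>"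
    using g less_imp_le by blast
qed fact

text \<open>With all coordinates but the i-th fixed, the section of the diagonal is one point, hence
  null.\<close>

lemma AE_lborel_pi_distinct:
  "AE y in lborel_pi q. \<forall>i<q. \<forall>j<q. i \<noteq> j \<longrightarrow> y i \<noteq> y j"
proof -
  have *: "AE y in lborel_pi q. y i \<noteq> y j" if ij: "i < q" "j < q" "i \<noteq> j" for i j
  proof -
    define I where "I = {..<q} - {i}"
    have I: "finite I" "i \<notin> I" "insert i I = {..<q}" "j \<in> I" using ij by (auto simp: I_def)
    have [measurable]: "i \<in> insert i I" "j \<in> insert i I" using I by auto
    have m: "(\<lambda>y :: nat \<Rightarrow> real. indicator {0} (y i - y j) :: ennreal) \<in> borel_measurable (PiM (insert i I) (\<lambda>_. lborel))"
      by measurable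
    have "(\<integral>\<^sup>+y. indicator {0 :: real} (y i - y j) \<partial>PiM (insert i I) (\<lambda>_. lborel)) =
       (\<integral>\<^sup>+x. \<integral>\<^sup>+z. indicator {0 :: real} ((x(i := z)) i - (x(i := z)) j) \<partial>lborel \<partial>PiM I (\<lambda>_. lborel))"
      using lborel_product.product_nn_integral_insert[OF I(1,2) m] by simp
    also have "\<dots> = (\<integral>\<^sup>+x. \<integral>\<^sup>+z. indicator {x j :: real} z \<partial>lborel \<partial>PiM I (\<lambda>_. lborel))"
      using ij by (intro nn_integral_cong) (auto simp: indicator_def)
    also have "\<dots> = 0" by simp
    finally have "(\<integral>\<^sup>+y. indicator {0 :: real} (y i - y j) \<partial>lborel_pi q) = 0" using I(3) by simp
    then have "AE y in lborel_pi q. (indicator {0 :: real} (y i - y j) :: ennreal) = 0"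
      using m unfolding I(3) by (subst (asm) nn_integral_0_iff_AE) auto
    then show ?thesis by eventually_elim (auto simp: indicator_def split: if_splits)
  qed
  have "AE y in lborel_pi q. \<forall>i\<in>{..<q}. \<forall>j\<in>{..<q}. i \<noteq> j \<longrightarrow> y i \<noteq> y j"
  proof (intro AE_finite_allI finite_lessThan)
    fix i j assume "i \<in> {..<q}" "j \<in> {..<q}"
    then show "AE y in lborel_pi q. i \<noteq> j \<longrightarrow> y i \<noteq> y j"
      using *[of i j] by (cases "i = j") auto
  qed
  then show ?thesis by eventually_elim auto
qed

lemma grid_cell_exists:
  assumes "t 0 < (y::real)" "y \<le> t m"
  shows "\<exists>j<m. y \<in> {t j<..t (Suc j)}"
  using assms
proof (induction m)
  case (Suc m)
  then show ?case by (cases "y \<le> t m") (auto intro: less_SucI)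
qed auto

lemma form_kernel_eval_cell:
  assumes t: "strict_mono_on {..m} t" and k: "k \<in> offdiag_indices q m"
    and y: "\<And>i. i < q \<Longrightarrow> y i \<in> {t (k i)<..t (Suc (k i))}"
  shows "form_kernel (grid_form q m t a) y = a k"
proof -
  have "(\<Prod>i<q. indicator {t (l i)<..t (Suc (l i))} (y i) :: real) = (if l = k then 1 else 0)"
    if l: "l \<in> offdiag_indices q m" for l
  proof (cases "l = k")
    case True
    then show ?thesis using y by auto
  next
    case False
    have "\<exists>i<q. l i \<noteq> k i"
    proof (rule ccontr)
      assume "\<not> (\<exists>i<q. l i \<noteq> k i)"
      then have "k = l" using k l by (intro PiE_ext[of k "{..<q}" "\<lambda>_. {..<m}" l]) (auto simp: offdiag_indices_def)
      with False show False by simp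
    qed
    then obtain i where "i < q" "l i \<noteq> k i" by blast
    then have "y i \<notin> {t (l i)<..t (Suc (l i))}"
      using grid_cells_unique[OF t offdiag_indicesD[OF l] offdiag_indicesD[OF k] _ y] by blast
    then have "(\<Prod>i<q. indicator {t (l i)<..t (Suc (l i))} (y i) :: real) = 0"
      using \<open>i < q\<close> by (intro prod_zero bexI[of _ i]) simp_all
    then show ?thesis using False by simp
  qed
  then show ?thesis
    unfolding form_kernel_grid_form_eq[OF t] using k by (simp add: if_distrib[of "\<lambda>x. _ * x"] cong: if_cong)
qed

lemma form_kernel_eval_outside:
  assumes t: "strict_mono_on {..m} t"
    and "\<And>k. k \<in> offdiag_indices q m \<Longrightarrow> \<exists>i<q. y i \<notin> {t (k i)<..t (Suc (k i))}"
  shows "form_kernel (grid_form q m t a) y = 0"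
  unfolding form_kernel_grid_form_eq[OF t]
proof (intro sum.neutral ballI)
  fix k assume "k \<in> offdiag_indices q m"
  then obtain i where "i < q" "y i \<notin> {t (k i)<..t (Suc (k i))}" using assms(2) by blast
  then have "(\<Prod>i<q. indicator {t (k i)<..t (Suc (k i))} (y i) :: real) = 0"
    by (intro prod_zero bexI[of _ i]) simp_all
  then show "a k * (\<Prod>i<q. indicator {t (k i)<..t (Suc (k i))} (y i)) = 0" by simp
qed

definition cube :: "nat \<Rightarrow> real \<Rightarrow> (nat \<Rightarrow> real) \<Rightarrow> real" where
  "cube q L y = (\<Prod>i<q. indicator {-L<..L} (y i))"

lemma prod_indicator_eq:
  fixes q :: nat
  shows "(\<Prod>i<q. indicator (A i) (y i) :: real) = (if \<forall>i<q. y i \<in> A i then 1 else 0)"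
proof (cases "\<forall>i<q. y i \<in> A i")
  case False
  then obtain i where "i < q" "y i \<notin> A i" by blast
  then have "(\<Prod>i<q. indicator (A i) (y i) :: real) = 0" by (intro prod_zero bexI[of _ i]) simp_all
  then show ?thesis using False by simp
qed auto

lemma cube_eq: "cube q L y = (if \<forall>i<q. -L < y i \<and> y i \<le> L then 1 else 0)"
  unfolding cube_def prod_indicator_eq by auto

lemma borel_measurable_cube [measurable]: "cube q L \<in> borel_measurable (lborel_pi q)"
  unfolding cube_def[abs_def] by (intro borel_measurable_prod) auto

lemma sqnorm_cube: "ksqnorm q (cube q L) < \<infinity>"
proof -
  have "ksqnorm q (cube q L) = (\<integral>\<^sup>+y. (\<Prod>i<q. indicator {-L<..L} (y i)) \<partial>lborel_pi q)"
    unfolding sqnorm_def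
  proof (intro nn_integral_cong)
    fix y
    have "(cube q L y)\<^sup>2 = cube q L y" by (simp add: cube_eq)
    then show "ennreal ((cube q L y)\<^sup>2) = (\<Prod>i<q. indicator {-L<..L} (y i))"
      by (simp add: cube_def prod_ennreal[symmetric] ennreal_indicator)
  qed
  also have "\<dots> = (\<Prod>i<q. \<integral>\<^sup>+x. indicator {-L<..L} x \<partial>lborel)"
    by (intro lborel_product.product_nn_integral_prod) auto
  also have "\<dots> < \<infinity>"
  proof -
    have "emeasure lborel {-L<..L} < \<infinity>"
      by (rule emeasure_bounded_finite) (rule bounded_subset[of "{-L..L}"], auto)
    then show ?thesis by (simp add: power_less_top_ennreal)
  qed
  finally show ?thesis .
qed

text \<open>Elementary kernels vanish near the diagonals while the box may meet them. As the mesh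
  tends to 0 the excluded region shrinks to the diagonals, and at every point with distinct
  coordinates the approximation is eventually exact.\<close>

lemma approximable_box:
  assumes L: "L > 0" and c: "\<And>i. i < q \<Longrightarrow> -L \<le> c i" and d: "\<And>i. i < q \<Longrightarrow> d i \<le> L"
  shows "approximable q (\<lambda>y. \<Prod>i<q. indicator {c i<..d i} (y i))"
proof -
  define h where "h n = 2 * L / real (Suc n)" for n
  define t where "t n j = -L + h n * real j" for n j
  \<comment> \<open>A grid box receives the value of the target at its lower corner.\<close>
  define a :: "nat \<Rightarrow> (nat \<Rightarrow> nat) \<Rightarrow> real" where "a n k = (\<Prod>i<q. indicator {c i<..d i} (t n (k i)))" for n k
  define g where "g n = form_kernel (grid_form q (Suc n) (t n) (a n))" for n
  have h: "h n > 0" for n using L by (simp add: h_def)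
  have t: "strict_mono_on {..Suc n} (t n)" for n
    using h[of n] by (intro strict_mono_onI) (simp add: t_def)
  have t_ends: "t n 0 = -L" "t n (Suc n) = L" for n by (simp_all add: t_def h_def del: of_nat_Suc)
  have cell_len: "t n (Suc j) = t n j + h n" for n j by (simp add: t_def algebra_simps)
  have a01: "a n k = 0 \<or> a n k = 1" for n k unfolding a_def prod_indicator_eq by auto
  have forms: "grid_form q (Suc n) (t n) (a n) \<in> elementary_forms q" for n
    using t by (auto simp: elementary_forms_def)
  have h_lim: "\<forall>\<^sub>F n in sequentially. h n < \<delta>" if "\<delta> > 0" for \<delta>
  proof -
    have "(\<lambda>n. 2 * L * inverse (real (Suc n))) \<longlonglongrightarrow> 2 * L * 0"
      by (intro tendsto_intros LIMSEQ_inverse_real_of_nat)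
    then show ?thesis using that by (auto simp: h_def divide_inverse intro: order_tendstoD(2))
  qed
  have bound: "\<bar>g n y\<bar> \<le> cube q L y" for n y
  proof (cases "\<exists>k\<in>offdiag_indices q (Suc n). \<forall>i<q. y i \<in> {t n (k i)<..t n (Suc (k i))}")
    case True
    then obtain k where k: "k \<in> offdiag_indices q (Suc n)" "\<And>i. i < q \<Longrightarrow> y i \<in> {t n (k i)<..t n (Suc (k i))}" by blast
    have "-L < y i \<and> y i \<le> L" if "i < q" for i
    proof -
      have "t n 0 \<le> t n (k i)" "t n (Suc (k i)) \<le> t n (Suc n)"
        using offdiag_indicesD[OF k(1) that] by (intro strict_mono_on_grid_le[OF t]; simp)+
      then show ?thesis using k(2)[OF that] by (auto simp: t_ends)
    qed
    then show ?thesis using form_kernel_eval_cell[OF t k, of "a n"] a01[of n k] by (auto simp: g_def cube_eq)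
  next
    case False
    then have "g n y = 0" unfolding g_def by (intro form_kernel_eval_outside[OF t]) blast
    then show ?thesis by (simp add: cube_eq)
  qed
  have lim: "(\<lambda>n. g n y) \<longlonglongrightarrow> (\<Prod>i<q. indicator {c i<..d i} (y i))"
    if dist: "\<forall>i<q. \<forall>j<q. i \<noteq> j \<longrightarrow> y i \<noteq> y j" for y
  proof (cases "\<forall>i<q. -L < y i \<and> y i \<le> L")
    case False
    then have "g n y = 0" for n using bound[of n y] by (auto simp: cube_eq split: if_splits)
    moreover have "(\<Prod>i<q. indicator {c i<..d i} (y i) :: real) = 0"
    proof -
      from False obtain i where i: "i < q" "\<not> (-L < y i \<and> y i \<le> L)" by blast
      then have "y i \<notin> {c i<..d i}" using c[OF i(1)] d[OF i(1)] by auto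
      then show ?thesis unfolding prod_indicator_eq using i(1) by auto
    qed
    ultimately show ?thesis by (simp only: tendsto_const)
  next
    case True
    \<comment> \<open>Once the mesh is below all gaps between coordinates, they lie in different
      cells, so the multi-index of the box is injective and hence present in the form.\<close>
    have e1: "\<forall>\<^sub>F n in sequentially. \<forall>i\<in>{..<q}. \<forall>j\<in>{..<q}. i \<noteq> j \<longrightarrow> h n < \<bar>y i - y j\<bar>"
    proof (intro eventually_ball_finite finite_lessThan ballI)
      fix i j assume "i \<in> {..<q}" "j \<in> {..<q}"
      then show "\<forall>\<^sub>F n in sequentially. i \<noteq> j \<longrightarrow> h n < \<bar>y i - y j\<bar>"
        using dist h_lim[of "\<bar>y i - y j\<bar>"] by (cases "i = j") auto
    qed
    \<comment> \<open>A corner lies less than the coordinate, by at most the mesh. For a small mesh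
      it cannot have crossed c or d, so corner and point are on the same side of both ends.\<close>
    have e2: "\<forall>\<^sub>F n in sequentially. \<forall>i\<in>{..<q}. (c i < y i \<longrightarrow> h n < y i - c i) \<and> (d i < y i \<longrightarrow> h n < y i - d i)"
    proof (intro eventually_ball_finite finite_lessThan ballI eventually_conj)
      fix i
      show "\<forall>\<^sub>F n in sequentially. c i < y i \<longrightarrow> h n < y i - c i"
        using h_lim[of "y i - c i"] by (cases "c i < y i") auto
      show "\<forall>\<^sub>F n in sequentially. d i < y i \<longrightarrow> h n < y i - d i"
        using h_lim[of "y i - d i"] by (cases "d i < y i") auto
    qed
    have "\<forall>\<^sub>F n in sequentially. g n y = (\<Prod>i<q. indicator {c i<..d i} (y i))"
      using e1 e2
    proof eventually_elim
      case (elim n)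
      have "\<forall>i. \<exists>j. i < q \<longrightarrow> j < Suc n \<and> y i \<in> {t n j<..t n (Suc j)}"
        using grid_cell_exists[of "t n" _ "Suc n"] True by (metis t_ends)
      from choice[OF this] obtain k0 where k0: "\<And>i. i < q \<Longrightarrow> k0 i < Suc n \<and> y i \<in> {t n (k0 i)<..t n (Suc (k0 i))}"
        by blast
      define k where "k = restrict k0 {..<q}"
      have k: "k i < Suc n" "y i \<in> {t n (k i)<..t n (Suc (k i))}" if "i < q" for i
        using k0[OF that] that by (auto simp: k_def)
      have "inj_on k {..<q}"
      proof (rule inj_onI, rule ccontr)
        fix i j assume ij: "i \<in> {..<q}" "j \<in> {..<q}" "k i = k j" "i \<noteq> j"
        then have "h n < \<bar>y i - y j\<bar>" using elim(1) by blast
        moreover have "y i \<in> {t n (k i)<..t n (k i) + h n}" "y j \<in> {t n (k i)<..t n (k i) + h n}"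
          using k(2)[of i] k(2)[of j] ij by (simp_all add: cell_len)
        ultimately show False by (auto simp: abs_if split: if_splits)
      qed
      then have k_in: "k \<in> offdiag_indices q (Suc n)" using k(1) by (auto simp: offdiag_indices_def k_def)
      have "g n y = a n k" unfolding g_def by (rule form_kernel_eval_cell[OF t k_in k(2)])
      also have "\<dots> = (\<Prod>i<q. indicator {c i<..d i} (y i))"
        unfolding a_def
      proof (intro prod.cong refl)
        fix i assume i: "i \<in> {..<q}"
        have "y i \<in> {t n (k i)<..t n (k i) + h n}" using k(2)[of i] i by (simp add: cell_len)
        moreover have "(c i < y i \<longrightarrow> h n < y i - c i) \<and> (d i < y i \<longrightarrow> h n < y i - d i)" using elim(2) i by blast
        ultimately have "t n (k i) \<in> {c i<..d i} \<longleftrightarrow> y i \<in> {c i<..d i}" by auto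
        then show "indicator {c i<..d i} (t n (k i)) = (indicator {c i<..d i} (y i) :: real)"
          by (simp add: indicator_def)
      qed
      finally show ?case .
    qed
    then show ?thesis by (rule tendsto_eventually)
  qed
  show ?thesis
  proof (rule approximable_dominated[OF _ borel_measurable_cube _ sqnorm_cube[of q L], where g=g])
    show "(\<lambda>y. \<Prod>i<q. indicator {c i<..d i} (y i) :: real) \<in> borel_measurable (lborel_pi q)"
      by (intro borel_measurable_prod) auto
    show "approximable q (g n)" for n unfolding g_def by (rule approximable_form_kernel[OF forms])
    show "AE y in lborel_pi q. \<bar>\<Prod>i<q. indicator {c i<..d i} (y i) :: real\<bar> \<le> cube q L y"
      unfolding prod_indicator_eq cube_eq using c d by (intro AE_I2) (auto intro: le_less_trans order_trans)
    show "AE y in lborel_pi q. \<bar>g n y\<bar> \<le> cube q L y" for n using bound by simp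
    show "AE y in lborel_pi q. (\<lambda>n. g n y) \<longlonglongrightarrow> (\<Prod>i<q. indicator {c i<..d i} (y i))"
      using AE_lborel_pi_distinct[of q] by eventually_elim (rule lim)
  qed
qed

text \<open>Lower orthants are stable under intersection, and their traces on a cube are boxes; this
  generator suits an induction from boxes to all measurable sets. For q = 0 the product is a
  one-point space and is treated apart.\<close>

lemma sets_lborel_pi_eq:
  "sets (lborel_pi q) = sigma_sets ({..<q} \<rightarrow>\<^sub>E UNIV)
     (range (\<lambda>x :: nat \<Rightarrow> real. {y \<in> {..<q} \<rightarrow>\<^sub>E UNIV. \<forall>i<q. y i \<le> x i}))"
proof (cases "q = 0")
  case True
  then show ?thesis by (simp add: sets_PiM_empty sigma_sets_empty_eq image_constant_conv sigma_sets_singleton)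
next
  case False
  have "sets (lborel_pi q) = sets (PiM {..<q} (\<lambda>_. sigma UNIV (range (\<lambda>a::real. {..a}))))"
    by (intro sets_PiM_cong) (simp_all add: borel_eq_atMost[symmetric])
  also have "\<dots> = sets (sigma ({..<q} \<rightarrow>\<^sub>E UNIV)
      {{f\<in>({..<q} \<rightarrow>\<^sub>E UNIV). \<forall>i\<in>j. f i \<in> A i} | A j. j \<in> {{..<q}} \<and> A \<in> Pi j (\<lambda>_. range (\<lambda>a::real. {..a}))})"
  proof (rule sets_PiM_sigma)
    show "\<exists>S\<subseteq>range (\<lambda>a::real. {..a}). countable S \<and> UNIV = \<Union> S" for i :: nat
      by (intro exI[of _ "range (\<lambda>n::nat. {..real n})"]) (auto intro: real_arch_simple)
  qed auto
  also have "{{f\<in>({..<q} \<rightarrow>\<^sub>E UNIV). \<forall>i\<in>j. f i \<in> A i} | A j. j \<in> {{..<q}} \<and> A \<in> Pi j (\<lambda>_. range (\<lambda>a::real. {..a}))} =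
      range (\<lambda>x. {y \<in> {..<q} \<rightarrow>\<^sub>E UNIV. \<forall>i<q. y i \<le> x i})"
  proof (intro set_eqI iffI)
    fix Z :: "(nat \<Rightarrow> real) set" assume "Z \<in> {{f\<in>({..<q} \<rightarrow>\<^sub>E UNIV). \<forall>i\<in>j. f i \<in> A i} | A j. j \<in> {{..<q}} \<and> A \<in> Pi j (\<lambda>_. range (\<lambda>a::real. {..a}))}"
    then obtain A where A: "Z = {f\<in>({..<q} \<rightarrow>\<^sub>E UNIV). \<forall>i\<in>{..<q}. f i \<in> A i}" "\<And>i. i < q \<Longrightarrow> A i \<in> range (\<lambda>a::real. {..a})" by auto
    have "\<forall>i. \<exists>a. i < q \<longrightarrow> A i = {..a}" using A(2) by blast
    from choice[OF this] obtain x where "\<forall>i. i < q \<longrightarrow> A i = {..x i}" ..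
    then have "Z = {y \<in> {..<q} \<rightarrow>\<^sub>E UNIV. \<forall>i<q. y i \<le> x i}" unfolding A(1) by auto
    then show "Z \<in> range (\<lambda>x. {y \<in> {..<q} \<rightarrow>\<^sub>E UNIV. \<forall>i<q. y i \<le> x i})" by blast
  next
    fix Z :: "(nat \<Rightarrow> real) set" assume "Z \<in> range (\<lambda>x. {y \<in> {..<q} \<rightarrow>\<^sub>E UNIV. \<forall>i<q. y i \<le> x i})"
    then obtain x where "Z = {y \<in> {..<q} \<rightarrow>\<^sub>E UNIV. \<forall>i<q. y i \<le> x i}" by blast
    then have "Z = {f\<in>({..<q} \<rightarrow>\<^sub>E UNIV). \<forall>i\<in>{..<q}. f i \<in> {..x i}}" by auto
    then show "Z \<in> {{f\<in>({..<q} \<rightarrow>\<^sub>E UNIV). \<forall>i\<in>j. f i \<in> A i} | A j. j \<in> {{..<q}} \<and> A \<in> Pi j (\<lambda>_. range (\<lambda>a::real. {..a}))}"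
      by (auto intro!: exI[of _ "\<lambda>i. {..x i}"])
  qed
  finally show ?thesis by (subst (asm) sets_measure_of) auto
qed

text \<open>The sets with this property form a Dynkin system. The factor \<open>cube q L\<close>
  keeps all norms finite, so complements become differences from the cube and countable unions are
  dominated by it.\<close>

lemma approximable_indicator_cube:
  assumes A: "A \<in> sets (lborel_pi q)" and L: "L > 0"
  shows "approximable q (\<lambda>y. indicator A y * cube q L y)"
proof -
  let ?\<Omega> = "{..<q} \<rightarrow>\<^sub>E (UNIV :: real set)"
  let ?G = "range (\<lambda>x. {y \<in> ?\<Omega>. \<forall>i<q. y i \<le> x i})"
  have cube: "approximable q (cube q L)"
    unfolding cube_def[abs_def] by (rule approximable_box[OF L]) auto
  have zero: "approximable q (\<lambda>y. 0)" using approximable_lincomb[OF cube cube, of 0 0] by simp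
  have "Int_stable ?G"
  proof (rule Int_stableI)
    fix S T assume "S \<in> ?G" "T \<in> ?G"
    then obtain x x' where "S = {y \<in> ?\<Omega>. \<forall>i<q. y i \<le> x i}" "T = {y \<in> ?\<Omega>. \<forall>i<q. y i \<le> x' i}" by auto
    then have "S \<inter> T = {y \<in> ?\<Omega>. \<forall>i<q. y i \<le> min (x i) (x' i)}" by auto
    then show "S \<inter> T \<in> ?G" by (intro image_eqI[where x = "\<lambda>i. min (x i) (x' i)"]) simp_all
  qed
  moreover have "?G \<subseteq> Pow ?\<Omega>" by auto
  moreover have "A \<in> sigma_sets ?\<Omega> ?G" using A unfolding sets_lborel_pi_eq .
  ultimately show ?thesis
  proof (induction rule: sigma_sets_induct_disjoint)
    case (basic S)
    then obtain x where S: "S = {y \<in> ?\<Omega>. \<forall>i<q. y i \<le> x i}" by auto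
    have "approximable q (\<lambda>y. \<Prod>i<q. indicator {-L<..min L (x i)} (y i))"
      by (rule approximable_box[OF L]) auto
    then show ?case
      by (rule approximable_cong) (auto simp: S space_PiM cube_eq prod_indicator_eq indicator_def)
  next
    case empty
    then show ?case using zero by simp
  next
    case (compl S)
    have "approximable q (\<lambda>y. 1 * cube q L y + (-1) * (indicator S y * cube q L y))"
      by (intro approximable_lincomb cube compl.IH)
    then show ?case
      by (rule approximable_cong) (auto simp: space_PiM indicator_def)
  next
    case (union S)
    have S [measurable]: "S i \<in> sets (lborel_pi q)" for i unfolding sets_lborel_pi_eq using union by auto
    have partial: "approximable q (\<lambda>y. (\<Sum>i<n. indicator (S i) y * cube q L y))" for n
    proof (induction n)
      case (Suc n)
      show ?case using approximable_lincomb[OF Suc union.IH[of n], of 1 1] by simp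
    qed (simp add: zero)
    have sum_eq: "(\<Sum>i<n. indicator (S i) y * cube q L y) = indicator (\<Union>i<n. S i) y * cube q L y" for n y
    proof -
      have "indicator (\<Union>i\<in>{..<n}. S i) y = (\<Sum>i<n. indicator (S i) y :: real)"
        by (rule indicator_UN_disjoint) (use union in \<open>auto simp: disjoint_family_on_def\<close>)
      then show ?thesis by (simp add: sum_distrib_right)
    qed
    show ?case
    proof (rule approximable_dominated[OF _ borel_measurable_cube _ sqnorm_cube[of q L]])
      show "approximable q (\<lambda>y. indicator (\<Union>i<n. S i) y * cube q L y)" for n
        using partial[of n] unfolding sum_eq .
      show "AE y in lborel_pi q. (\<lambda>n. indicator (\<Union>i<n. S i) y * cube q L y) \<longlonglongrightarrow> indicator (\<Union>i. S i) y * cube q L y"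
        by (intro AE_I2 tendsto_mult LIMSEQ_indicator_UN tendsto_const)
      show "AE y in lborel_pi q. \<bar>indicator (\<Union>i. S i) y * cube q L y\<bar> \<le> cube q L y"
        "AE y in lborel_pi q. \<bar>indicator (\<Union>i<n. S i) y * cube q L y\<bar> \<le> cube q L y" for n
        by (auto simp: cube_eq indicator_def)
    qed measurable
  qed
qed

text \<open>The induction builds u from indicators by multiples, sums and increasing limits.
  Nonnegativity lets finiteness of the norm pass to the pieces; the factor c = 0 is separate, since
  the norm of c u then says nothing about u.\<close>

lemma approximable_mult_cube:
  assumes "u \<in> borel_measurable (lborel_pi q)" "\<And>y. 0 \<le> u y" and L: "L > 0"
    and "ksqnorm q (\<lambda>y. u y * cube q L y) < \<infinity>"
  shows "approximable q (\<lambda>y. u y * cube q L y)"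
  using assms(1,2,4)
proof (induction rule: borel_measurable_induct_real)
  case (set A)
  show ?case by (rule approximable_indicator_cube[OF set(1) L])
next
  case (mult u c)
  show ?case
  proof (cases "c = 0")
    case True
    have "approximable q (\<lambda>y. 0 * (indicator {} y * cube q L y) + 0 * (indicator {} y * cube q L y))"
      by (intro approximable_lincomb approximable_indicator_cube L) auto
    then show ?thesis using True by simp
  next
    case False
    note [measurable] = mult.hyps(2)
    have "ksqnorm q (\<lambda>y. c * u y * cube q L y) = ennreal (c\<^sup>2) * ksqnorm q (\<lambda>y. u y * cube q L y)"
      unfolding mult.assoc by (rule sqnorm_cmult) measurable
    then have "ksqnorm q (\<lambda>y. u y * cube q L y) < \<infinity>"
      using mult.prems False by (auto simp: ennreal_mult_less_top ennreal_eq_0_iff)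
    from approximable_lincomb[OF mult.IH[OF this] mult.IH[OF this], of c 0] show ?thesis
      by (simp add: mult.assoc)
  qed
next
  case (add u v)
  have "ksqnorm q (\<lambda>y. u y * cube q L y) \<le> ksqnorm q (\<lambda>y. (v y + u y) * cube q L y)"
    "ksqnorm q (\<lambda>y. v y * cube q L y) \<le> ksqnorm q (\<lambda>y. (v y + u y) * cube q L y)"
    using add.hyps(2,4) by (auto intro!: sqnorm_mono_AE AE_I2 simp: cube_eq)
  then have "approximable q (\<lambda>y. u y * cube q L y)" "approximable q (\<lambda>y. v y * cube q L y)"
    using add.prems add.IH by (auto intro: le_less_trans)
  from approximable_lincomb[OF this, of 1 1] show ?case by (simp add: algebra_simps)
next
  case (seq U)
  have le: "U i y \<le> u y" if "y \<in> space (lborel_pi q)" for i y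
    using seq.hyps(3) seq.hyps(4)[OF that] by (intro incseq_le[of "\<lambda>i. U i y"]) (auto simp: incseq_def le_fun_def)
  have nn: "0 \<le> u y" if "y \<in> space (lborel_pi q)" for y
    using le[OF that, of 0] seq.hyps(2)[of 0 y] by linarith
  have [measurable]: "u \<in> borel_measurable (lborel_pi q)"
    by (rule borel_measurable_LIMSEQ_real[OF seq.hyps(4) seq.hyps(1)])
  have fin: "ksqnorm q (\<lambda>y. U i y * cube q L y) < \<infinity>" for i
    by (rule le_less_trans[OF sqnorm_mono_AE seq.prems])
      (use le seq.hyps(2) nn in \<open>auto intro!: AE_I2 simp: cube_eq\<close>)
  show ?case
  proof (rule approximable_dominated[OF _ _ seq.IH[OF fin] seq.prems])
    show "AE y in lborel_pi q. \<bar>u y * cube q L y\<bar> \<le> u y * cube q L y"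
      "AE y in lborel_pi q. \<bar>U n y * cube q L y\<bar> \<le> u y * cube q L y" for n
      using nn le seq.hyps(2) by (auto intro!: AE_I2 simp: cube_eq)
    show "AE y in lborel_pi q. (\<lambda>n. U n y * cube q L y) \<longlonglongrightarrow> u y * cube q L y"
      using seq.hyps(4) by (intro AE_I2 tendsto_mult tendsto_const) auto
  qed measurable
qed

lemma approximable_nonneg:
  assumes [measurable]: "u \<in> borel_measurable (lborel_pi q)" and u: "\<And>y. 0 \<le> u y" "ksqnorm q u < \<infinity>"
  shows "approximable q u"
proof (rule approximable_dominated[OF _ _ _ u(2)])
  have le: "\<bar>u y * cube q L y\<bar> \<le> u y" for L y using u(1)[of y] by (simp add: cube_eq)
  show "approximable q (\<lambda>y. u y * cube q (real (Suc n)) y)" for n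
  proof (rule approximable_mult_cube)
    have "ksqnorm q (\<lambda>y. u y * cube q (real (Suc n)) y) \<le> ksqnorm q u"
      using le u(1) by (intro sqnorm_mono_AE AE_I2) (simp del: of_nat_Suc)
    then show "ksqnorm q (\<lambda>y. u y * cube q (real (Suc n)) y) < \<infinity>" using u(2) by (rule le_less_trans)
  qed (use u in auto)
  show "AE y in lborel_pi q. \<bar>u y * cube q (real (Suc n)) y\<bar> \<le> u y" for n using le by simp
  show "AE y in lborel_pi q. \<bar>u y\<bar> \<le> u y" using u(1) by simp
  show "AE y in lborel_pi q. (\<lambda>n. u y * cube q (real (Suc n)) y) \<longlonglongrightarrow> u y"
  proof (rule AE_I2)
    fix y
    have "\<forall>\<^sub>F n in sequentially. \<forall>i\<in>{..<q}. \<bar>y i\<bar> < real (Suc n)"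
    proof (intro eventually_ball_finite finite_lessThan ballI)
      fix i
      obtain N :: nat where N: "\<bar>y i\<bar> < real N" using reals_Archimedean2 by blast
      show "\<forall>\<^sub>F n in sequentially. \<bar>y i\<bar> < real (Suc n)"
        using eventually_ge_at_top[of N] by eventually_elim (use N in linarith)
    qed
    then have "\<forall>\<^sub>F n in sequentially. u y * cube q (real (Suc n)) y = u y"
    proof eventually_elim
      case (elim n)
      have "\<forall>i<q. - real (Suc n) < y i \<and> y i \<le> real (Suc n)"
      proof (intro allI impI)
        fix i assume "i < q"
        then have "\<bar>y i\<bar> < real (Suc n)" using elim by blast
        then show "- real (Suc n) < y i \<and> y i \<le> real (Suc n)" by linarith
      qed
      then show ?case unfolding cube_eq by simp
    qed
    then show "(\<lambda>n. u y * cube q (real (Suc n)) y) \<longlonglongrightarrow> u y" by (rule tendsto_eventually)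
  qed
qed (use assms in auto)

lemma approximable_square_integrable:
  assumes [measurable]: "f \<in> borel_measurable (lborel_pi q)" and f: "ksqnorm q f < \<infinity>"
  shows "approximable q f"
proof -
  have "ksqnorm q (\<lambda>y. max 0 (f y)) < \<infinity>" "ksqnorm q (\<lambda>y. max 0 (- f y)) < \<infinity>"
    by (rule le_less_trans[OF sqnorm_mono_AE f]; simp)+
  then have "approximable q (\<lambda>y. max 0 (f y))" "approximable q (\<lambda>y. max 0 (- f y))"
    by (auto intro!: approximable_nonneg)
  from approximable_lincomb[OF this, of 1 "-1"]
  have "approximable q (\<lambda>y. max 0 (f y) - max 0 (- f y))" by simp
  moreover have "(\<lambda>y. max 0 (f y) - max 0 (- f y)) = f" by (auto simp: fun_eq_iff max_def)
  ultimately show ?thesis by simp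
qed

lemma (in wiener_chaos) has_wi_square_integrable:
  assumes "f \<in> borel_measurable (lborel_pi q)" "ksqnorm q f < \<infinity>"
  shows "\<exists>X. has_wi f X"
  using has_wi_exists[of f] approximable_square_integrable[OF assms] by (auto simp: approximable_def)

subsection \<open>The Hermite kernel\<close>

lemma borel_measurable_pos_powr [measurable (raw)]:
  assumes [measurable]: "f \<in> borel_measurable N"
  shows "(\<lambda>x. pos_powr (f x) a) \<in> borel_measurable N"
  unfolding pos_powr_def by measurable

lemma pos_powr_nonneg: "pos_powr x a \<ge> 0"
  by (simp add: pos_powr_def)

lemma pos_powr_mult: "e > 0 \<Longrightarrow> pos_powr (e * x) a = e powr a * pos_powr x a"
  by (auto simp: pos_powr_def powr_mult zero_less_mult_iff)

lemma borel_measurable_hermite_kernel [measurable (raw)]: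
  assumes [measurable]: "f \<in> borel_measurable N" "g \<in> measurable N (lborel_pi q)"
  shows "(\<lambda>x. hermite_kernel q H d (f x) (g x)) \<in> borel_measurable N"
proof -
  have "(\<lambda>x. g x i) \<in> borel_measurable N" if "i < q" for i
  proof -
    have "(\<lambda>y. y i) \<in> measurable (lborel_pi q) lborel" using that by (intro measurable_component_singleton) auto
    from measurable_compose[OF assms(2) this] show ?thesis by simp
  qed
  then show ?thesis
    unfolding hermite_kernel_def by (intro borel_measurable_times borel_measurable_const borel_measurable_prod
      borel_measurable_pos_powr borel_measurable_diff) auto
qed

lemma nn_integral_powr_symmetric_finite:
  assumes b: "b > -1" and D: "D \<ge> 0"
  shows "(\<integral>\<^sup>+w. indicator {-D..D} w * ennreal (\<bar>w\<bar> powr b) \<partial>lborel) < \<infinity>"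
proof -
  define g where "g w = ennreal (w powr b) * indicator {0..D} w" for w :: real
  have [measurable]: "g \<in> borel_measurable borel" unfolding g_def[abs_def] by measurable
  have g: "(\<integral>\<^sup>+w. g w \<partial>lborel) = ennreal (D powr (b + 1) / (b + 1))"
    unfolding g_def using has_integral_powr_from_0[OF b D] by (intro nn_integral_has_integral_lebesgue') auto
  have "(\<integral>\<^sup>+w. g (- w) \<partial>lborel) = (\<integral>\<^sup>+w. g w \<partial>lborel)"
    using nn_integral_real_affine[of g "-1" 0] by simp
  moreover have "(\<integral>\<^sup>+w. indicator {-D..D} w * ennreal (\<bar>w\<bar> powr b) \<partial>lborel) \<le> (\<integral>\<^sup>+w. g w + g (- w) \<partial>lborel)"
    by (intro nn_integral_mono) (auto simp: g_def indicator_def abs_if)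
  moreover have "(\<integral>\<^sup>+w. g w + g (- w) \<partial>lborel) = (\<integral>\<^sup>+w. g w \<partial>lborel) + (\<integral>\<^sup>+w. g (- w) \<partial>lborel)"
    by (rule nn_integral_add) auto
  ultimately show ?thesis using g by (auto intro: le_less_trans)
qed

text \<open>For 1/2 < a < 1 this is the Beta function value B(1 - a, 2a - 1), written as an integral
  over the half-line.\<close>

definition beta_const :: "real \<Rightarrow> ennreal" where
  "beta_const a = (\<integral>\<^sup>+x. ennreal (pos_powr x (-a) * pos_powr (1 + x) (-a)) \<partial>lborel)"

text \<open>Near 0 the integrand is of order x^(-a), which needs a < 1; at infinity it is of order
  x^(-2a), which needs a > 1/2.\<close>

lemma beta_const_finite:
  assumes "1 / 2 < a" "a < 1"
  shows "beta_const a < \<infinity>"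
proof -
  have "beta_const a \<le>
    (\<integral>\<^sup>+x. ennreal (x powr (-a)) * indicator {0..1} x + ennreal (x powr (-2 * a)) * indicator {1..} x \<partial>lborel)"
  unfolding beta_const_def
  proof (intro nn_integral_mono)
    fix x :: real
    consider "x \<le> 0" | "0 < x" "x < 1" | "1 \<le> x" by linarith
    then show "ennreal (pos_powr x (-a) * pos_powr (1 + x) (-a)) \<le>
      ennreal (x powr (-a)) * indicator {0..1} x + ennreal (x powr (-2 * a)) * indicator {1..} x"
    proof cases
      case 2
      then have "(1 + x) powr (-a) \<le> 1 powr (-a)" using assms by (intro powr_mono2') auto
      then have "x powr (-a) * (1 + x) powr (-a) \<le> x powr (-a) * 1" by (intro mult_left_mono) auto
      then show ?thesis using 2 by (simp add: pos_powr_def ennreal_leI)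
    next
      case 3
      then have "(1 + x) powr (-a) \<le> x powr (-a)" using assms by (intro powr_mono2') auto
      then have "x powr (-a) * (1 + x) powr (-a) \<le> x powr (-a) * x powr (-a)" by (intro mult_left_mono) auto
      also have "\<dots> = x powr (-2 * a)" by (simp add: powr_add[symmetric])
      finally have "ennreal (pos_powr x (-a) * pos_powr (1 + x) (-a)) \<le> ennreal (x powr (-2 * a)) * indicator {1..} x"
        using 3 by (simp add: pos_powr_def ennreal_leI)
      then show ?thesis by (rule order_trans) simp
    qed (simp add: pos_powr_def)
  qed
  also have "\<dots> = (\<integral>\<^sup>+x. ennreal (x powr (-a)) * indicator {0..1} x \<partial>lborel) +
      (\<integral>\<^sup>+x. ennreal (x powr (-2 * a)) * indicator {1..} x \<partial>lborel)"
    by (rule nn_integral_add) auto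
  also have "(\<integral>\<^sup>+x. ennreal (x powr (-a)) * indicator {0..1} x \<partial>lborel) = ennreal (1 powr (-a + 1) / (-a + 1))"
    using assms by (intro nn_integral_has_integral_lebesgue' has_integral_powr_from_0) auto
  also have "(\<integral>\<^sup>+x. ennreal (x powr (-2 * a)) * indicator {1..} x \<partial>lborel) = ennreal (- (1 powr (-2 * a + 1)) / (-2 * a + 1))"
    using assms by (intro nn_integral_has_integral_lebesgue' has_integral_powr_to_inf) auto
  finally show ?thesis by (rule le_less_trans) simp
qed

text \<open>Measuring the distance of y below the smaller of u and v in units of |u - v| leaves the
  Beta integral. The exponent is 1 from the substitution and -2a from the two powers.\<close>

lemma nn_integral_pos_powr_pair:
  assumes "u \<noteq> v"
  shows "(\<integral>\<^sup>+y. ennreal (pos_powr (u - y) (-a) * pos_powr (v - y) (-a)) \<partial>lborel) =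
    ennreal (\<bar>u - v\<bar> powr (1 - 2 * a)) * beta_const a"
proof -
  have *: "(\<integral>\<^sup>+y. ennreal (pos_powr (u - y) (-a) * pos_powr (v - y) (-a)) \<partial>lborel) =
    ennreal (\<bar>u - v\<bar> powr (1 - 2 * a)) * beta_const a"
    if uv: "u < v" for u v :: real
  proof -
    let ?e = "v - u"
    have e: "?e > 0" using uv by simp
    have "(\<integral>\<^sup>+y. ennreal (pos_powr (u - y) (-a) * pos_powr (v - y) (-a)) \<partial>lborel) =
      ennreal \<bar>- ?e\<bar> * (\<integral>\<^sup>+x. ennreal (pos_powr (u - (u + - ?e * x)) (-a) * pos_powr (v - (u + - ?e * x)) (-a)) \<partial>lborel)"
      using uv by (intro nn_integral_real_affine) auto
    also have "(\<lambda>x. ennreal (pos_powr (u - (u + - ?e * x)) (-a) * pos_powr (v - (u + - ?e * x)) (-a))) =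
      (\<lambda>x. ennreal (?e powr (-2 * a)) * ennreal (pos_powr x (-a) * pos_powr (1 + x) (-a)))"
    proof
      fix x
      have "u - (u + - ?e * x) = ?e * x" "v - (u + - ?e * x) = ?e * (1 + x)" by (simp_all add: algebra_simps)
      moreover have "?e powr (-a) * ?e powr (-a) = ?e powr (-2 * a)" by (simp add: powr_add[symmetric])
      ultimately show "ennreal (pos_powr (u - (u + - ?e * x)) (-a) * pos_powr (v - (u + - ?e * x)) (-a)) =
        ennreal (?e powr (-2 * a)) * ennreal (pos_powr x (-a) * pos_powr (1 + x) (-a))"
        using e by (simp only: pos_powr_mult) (simp add: ennreal_mult[symmetric] pos_powr_nonneg mult_ac)
    qed
    also have "(\<integral>\<^sup>+x. ennreal (?e powr (-2 * a)) * ennreal (pos_powr x (-a) * pos_powr (1 + x) (-a)) \<partial>lborel) =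
      ennreal (?e powr (-2 * a)) * beta_const a"
      unfolding beta_const_def by (rule nn_integral_cmult) auto
    also have "ennreal \<bar>- ?e\<bar> * (ennreal (?e powr (-2 * a)) * beta_const a) =
      ennreal (?e * ?e powr (-2 * a)) * beta_const a"
      using e by (simp add: ennreal_mult mult.assoc)
    also have "?e * ?e powr (-2 * a) = \<bar>u - v\<bar> powr (1 - 2 * a)"
      using e by (simp add: powr_mult_base abs_if)
    finally show ?thesis .
  qed
  show ?thesis
  proof (cases "u < v")
    case False
    then have "v < u" using assms by simp
    from *[OF this] show ?thesis by (simp add: mult.commute abs_minus_commute)
  qed (rule *)
qed

section \<open>Square integrability, rescaling and truncation of the Hermite kernel\<close>

locale hermite_parameters =
  fixes q :: nat and H d :: real
  assumes q1: "q \<ge> 1" and H: "1 / 2 < H" "H < 1" and d: "d > 0"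
begin

definition expo :: real where "expo = 1 / 2 + (1 - H) / real q"

text \<open>The first two facts make the Beta constant finite. The third gives the covariance
  exponent 2H - 2 after a product over q coordinates, and the fourth the self-similarity exponent
  H.\<close>

lemma expo: "1 / 2 < expo" "expo < 1" "real q * (1 - 2 * expo) = 2 * H - 2" "real q * expo = real q / 2 + 1 - H"
proof -
  have "(1 - H) / real q \<le> (1 - H) / 1" using q1 H by (intro divide_left_mono) auto
  then show "expo < 1" using H by (simp add: expo_def)
  show "1 / 2 < expo" using q1 H by (simp add: expo_def)
  show "real q * (1 - 2 * expo) = 2 * H - 2" "real q * expo = real q / 2 + 1 - H"
    using q1 by (simp_all add: expo_def field_simps)
qed

abbreviation kernel :: "real \<Rightarrow> (nat \<Rightarrow> real) \<Rightarrow> real" where "kernel \<equiv> hermite_kernel q H d"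

lemma kernel_eq: "kernel u y = d * (\<Prod>i<q. pos_powr (u - y i) (- expo))"
  by (simp add: hermite_kernel_def expo_def)

lemma kernel_nonneg: "kernel u y \<ge> 0"
  using d by (auto simp: kernel_eq intro!: mult_nonneg_nonneg prod_nonneg pos_powr_nonneg)

lemma nn_integral_kernel_pair:
  assumes "u \<noteq> v"
  shows "(\<integral>\<^sup>+y. ennreal (kernel u y) * ennreal (kernel v y) \<partial>lborel_pi q) =
    ennreal (\<bar>u - v\<bar> powr (2 * H - 2)) * (ennreal (d\<^sup>2) * beta_const expo ^ q)"
proof -
  have "ennreal (kernel u y) * ennreal (kernel v y) =
      ennreal (d\<^sup>2) * (\<Prod>i<q. ennreal (pos_powr (u - y i) (-expo) * pos_powr (v - y i) (-expo)))" for y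
  proof -
    have "kernel u y * kernel v y = d\<^sup>2 * (\<Prod>i<q. pos_powr (u - y i) (-expo) * pos_powr (v - y i) (-expo))"
      by (simp add: kernel_eq prod.distrib power2_eq_square mult_ac)
    then have "ennreal (kernel u y) * ennreal (kernel v y) =
        ennreal (d\<^sup>2 * (\<Prod>i<q. pos_powr (u - y i) (-expo) * pos_powr (v - y i) (-expo)))"
      by (simp only: ennreal_mult[OF kernel_nonneg kernel_nonneg, symmetric])
    also have "\<dots> = ennreal (d\<^sup>2) * (\<Prod>i<q. ennreal (pos_powr (u - y i) (-expo) * pos_powr (v - y i) (-expo)))"
      by (simp add: ennreal_mult prod_nonneg pos_powr_nonneg prod_ennreal flip: ennreal_mult)
    finally show ?thesis .
  qed
  then have "(\<integral>\<^sup>+y. ennreal (kernel u y) * ennreal (kernel v y) \<partial>lborel_pi q) =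
    (\<integral>\<^sup>+y. ennreal (d\<^sup>2) * (\<Prod>i<q. ennreal (pos_powr (u - y i) (-expo) * pos_powr (v - y i) (-expo))) \<partial>lborel_pi q)"
    by simp
  also have "\<dots> = ennreal (d\<^sup>2) * (\<integral>\<^sup>+y. (\<Prod>i<q. ennreal (pos_powr (u - y i) (-expo) * pos_powr (v - y i) (-expo))) \<partial>lborel_pi q)"
    by (intro nn_integral_cmult borel_measurable_prod) auto
  also have "(\<integral>\<^sup>+y. (\<Prod>i<q. ennreal (pos_powr (u - y i) (-expo) * pos_powr (v - y i) (-expo))) \<partial>lborel_pi q) =
      (\<Prod>i<q. \<integral>\<^sup>+x. ennreal (pos_powr (u - x) (-expo) * pos_powr (v - x) (-expo)) \<partial>lborel)"
    by (intro lborel_product.product_nn_integral_prod) auto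
  also have "\<dots> = (ennreal (\<bar>u - v\<bar> powr (1 - 2 * expo)) * beta_const expo) ^ q"
    unfolding nn_integral_pos_powr_pair[OF assms] by simp
  also have "\<dots> = ennreal (\<bar>u - v\<bar> powr (2 * H - 2)) * beta_const expo ^ q"
    unfolding power_mult_distrib using expo(3) assms
    by (simp add: ennreal_power powr_power mult.commute)
  finally show ?thesis by (simp add: mult_ac)
qed

text \<open>The square is a double integral over u and v. Integrating out y first leaves a multiple
  of |u - v|^(2H-2), which is integrable on bounded sets because 2H - 2 > -1.\<close>

lemma nn_integral_kernel_square_finite:
  assumes "A \<le> B"
  shows "(\<integral>\<^sup>+y. (\<integral>\<^sup>+u. indicator {A..B} u * ennreal (kernel u y) \<partial>lborel)\<^sup>2 \<partial>lborel_pi q) < \<infinity>"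
proof -
  interpret pair: pair_sigma_finite "lborel :: real measure" "lborel_pi q"
    by (rule pair_sigma_finite.intro[OF sigma_finite_lborel lborel_product.sigma_finite]) simp
  let ?k = "\<lambda>u y. indicator {A..B} u * ennreal (kernel u y)"
  define K where "K = ennreal (d\<^sup>2) * beta_const expo ^ q"
  have K: "K < \<infinity>"
    using beta_const_finite[OF expo(1,2)] unfolding K_def
    by (auto simp: ennreal_mult_less_top power_less_top_ennreal)
  define W where "W = (\<integral>\<^sup>+w. indicator {-(B - A)..B - A} w * ennreal (\<bar>w\<bar> powr (2 * H - 2)) \<partial>lborel)"
  have W: "W < \<infinity>" unfolding W_def using H assms by (intro nn_integral_powr_symmetric_finite) auto
  have "(\<integral>\<^sup>+y. (\<integral>\<^sup>+u. ?k u y \<partial>lborel)\<^sup>2 \<partial>lborel_pi q) = (\<integral>\<^sup>+y. \<integral>\<^sup>+u. \<integral>\<^sup>+v. ?k u y * ?k v y \<partial>lborel \<partial>lborel \<partial>lborel_pi q)"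
    by (intro nn_integral_cong) (simp add: power2_eq_square nn_integral_cmult nn_integral_multc)
  also have "\<dots> = (\<integral>\<^sup>+u. \<integral>\<^sup>+y. \<integral>\<^sup>+v. ?k u y * ?k v y \<partial>lborel \<partial>lborel_pi q \<partial>lborel)"
    by (rule pair.Fubini') measurable
  also have "\<dots> = (\<integral>\<^sup>+u. \<integral>\<^sup>+v. \<integral>\<^sup>+y. ?k u y * ?k v y \<partial>lborel_pi q \<partial>lborel \<partial>lborel)"
    by (intro nn_integral_cong pair.Fubini') measurable
  also have "\<dots> \<le> (\<integral>\<^sup>+u. indicator {A..B} u * (K * W) \<partial>lborel)"
  proof (intro nn_integral_mono)
    fix u :: real
    show "(\<integral>\<^sup>+v. \<integral>\<^sup>+y. ?k u y * ?k v y \<partial>lborel_pi q \<partial>lborel) \<le> indicator {A..B} u * (K * W)"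
    proof (cases "u \<in> {A..B}")
      case True
      have "(\<integral>\<^sup>+v. \<integral>\<^sup>+y. ?k u y * ?k v y \<partial>lborel_pi q \<partial>lborel) =
          (\<integral>\<^sup>+v. indicator {A..B} v * (\<integral>\<^sup>+y. ennreal (kernel u y) * ennreal (kernel v y) \<partial>lborel_pi q) \<partial>lborel)"
        using True by (intro nn_integral_cong) (simp split: split_indicator)
      also have "\<dots> \<le> (\<integral>\<^sup>+v. K * (indicator {-(B - A)..B - A} (u - v) * ennreal (\<bar>u - v\<bar> powr (2 * H - 2))) \<partial>lborel)"
      proof (rule nn_integral_mono_AE)
        show "AE v in lborel. indicator {A..B} v * (\<integral>\<^sup>+y. ennreal (kernel u y) * ennreal (kernel v y) \<partial>lborel_pi q) \<le>
            K * (indicator {-(B - A)..B - A} (u - v) * ennreal (\<bar>u - v\<bar> powr (2 * H - 2)))"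
          \<comment> \<open>The pair formula fails on u = v, which for fixed u is a single
            point.\<close>
          using AE_lborel_singleton[of u]
        proof eventually_elim
          case (elim v)
          then have "u \<noteq> v" by simp
          from nn_integral_kernel_pair[OF this] show ?case
            using True by (auto simp: K_def mult_ac indicator_def)
        qed
      qed
      also have "\<dots> = K * (\<integral>\<^sup>+v. indicator {-(B - A)..B - A} (u - v) * ennreal (\<bar>u - v\<bar> powr (2 * H - 2)) \<partial>lborel)"
        by (rule nn_integral_cmult) measurable
      also have "(\<integral>\<^sup>+v. indicator {-(B - A)..B - A} (u - v) * ennreal (\<bar>u - v\<bar> powr (2 * H - 2)) \<partial>lborel) = W"
        using nn_integral_real_affine[of "\<lambda>w. indicator {-(B - A)..B - A} w * ennreal (\<bar>w\<bar> powr (2 * H - 2))" "-1" u]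
        unfolding W_def by simp
      finally show ?thesis using True by simp
    qed simp
  qed
  also have "\<dots> = emeasure lborel {A..B} * (K * W)" by (simp add: nn_integral_multc)
  also have "\<dots> < \<infinity>" using K W assms by (simp add: ennreal_mult_less_top)
  finally show ?thesis .
qed

text \<open>The inner integral is square integrable in y, hence finite almost everywhere. Outside a
  null set the integrals over u are therefore genuine and not the default value 0, so linearity
  holds.\<close>

lemma AE_integrable_kernel:
  "AE y in lborel_pi q. integrable lborel (\<lambda>u. indicator {A..B} u * kernel u y)"
proof (cases "A \<le> B")
  case True
  have "AE y in lborel_pi q. (\<integral>\<^sup>+u. indicator {A..B} u * ennreal (kernel u y) \<partial>lborel)\<^sup>2 \<noteq> \<infinity>"
    using nn_integral_kernel_square_finite[OF True] by (intro nn_integral_noteq_infinite) auto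
  then show ?thesis using AE_space
  proof eventually_elim
    case (elim y)
    then have [measurable]: "(\<lambda>u. y) \<in> measurable lborel (lborel_pi q)" by simp
    have "(\<integral>\<^sup>+u. indicator {A..B} u * ennreal (kernel u y) \<partial>lborel) < \<infinity>"
      using elim(1) by (simp add: less_top[symmetric] power2_eq_square ennreal_mult_eq_top_iff)
    also have "(\<integral>\<^sup>+u. indicator {A..B} u * ennreal (kernel u y) \<partial>lborel) = (\<integral>\<^sup>+u. ennreal (indicator {A..B} u * kernel u y) \<partial>lborel)"
      by (intro nn_integral_cong) (simp split: split_indicator)
    finally show ?case
      by (intro integrableI_nonneg) (auto simp: kernel_nonneg)
  qed
qed simp

definition hermite_base :: "(nat \<Rightarrow> real) \<Rightarrow> real" where
  "hermite_base y = (LINT u:{0..1}|lborel. kernel u y)"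

lemma borel_measurable_hermite_integral [measurable]:
  assumes [measurable]: "g \<in> borel_measurable borel"
  shows "(\<lambda>y. \<integral>u. g u * kernel u y \<partial>lborel) \<in> borel_measurable (lborel_pi q)"
  by measurable

lemma hermite_base_alt: "hermite_base y = (\<integral>u. indicator {0..1} u * kernel u y \<partial>lborel)"
  by (simp add: hermite_base_def set_lebesgue_integral_def)

lemma borel_measurable_hermite_base [measurable]: "hermite_base \<in> borel_measurable (lborel_pi q)"
  unfolding hermite_base_alt[abs_def] by measurable

lemma hermite_base_nonneg: "hermite_base y \<ge> 0"
  unfolding hermite_base_alt by (intro integral_nonneg_AE) (auto simp: kernel_nonneg)

lemma sqnorm_hermite_base: "ksqnorm q hermite_base < \<infinity>"
proof -
  have "ksqnorm q hermite_base \<le> (\<integral>\<^sup>+y. (\<integral>\<^sup>+u. indicator {0..1} u * ennreal (kernel u y) \<partial>lborel)\<^sup>2 \<partial>lborel_pi q)"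
    unfolding sqnorm_def
  proof (rule nn_integral_mono_AE)
    show "AE y in lborel_pi q. ennreal ((hermite_base y)\<^sup>2) \<le> (\<integral>\<^sup>+u. indicator {0..1} u * ennreal (kernel u y) \<partial>lborel)\<^sup>2"
      using AE_integrable_kernel[of 0 1]
    proof eventually_elim
      case (elim y)
      have "ennreal (hermite_base y) = (\<integral>\<^sup>+u. ennreal (indicator {0..1} u * kernel u y) \<partial>lborel)"
        unfolding hermite_base_alt using elim by (intro nn_integral_eq_integral[symmetric]) (auto simp: kernel_nonneg)
      also have "\<dots> = (\<integral>\<^sup>+u. indicator {0..1} u * ennreal (kernel u y) \<partial>lborel)"
        by (intro nn_integral_cong) (simp split: split_indicator)
      finally have "(ennreal (hermite_base y))\<^sup>2 = (\<integral>\<^sup>+u. indicator {0..1} u * ennreal (kernel u y) \<partial>lborel)\<^sup>2" by simp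
      then show ?case using hermite_base_nonneg by (simp add: ennreal_power)
    qed
  qed
  also have "\<dots> < \<infinity>" by (rule nn_integral_kernel_square_finite) simp
  finally show ?thesis .
qed

text \<open>This is where self-similarity and stationary increments of the Hermite process come from.\<close>

lemma hermite_integral_affine:
  assumes e: "e > 0"
  shows "(\<integral>u. indicator {s..s + e} u * kernel u y \<partial>lborel) = e powr H * affine_kernel q s e hermite_base y"
proof -
  let ?y = "\<lambda>i\<in>{..<q}. (y i - s) / e"
  have "(\<integral>u. indicator {s..s + e} u * kernel u y \<partial>lborel) =
      \<bar>e\<bar> *\<^sub>R (\<integral>w. indicator {s..s + e} (s + e * w) * kernel (s + e * w) y \<partial>lborel)"
    using e by (intro lborel_integral_real_affine) auto
  also have "(\<lambda>w. indicator {s..s + e} (s + e * w) * kernel (s + e * w) y) =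
      (\<lambda>w. e powr (- (real q * expo)) * (indicator {0..1} w * kernel w ?y))"
  proof
    fix w
    have "pos_powr (s + e * w - y i) (-expo) = e powr (-expo) * pos_powr (w - ?y i) (-expo)" if "i < q" for i
    proof -
      have "s + e * w - y i = e * (w - ?y i)" using e that by (simp add: field_simps)
      then show ?thesis using pos_powr_mult[OF e] by simp
    qed
    then have "(\<Prod>i<q. pos_powr (s + e * w - y i) (-expo)) = (\<Prod>i<q. e powr (-expo) * pos_powr (w - ?y i) (-expo))"
      by (intro prod.cong) auto
    also have "\<dots> = e powr (- (real q * expo)) * (\<Prod>i<q. pos_powr (w - ?y i) (-expo))"
      using e by (simp add: prod.distrib powr_power mult.commute)
    finally have "kernel (s + e * w) y = e powr (- (real q * expo)) * kernel w ?y"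
      by (simp add: kernel_eq)
    moreover have "indicator {s..s + e} (s + e * w) = (indicator {0..1} w :: real)"
      using e by (auto simp: indicator_def zero_le_mult_iff)
    ultimately show "indicator {s..s + e} (s + e * w) * kernel (s + e * w) y =
        e powr (- (real q * expo)) * (indicator {0..1} w * kernel w ?y)" by simp
  qed
  also have "\<bar>e\<bar> *\<^sub>R (\<integral>w. e powr (- (real q * expo)) * (indicator {0..1} w * kernel w ?y) \<partial>lborel) =
      (e * e powr (- (real q * expo))) * hermite_base ?y"
    using e by (simp add: hermite_base_alt)
  \<comment> \<open>One factor e stems from the substitution, the rest from homogeneity of the
    kernel. Of the total exponent 1 - q \<open>expo\<close> = H - q/2, the part -q/2 belongs to the
    unitary rescaling.\<close>
  also have "e * e powr (- (real q * expo)) = e powr H * (1 / sqrt e) ^ q"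
  proof -
    have "(1 / sqrt e) ^ q = (e powr (- (1 / 2))) ^ q"
      using e by (simp add: powr_minus_divide powr_half_sqrt)
    also have "\<dots> = e powr (- (real q / 2))" using e by (simp add: powr_power)
    finally have "e powr H * (1 / sqrt e) ^ q = e powr (H + - (real q / 2))" by (simp only: powr_add)
    also have "H + - (real q / 2) = 1 + - (real q * expo)" using expo(4) by simp
    finally show ?thesis using e by (simp add: powr_mult_base)
  qed
  finally show ?thesis by (simp only: affine_kernel_def mult.assoc)
qed

text \<open>The Hermite kernel is nonnegative, so an integrand bounded by c on an interval of length
  e is dominated by c times the integral over the interval, which is a rescaled copy of
  \<open>hermite_base\<close>.\<close>

lemma hermite_integral_dominated:
  assumes e: "e > 0" and [measurable]: "g \<in> borel_measurable borel"
    and g: "AE u in lborel. \<bar>g u\<bar> \<le> c * indicator {s..s + e} u"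
  shows "AE y in lborel_pi q. integrable lborel (\<lambda>u. g u * kernel u y) \<and>
    \<bar>\<integral>u. g u * kernel u y \<partial>lborel\<bar> \<le> c * (e powr H * affine_kernel q s e hermite_base y)"
  using AE_integrable_kernel[of s "s + e"] AE_space
proof eventually_elim
  case (elim y)
  then have [measurable]: "(\<lambda>u. y) \<in> measurable lborel (lborel_pi q)" by simp
  have i: "integrable lborel (\<lambda>u. c * (indicator {s..s + e} u * kernel u y))" using elim(1) by simp
  have b: "AE u in lborel. norm (g u * kernel u y) \<le> c * (indicator {s..s + e} u * kernel u y)"
    using g
  proof eventually_elim
    case (elim u)
    then have "\<bar>g u\<bar> * kernel u y \<le> c * indicator {s..s + e} u * kernel u y"
      by (rule mult_right_mono[OF _ kernel_nonneg])
    then show ?case by (simp add: abs_mult kernel_nonneg mult_ac)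
  qed
  have int: "integrable lborel (\<lambda>u. g u * kernel u y)"
    by (rule Bochner_Integration.integrable_bound[OF i]) (measurable, use b in \<open>auto elim!: eventually_mono\<close>)
  have "\<bar>\<integral>u. g u * kernel u y \<partial>lborel\<bar> \<le> (\<integral>u. norm (g u * kernel u y) \<partial>lborel)"
    using integral_norm_bound[of lborel "\<lambda>u. g u * kernel u y"] by simp
  also have "\<dots> \<le> (\<integral>u. c * (indicator {s..s + e} u * kernel u y) \<partial>lborel)"
    using b int i by (intro integral_mono_AE) auto
  also have "\<dots> = c * (e powr H * affine_kernel q s e hermite_base y)"
    by (simp add: hermite_integral_affine[OF e])
  finally show ?case using int by simp
qed

text \<open>The factor e^(-H) removes the size of the interval and the rescaling is unitary, so the
  bound is uniform in s and e.\<close>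

lemma sqnorm_hermite_integral_le:
  assumes e: "e > 0" and g: "g \<in> borel_measurable borel" "AE u in lborel. \<bar>g u\<bar> \<le> c * indicator {s..s + e} u"
    and D: "ksqnorm q hermite_base \<le> ennreal D" "D \<ge> 0"
  shows "ksqnorm q (\<lambda>y. e powr (-H) * (\<integral>u. g u * kernel u y \<partial>lborel)) \<le> ennreal (c\<^sup>2 * D)"
proof -
  have "AE y in lborel_pi q. \<bar>e powr (-H) * (\<integral>u. g u * kernel u y \<partial>lborel)\<bar> \<le> \<bar>c * affine_kernel q s e hermite_base y\<bar>"
    using hermite_integral_dominated[OF e g]
  proof eventually_elim
    case (elim y)
    then have "e powr (-H) * \<bar>\<integral>u. g u * kernel u y \<partial>lborel\<bar> \<le>
        e powr (-H) * (c * (e powr H * affine_kernel q s e hermite_base y))"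
      by (intro mult_left_mono) auto
    also have "\<dots> = c * affine_kernel q s e hermite_base y" using e by (simp add: powr_minus field_simps)
    finally have "\<bar>e powr (-H) * (\<integral>u. g u * kernel u y \<partial>lborel)\<bar> \<le> c * affine_kernel q s e hermite_base y"
      by (simp add: abs_mult)
    then show ?case by (rule order_trans) simp
  qed
  then have "ksqnorm q (\<lambda>y. e powr (-H) * (\<integral>u. g u * kernel u y \<partial>lborel)) \<le>
      ksqnorm q (\<lambda>y. c * affine_kernel q s e hermite_base y)"
    by (rule sqnorm_mono_AE)
  also have "\<dots> = ennreal (c\<^sup>2) * ksqnorm q hermite_base"
    using e by (simp add: sqnorm_cmult sqnorm_affine_kernel)
  also have "\<dots> \<le> ennreal (c\<^sup>2) * ennreal D" using D by (intro mult_left_mono) auto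
  finally show ?thesis using D by (simp add: ennreal_mult)
qed

text \<open>The kernel vanishes when a coordinate exceeds 1, so only the distant past is cut off;
  the window of length K is measured in units of the increment.\<close>

definition truncated_base :: "real \<Rightarrow> (nat \<Rightarrow> real) \<Rightarrow> real" where
  "truncated_base K y = (if \<forall>i<q. 1 - K < y i \<and> y i \<le> 1 then hermite_base y else 0)"

lemma hermite_base_eq_0:
  assumes "i < q" "1 < y i"
  shows "hermite_base y = 0"
proof -
  have zero: "indicator {0..1} u * kernel u y = 0" for u
  proof (cases "u \<in> {0..1}")
    case True
    then have "pos_powr (u - y i) (-expo) = 0" using assms(2) by (simp add: pos_powr_def)
    then have "(\<Prod>i<q. pos_powr (u - y i) (-expo)) = 0" using assms(1) by (intro prod_zero bexI[of _ i]) simp_all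
    then show ?thesis by (simp add: kernel_eq)
  qed simp
  show ?thesis unfolding hermite_base_alt by (simp only: zero Bochner_Integration.integral_zero)
qed

lemma borel_measurable_truncated_base [measurable]: "truncated_base K \<in> borel_measurable (lborel_pi q)"
proof -
  have "truncated_base K = (\<lambda>y. (\<Prod>i<q. indicator {1 - K<..1} (y i)) * hermite_base y)"
    unfolding prod_indicator_eq by (auto simp: fun_eq_iff truncated_base_def)
  also have "\<dots> \<in> borel_measurable (lborel_pi q)"
    by (intro borel_measurable_times borel_measurable_prod borel_measurable_hermite_base) auto
  finally show ?thesis .
qed

lemma abs_truncated_base_le: "\<bar>truncated_base K y\<bar> \<le> hermite_base y"
  using hermite_base_nonneg[of y] by (simp add: truncated_base_def)

lemma truncated_base_tendsto:
  assumes K: "filterlim K at_top sequentially"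
  shows "(\<lambda>n. ksqnorm q (\<lambda>y. hermite_base y - truncated_base (K n) y)) \<longlonglongrightarrow> 0"
proof (rule sqnorm_dominated_tendsto[OF _ _ _ sqnorm_hermite_base])
  show "AE y in lborel_pi q. \<bar>hermite_base y\<bar> \<le> hermite_base y" using hermite_base_nonneg by simp
  show "AE y in lborel_pi q. \<bar>truncated_base (K n) y\<bar> \<le> hermite_base y" for n using abs_truncated_base_le by simp
  show "AE y in lborel_pi q. (\<lambda>n. truncated_base (K n) y) \<longlonglongrightarrow> hermite_base y"
  proof (rule AE_I2)
    fix y
    show "(\<lambda>n. truncated_base (K n) y) \<longlonglongrightarrow> hermite_base y"
    proof (cases "\<forall>i<q. y i \<le> 1")
      case True
      have "\<forall>\<^sub>F n in sequentially. \<forall>i\<in>{..<q}. 1 - y i < K n"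
        using K by (intro eventually_ball_finite) (auto simp: filterlim_at_top_dense)
      then have "\<forall>\<^sub>F n in sequentially. truncated_base (K n) y = hermite_base y"
      proof eventually_elim
        case (elim n)
        have "1 - K n < y i" if "i < q" for i
        proof -
          have "1 - y i < K n" using elim that by blast
          then show ?thesis by linarith
        qed
        then show ?case using True by (simp add: truncated_base_def)
      qed
      then show ?thesis by (rule tendsto_eventually)
    next
      case False
      then obtain i where "i < q" "1 < y i" by (auto simp: not_le)
      from hermite_base_eq_0[of i y, OF this] have "hermite_base y = 0" "truncated_base K y = 0" for K
        by (auto simp: truncated_base_def)
      then show ?thesis by simp
    qed
  qed
qed measurable

end

subsection \<open>Averages\<close>

text \<open>Off-diagonal covariances vanish, so the variance of the sum is of order
  \<open>card A\<close> and not its square; the L^1 norm is at most the L^2 norm.\<close>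

lemma (in prob_space) uncorrelated_sum_abs_le:
  fixes W :: "'i \<Rightarrow> 'a \<Rightarrow> real"
  assumes fin: "finite A" and [measurable]: "\<And>l. l \<in> A \<Longrightarrow> W l \<in> borel_measurable M"
    and W: "\<And>l. l \<in> A \<Longrightarrow> sqnorm M (W l) \<le> ennreal K" and K: "K \<ge> 0"
    and uncorrelated: "\<And>l k. l \<in> A \<Longrightarrow> k \<in> A \<Longrightarrow> l \<noteq> k \<Longrightarrow>
      (\<integral>\<omega>. W l \<omega> * W k \<omega> \<partial>M) = (\<integral>\<omega>. W l \<omega> \<partial>M) * (\<integral>\<omega>. W k \<omega> \<partial>M)"
    and c: "\<And>l. l \<in> A \<Longrightarrow> \<bar>c l\<bar> \<le> b"
  shows "(\<integral>\<omega>. \<bar>\<Sum>l\<in>A. c l * (W l \<omega> - (\<integral>\<omega>'. W l \<omega>' \<partial>M))\<bar> \<partial>M) \<le> sqrt (real (card A) * (b\<^sup>2 * K))"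
proof -
  define V where "V l \<omega> = W l \<omega> - (\<integral>\<omega>'. W l \<omega>' \<partial>M)" for l \<omega>
  define S where "S \<omega> = (\<Sum>l\<in>A. c l * V l \<omega>)" for \<omega>
  have [measurable]: "V l \<in> borel_measurable M" if "l \<in> A" for l
    using that unfolding V_def[abs_def] by measurable
  have [measurable]: "S \<in> borel_measurable M" unfolding S_def[abs_def] by (intro borel_measurable_sum borel_measurable_times) auto
  have intW: "integrable M (W l)" if "l \<in> A" for l
    using sqnorm_bound_integrable(2)[OF _ W[OF that] K] that by simp
  have intWW: "integrable M (\<lambda>\<omega>. W l \<omega> * W k \<omega>)" if "l \<in> A" "k \<in> A" for l k
    using sqnorm_bound_mult(1)[OF _ _ W[OF that(1)] W[OF that(2)] K K] that by simp
  have VV: "V l \<omega> * V k \<omega> = W l \<omega> * W k \<omega> - (\<integral>\<omega>'. W k \<omega>' \<partial>M) * W l \<omega> - (\<integral>\<omega>'. W l \<omega>' \<partial>M) * W k \<omega>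
      + (\<integral>\<omega>'. W l \<omega>' \<partial>M) * (\<integral>\<omega>'. W k \<omega>' \<partial>M)" for l k \<omega>
    by (simp add: V_def algebra_simps)
  have intVV: "integrable M (\<lambda>\<omega>. V l \<omega> * V k \<omega>)" if "l \<in> A" "k \<in> A" for l k
    unfolding VV using intW intWW that by simp
  have EVV: "(\<integral>\<omega>. V l \<omega> * V k \<omega> \<partial>M) = (\<integral>\<omega>. W l \<omega> * W k \<omega> \<partial>M) - (\<integral>\<omega>. W l \<omega> \<partial>M) * (\<integral>\<omega>. W k \<omega> \<partial>M)"
    if "l \<in> A" "k \<in> A" for l k
    unfolding VV using intW intWW that by (simp add: prob_space)
  have SS: "(S \<omega>)\<^sup>2 = (\<Sum>l\<in>A. \<Sum>k\<in>A. (c l * c k) * (V l \<omega> * V k \<omega>))" for \<omega>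
    by (simp add: S_def power2_eq_square sum_product mult_ac)
  have intS: "integrable M (\<lambda>\<omega>. (S \<omega>)\<^sup>2)"
    unfolding SS using intVV by simp
  have "(\<integral>\<omega>. (S \<omega>)\<^sup>2 \<partial>M) = (\<Sum>l\<in>A. \<Sum>k\<in>A. (c l * c k) * (\<integral>\<omega>. V l \<omega> * V k \<omega> \<partial>M))"
    unfolding SS using intVV by simp
  also have "\<dots> = (\<Sum>l\<in>A. \<Sum>k\<in>A. if k = l then (c l)\<^sup>2 * (\<integral>\<omega>. V l \<omega> * V l \<omega> \<partial>M) else 0)"
  proof (intro sum.cong refl)
    fix l k assume lk: "l \<in> A" "k \<in> A"
    show "(c l * c k) * (\<integral>\<omega>. V l \<omega> * V k \<omega> \<partial>M) = (if k = l then (c l)\<^sup>2 * (\<integral>\<omega>. V l \<omega> * V l \<omega> \<partial>M) else 0)"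
    proof (cases "k = l")
      case False
      then have "(\<integral>\<omega>. V l \<omega> * V k \<omega> \<partial>M) = 0"
        using EVV[OF lk] uncorrelated[OF lk] by simp
      then show ?thesis using False by simp
    qed (simp add: power2_eq_square)
  qed
  also have "\<dots> = (\<Sum>l\<in>A. (c l)\<^sup>2 * (\<integral>\<omega>. V l \<omega> * V l \<omega> \<partial>M))" using fin by simp
  also have "\<dots> \<le> (\<Sum>l\<in>A. b\<^sup>2 * K)"
  proof (intro sum_mono mult_mono)
    fix l assume l: "l \<in> A"
    show "(c l)\<^sup>2 \<le> b\<^sup>2" using c[OF l] by (simp add: abs_le_square_iff[symmetric])
    have "(\<integral>\<omega>. V l \<omega> * V l \<omega> \<partial>M) \<le> (\<integral>\<omega>. (W l \<omega>)\<^sup>2 \<partial>M)"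
      unfolding EVV[OF l l] by (simp add: power2_eq_square)
    also have "\<dots> \<le> K" using sqnorm_bound_integrable(3)[OF _ W[OF l] K] l by simp
    finally show "(\<integral>\<omega>. V l \<omega> * V l \<omega> \<partial>M) \<le> K" .
  qed auto
  finally have "(\<integral>\<omega>. (S \<omega>)\<^sup>2 \<partial>M) \<le> real (card A) * (b\<^sup>2 * K)" by simp
  moreover have "sqnorm M S = ennreal (\<integral>\<omega>. (S \<omega>)\<^sup>2 \<partial>M)"
    unfolding sqnorm_def using intS by (intro nn_integral_eq_integral) auto
  ultimately have "sqnorm M S \<le> ennreal (real (card A) * (b\<^sup>2 * K))" by (simp add: ennreal_leI)
  then have "(\<integral>\<omega>. \<bar>S \<omega>\<bar> \<partial>M) \<le> sqrt (real (card A) * (b\<^sup>2 * K))"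
    using K by (intro sqnorm_bound_integrable(4)) auto
  then show ?thesis by (simp add: S_def V_def)
qed

text \<open>Uniform continuity bounds the error on each cell by \<epsilon>/2 times its length. The
  induction on k accumulates these errors over the first k cells, with f evaluated at right end
  points.\<close>

lemma riemann_sum_tendsto:
  fixes f :: "real \<Rightarrow> real"
  assumes f: "continuous_on {0..1} f"
  shows "(\<lambda>n. (\<Sum>l=1..n. f (real l / real n)) / real n) \<longlonglongrightarrow> (LINT s:{0..1}|lborel. f s)"
proof (rule LIMSEQ_I)
  fix \<epsilon> :: real assume \<epsilon>: "\<epsilon> > 0"
  have "uniformly_continuous_on {0..1} f" by (rule compact_uniformly_continuous[OF f]) simp
  then obtain \<delta> where \<delta>: "\<delta> > 0" "\<And>x y. x \<in> {0..1} \<Longrightarrow> y \<in> {0..1} \<Longrightarrow> dist y x < \<delta> \<Longrightarrow> dist (f y) (f x) < \<epsilon> / 2"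
    using \<epsilon> unfolding uniformly_continuous_on_def by (metis half_gt_zero)
  obtain n0 :: nat where n0: "1 / \<delta> < real n0" using reals_Archimedean2 by blast
  have eq: "(LINT s:{0..1}|lborel. f s) = integral {0..1} f"
    by (rule set_borel_integral_eq_integral(2)[OF borel_integrable_atLeastAtMost'[OF f]])
  have "norm ((\<Sum>l=1..n. f (real l / real n)) / real n - (LINT s:{0..1}|lborel. f s)) < \<epsilon>" if n: "n \<ge> Suc n0" for n
  proof -
    have n_pos: "real n > 0" using n by simp
    have "1 / \<delta> < real n" using n n0 by linarith
    then have mesh: "1 / real n < \<delta>" using \<delta>(1) n_pos by (simp add: field_simps)
    have "\<bar>integral {0..real k / real n} f - (\<Sum>l=1..k. f (real l / real n)) / real n\<bar> \<le> real k / real n * (\<epsilon> / 2)"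
      if "k \<le> n" for k
      using that
    proof (induction k)
      case (Suc k)
      let ?a = "real k / real n" and ?b = "real (Suc k) / real n"
      have ab: "0 \<le> ?a" "?a \<le> ?b" "?b \<le> 1" "?b - ?a = 1 / real n"
        using Suc.prems n_pos by (auto simp: field_simps)
      have c1: "continuous_on {?a..?b} f" and c0: "continuous_on {0..?b} f"
        using order_trans[OF ab(1)] order_trans[OF _ ab(3)]
        by (auto intro!: continuous_on_subset[OF f] simp only: atLeastAtMost_iff subset_iff)
      have split: "integral {0..?b} f = integral {0..?a} f + integral {?a..?b} f"
        using ab by (intro Henstock_Kurzweil_Integration.integral_combine[symmetric] integrable_continuous_real c0) auto
      have "integral {?a..?b} (\<lambda>x. f x - f ?b) = integral {?a..?b} f - f ?b / real n"
        using ab c1 by (subst Henstock_Kurzweil_Integration.integral_diff) (auto intro: integrable_continuous_real)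
      moreover have "norm (integral {?a..?b} (\<lambda>x. f x - f ?b)) \<le> \<epsilon> / 2 * (?b - ?a)"
      proof (rule integral_bound[OF ab(2)])
        show "continuous_on {?a..?b} (\<lambda>x. f x - f ?b)" using c1 by (intro continuous_intros)
        fix x assume x: "x \<in> {?a..?b}"
        have "dist x ?b \<le> 1 / real n" using x ab(4) by (auto simp: dist_real_def)
        then have "dist x ?b < \<delta>" using mesh by simp
        moreover have "0 \<le> x" "x \<le> ?b" using order_trans[OF ab(1)] x by auto
        ultimately have "dist (f x) (f ?b) < \<epsilon> / 2" using ab order_trans[OF _ ab(3)] by (intro \<delta>(2)) auto
        then show "norm (f x - f ?b) \<le> \<epsilon> / 2" by (simp add: dist_real_def)
      qed
      ultimately have step: "\<bar>integral {?a..?b} f - f ?b / real n\<bar> \<le> \<epsilon> / 2 * (1 / real n)"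
        unfolding ab(4) by simp
      have sum: "(\<Sum>l=1..Suc k. f (real l / real n)) / real n = (\<Sum>l=1..k. f (real l / real n)) / real n + f ?b / real n"
        by (simp add: add_divide_distrib)
      have IH: "\<bar>integral {0..?a} f - (\<Sum>l=1..k. f (real l / real n)) / real n\<bar> \<le> ?a * (\<epsilon> / 2)"
        using Suc by simp
      have "?b * (\<epsilon> / 2) = ?a * (\<epsilon> / 2) + \<epsilon> / 2 * (1 / real n)" by (simp add: add_divide_distrib algebra_simps)
      then show ?case unfolding split sum using IH step by linarith
    qed simp
    from this[of n] have "\<bar>integral {0..1} f - (\<Sum>l=1..n. f (real l / real n)) / real n\<bar> \<le> \<epsilon> / 2"
      using n_pos by simp
    then show ?thesis using \<epsilon> by (simp add: eq abs_minus_commute)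
  qed
  then show "\<exists>no. \<forall>n\<ge>no. norm ((\<Sum>l=1..n. f (real l / real n)) / real n - (LINT s:{0..1}|lborel. f s)) < \<epsilon>"
    by blast
qed

lemma holder_continuous_on_imp_continuous_on:
  assumes "holder_continuous_on \<alpha> S h" "\<alpha> > 0"
  shows "continuous_on S h"
proof -
  obtain C where C: "\<And>s t. s \<in> S \<Longrightarrow> t \<in> S \<Longrightarrow> \<bar>h s - h t\<bar> \<le> C * \<bar>s - t\<bar> powr \<alpha>"
    using assms(1) unfolding holder_continuous_on_def by blast
  have "(h \<longlongrightarrow> h t) (at t within S)" if t: "t \<in> S" for t
  proof -
    have "((\<lambda>s. C * \<bar>s - t\<bar> powr \<alpha>) \<longlongrightarrow> C * \<bar>t - t\<bar> powr \<alpha>) (at t within S)"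
      using assms(2) by (intro tendsto_intros tendsto_powr') auto
    then have "((\<lambda>s. C * \<bar>s - t\<bar> powr \<alpha>) \<longlongrightarrow> 0) (at t within S)" by simp
    moreover have "\<forall>\<^sub>F s in at t within S. norm (h s - h t) \<le> C * \<bar>s - t\<bar> powr \<alpha>"
      using C t by (auto simp: eventually_at_filter)
    ultimately have "((\<lambda>s. h s - h t) \<longlongrightarrow> 0) (at t within S)" by (rule Lim_null_comparison[rotated])
    then show ?thesis by (simp add: LIM_zero_iff)
  qed
  then show ?thesis by (simp add: continuous_on_def)
qed

lemma mesh_exponent_le: "mesh_exponent \<gamma> N \<le> real N powr \<gamma>"
  unfolding mesh_exponent_def by (simp add: of_nat_nat)

lemma mesh_exponent_gt: "real N powr \<gamma> - 1 < mesh_exponent \<gamma> N"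
  unfolding mesh_exponent_def by (simp add: of_nat_nat)

lemma filterlim_mesh_exponent:
  assumes "0 < \<gamma>"
  shows "filterlim (mesh_exponent \<gamma>) at_top sequentially"
proof -
  have "filterlim (\<lambda>N. real N powr \<gamma> - 1) at_top sequentially" using assms by real_asymp
  then have "filterlim (\<lambda>N. real (mesh_exponent \<gamma> N)) at_top sequentially"
    by (rule filterlim_at_top_mono) (auto intro!: always_eventually less_imp_le mesh_exponent_gt)
  then show ?thesis by (simp add: filterlim_sequentially_iff_filterlim_real)
qed

text \<open>The binary logarithm of the ratio is at least N - N^\<gamma>, which tends to infinity
  because \<gamma> < 1.\<close>

lemma filterlim_scale_ratio:
  assumes "0 < \<gamma>" "\<gamma> < 1"
  shows "filterlim (\<lambda>N. 2 ^ N / 2 ^ mesh_exponent \<gamma> N :: real) at_top sequentially"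
proof -
  have "filterlim (\<lambda>N. 2 powr (real N - real N powr \<gamma>)) at_top sequentially"
    using assms by real_asymp
  then show ?thesis
  proof (rule filterlim_at_top_mono, intro always_eventually allI)
    fix N
    have "2 powr (real N - real N powr \<gamma>) \<le> 2 powr (real N - real (mesh_exponent \<gamma> N))"
      using mesh_exponent_le[of \<gamma> N] by (intro powr_mono) auto
    also have "\<dots> = 2 ^ N / 2 ^ mesh_exponent \<gamma> N" by (simp add: powr_diff powr_realpow)
    finally show "2 powr (real N - real N powr \<gamma>) \<le> 2 ^ N / 2 ^ mesh_exponent \<gamma> N" .
  qed
qed

subsection \<open>Increments of the integral process\<close>

text \<open>Square integrability guarantees that a version exists, so the arbitrary choice in
  \<open>wiener_ito_integral\<close> selects one.\<close>

lemma (in wiener_chaos) has_wi_version: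
  assumes "f \<in> borel_measurable (lborel_pi q)" "ksqnorm q f < \<infinity>"
  shows "has_wi f (wiener_ito_integral M B q f)"
  unfolding wiener_ito_integral_def by (rule someI_ex[OF has_wi_square_integrable[OF assms]])

locale hermite_integral = wiener_chaos M B q + hermite_parameters q H d
  for M :: "'a measure" and B q H d +
  fixes h :: "real \<Rightarrow> real" and X :: "real \<Rightarrow> 'a \<Rightarrow> real" and x0 C c \<alpha> :: real
  assumes h_cont: "continuous_on {0..1} h"
    and h_bound: "\<And>s. s \<in> {0..1} \<Longrightarrow> \<bar>h s\<bar> \<le> c"
    and h_holder: "\<And>s t. s \<in> {0..1} \<Longrightarrow> t \<in> {0..1} \<Longrightarrow> \<bar>h s - h t\<bar> \<le> C * \<bar>s - t\<bar> powr \<alpha>"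
    and c: "c \<ge> 0" and C: "C \<ge> 0" and \<alpha>: "\<alpha> > 0"
    and X_measurable: "\<And>t. t \<ge> 0 \<Longrightarrow> X t \<in> borel_measurable M"
    and X_eq: "\<And>t. t \<ge> 0 \<Longrightarrow> AE \<omega> in M. X t \<omega> = x0 +
      wiener_hermite_integral M B q H d (\<lambda>s. indicator {0..1} s * h s * indicator {0<..<t} s) \<omega>"
begin

definition h0 :: "real \<Rightarrow> real" where "h0 u = indicator {0..1} u * h u"

lemma borel_measurable_h0 [measurable]: "h0 \<in> borel_measurable borel"
  using borel_measurable_continuous_on_indicator[OF _ h_cont] by (simp add: h0_def[abs_def])

lemma h0_cases: "\<bar>h0 u\<bar> \<le> c" "u < 0 \<Longrightarrow> h0 u = 0" "1 < u \<Longrightarrow> h0 u = 0"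
  using h_bound[of u] c by (auto simp: h0_def indicator_def)

abbreviation local_kernel :: "real \<Rightarrow> real \<Rightarrow> (nat \<Rightarrow> real) \<Rightarrow> real" where
  "local_kernel t e \<equiv> affine_kernel q t e hermite_base"

text \<open>The interval is half-open on the right because subtracting the indicators of (0, t) and
  (0, t + e) leaves exactly [t, t + e) for t > 0.\<close>

definition incr_kernel :: "real \<Rightarrow> real \<Rightarrow> (nat \<Rightarrow> real) \<Rightarrow> real" where
  "incr_kernel t e y = (\<integral>u. (h0 u * indicator {t..<t + e} u) * kernel u y \<partial>lborel)"

lemma borel_measurable_incr_kernel [measurable]: "incr_kernel t e \<in> borel_measurable (lborel_pi q)"
  unfolding incr_kernel_def[abs_def] by measurable

lemma has_wi_increment:
  assumes t: "t > 0" and e: "e > 0"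
  shows "has_wi (incr_kernel t e) (\<lambda>\<omega>. X (t + e) \<omega> - X t \<omega>)"
proof -
  define g where "g t u = h0 u * indicator {0<..<t} u" for t u :: real
  define k where "k t y = (\<integral>u. g t u * kernel u y \<partial>lborel)" for t y
  have [measurable]: "g t \<in> borel_measurable borel" for t unfolding g_def[abs_def] by measurable
  have [measurable]: "k t \<in> borel_measurable (lborel_pi q)" for t unfolding k_def[abs_def] by measurable
  have "AE u in lborel. \<bar>g t u\<bar> \<le> c * indicator {0..0 + 1} u" for t
    using h0_cases c by (intro AE_I2) (auto simp: g_def indicator_def)
  from hermite_integral_dominated[OF zero_less_one _ this]
  have dom: "AE y in lborel_pi q. integrable lborel (\<lambda>u. g t u * kernel u y) \<and>
    \<bar>k t y\<bar> \<le> c * (1 powr H * local_kernel 0 1 y)" for t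
    unfolding k_def by measurable
  have fin: "ksqnorm q (k t) < \<infinity>" for t
  proof -
    have "ksqnorm q (k t) \<le> ksqnorm q (\<lambda>y. c * local_kernel 0 1 y)"
      using dom[of t]
    proof (intro sqnorm_mono_AE, eventually_elim)
      case (elim y)
      then have "\<bar>k t y\<bar> \<le> c * local_kernel 0 1 y" by simp
      then show ?case by (rule order_trans) simp
    qed
    also have "\<dots> = ennreal (c\<^sup>2) * ksqnorm q hermite_base"
      by (simp add: sqnorm_cmult sqnorm_affine_kernel)
    also have "\<dots> < \<infinity>" using sqnorm_hermite_base by (simp add: ennreal_mult_less_top)
    finally show ?thesis .
  qed
  have version: "wiener_hermite_integral M B q H d (\<lambda>s. indicator {0..1} s * h s * indicator {0<..<t} s) =
    wiener_ito_integral M B q (k t)" for t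
  proof -
    have "(\<lambda>y. LINT u:{0..}|lborel. (indicator {0..1} u * h u * indicator {0<..<t} u) * kernel u y) = k t"
      unfolding k_def set_lebesgue_integral_def g_def h0_def
      by (intro ext Bochner_Integration.integral_cong) (auto simp: indicator_def)
    then show ?thesis by (simp add: wiener_hermite_integral_def)
  qed
  define I where "I t = wiener_ito_integral M B q (k t)" for t
  have I: "has_wi (k t) (I t)" for t unfolding I_def by (rule has_wi_version[OF _ fin]) measurable
  have "has_wi (\<lambda>y. k (t + e) y - k t y) (\<lambda>\<omega>. I (t + e) \<omega> - I t \<omega>)"
    by (rule has_wi_diff[OF I I])
  then show ?thesis
  proof (rule has_wi_cong_AE)
    show "(\<lambda>\<omega>. X (t + e) \<omega> - X t \<omega>) \<in> borel_measurable M"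
      using X_measurable[of t] X_measurable[of "t + e"] t e by simp
    show "AE \<omega> in M. I (t + e) \<omega> - I t \<omega> = X (t + e) \<omega> - X t \<omega>"
    proof -
      have "AE \<omega> in M. X t \<omega> = x0 + I t \<omega>" "AE \<omega> in M. X (t + e) \<omega> = x0 + I (t + e) \<omega>"
        using X_eq[of t] X_eq[of "t + e"] t e unfolding version I_def by auto
      then show ?thesis by eventually_elim simp
    qed
    \<comment> \<open>Kernels are subtracted under the integral over u, which is legitimate only at
      those y where both integrals converge.\<close>
    show "AE y in lborel_pi q. k (t + e) y - k t y = incr_kernel t e y"
      using dom[of t] dom[of "t + e"]
    proof eventually_elim
      case (elim y)
      then have "k (t + e) y - k t y = (\<integral>u. g (t + e) u * kernel u y - g t u * kernel u y \<partial>lborel)"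
        unfolding k_def by (subst Bochner_Integration.integral_diff) auto
      also have "\<dots> = incr_kernel t e y"
        unfolding incr_kernel_def g_def using t e
        by (intro Bochner_Integration.integral_cong) (auto simp: indicator_def)
      finally show ?case .
    qed
  qed measurable
qed

lemma sqnorm_local_kernel: "e > 0 \<Longrightarrow> ksqnorm q (local_kernel t e) = ksqnorm q hermite_base"
  by (rule sqnorm_affine_kernel) measurable

lemma sqnorm_incr_kernel_le:
  assumes t: "0 \<le> t" and e: "e > 0" and D: "ksqnorm q hermite_base \<le> ennreal D" "D \<ge> 0"
  shows "ksqnorm q (\<lambda>y. e powr (-H) * incr_kernel t e y) \<le> ennreal (c\<^sup>2 * D)"
proof -
  have "AE u in lborel. \<bar>h0 u * indicator {t..<t + e} u\<bar> \<le> c * indicator {t..t + e} u"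
    using h0_cases c by (intro AE_I2) (auto simp: indicator_def)
  then show ?thesis unfolding incr_kernel_def by (intro sqnorm_hermite_integral_le[OF e _ _ D]) auto
qed

text \<open>Two errors are added: replacing h by its value at t changes the integrand by at most C
  e^\<alpha>, and truncating the kernel costs \<tau>, multiplied by h(t)^2 \<le> c^2.\<close>

lemma sqnorm_incr_kernel_diff_le:
  assumes t: "0 \<le> t" and e: "e > 0" "t + e \<le> 1" and D: "ksqnorm q hermite_base \<le> ennreal D" "D \<ge> 0"
    and \<tau>: "ksqnorm q (\<lambda>y. hermite_base y - truncated_base K y) \<le> ennreal \<tau>" "\<tau> \<ge> 0"
  shows "ksqnorm q (\<lambda>y. e powr (-H) * incr_kernel t e y - h t * affine_kernel q t e (truncated_base K) y)
    \<le> ennreal (2 * ((C * e powr \<alpha>)\<^sup>2 * D) + 2 * c\<^sup>2 * \<tau>)"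
proof -
  define g where "g u = h0 u * indicator {t..<t + e} u" for u
  define g' where "g' u = h t * indicator {t..t + e} u" for u
  have [measurable]: "g \<in> borel_measurable borel" "g' \<in> borel_measurable borel"
    unfolding g_def[abs_def] g'_def[abs_def] by measurable
  have t1: "t \<in> {0..1}" using t e by simp
  \<comment> \<open>The half-open increment interval and the closed interval of the rescaled kernel
    differ only at t + e.\<close>
  have "AE u in lborel. \<bar>g u - g' u\<bar> \<le> (C * e powr \<alpha>) * indicator {t..t + e} u"
    using AE_lborel_singleton[of "t + e"]
  proof eventually_elim
    case (elim u)
    show ?case
    proof (cases "u \<in> {t..<t + e}")
      case True
      then have "\<bar>h u - h t\<bar> \<le> C * \<bar>u - t\<bar> powr \<alpha>" using t e by (intro h_holder) auto
      also have "\<dots> \<le> C * e powr \<alpha>" using True C \<alpha> by (intro mult_left_mono powr_mono2) auto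
      finally show ?thesis using True t e by (simp add: g_def g'_def h0_def)
    qed (use elim in \<open>auto simp: g_def g'_def indicator_def\<close>)
  qed
  from sqnorm_hermite_integral_le[OF e(1) _ this D]
  have "ksqnorm q (\<lambda>y. e powr (-H) * (\<integral>u. (g u - g' u) * kernel u y \<partial>lborel)) \<le> ennreal ((C * e powr \<alpha>)\<^sup>2 * D)"
    by simp
  moreover have "AE u in lborel. \<bar>g u\<bar> \<le> c * indicator {t..t + e} u"
    using h0_cases c by (intro AE_I2) (auto simp: g_def indicator_def)
  from hermite_integral_dominated[OF e(1) _ this]
  have int: "AE y in lborel_pi q. integrable lborel (\<lambda>u. g u * kernel u y)" by (auto elim!: eventually_mono)
  have "AE y in lborel_pi q. e powr (-H) * (\<integral>u. (g u - g' u) * kernel u y \<partial>lborel) =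
      e powr (-H) * incr_kernel t e y - h t * local_kernel t e y"
    using int AE_integrable_kernel[of t "t + e"]
  proof eventually_elim
    case (elim y)
    have "(\<integral>u. (g u - g' u) * kernel u y \<partial>lborel) = (\<integral>u. g u * kernel u y - h t * (indicator {t..t + e} u * kernel u y) \<partial>lborel)"
      by (simp add: g'_def left_diff_distrib mult.assoc)
    also have "\<dots> = incr_kernel t e y - h t * (e powr H * local_kernel t e y)"
      using elim by (subst Bochner_Integration.integral_diff)
        (auto simp: incr_kernel_def g_def hermite_integral_affine[OF e(1)])
    finally show ?case using e by (simp add: powr_minus field_simps)
  qed
  ultimately have 1: "ksqnorm q (\<lambda>y. e powr (-H) * incr_kernel t e y - h t * local_kernel t e y) \<le>
      ennreal ((C * e powr \<alpha>)\<^sup>2 * D)" by (subst (asm) sqnorm_cong_AE) auto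
  have diff: "(\<lambda>y. local_kernel t e y - affine_kernel q t e (truncated_base K) y) =
      affine_kernel q t e (\<lambda>y. hermite_base y - truncated_base K y)"
    by (simp add: affine_kernel_def fun_eq_iff right_diff_distrib)
  have 2: "ksqnorm q (\<lambda>y. local_kernel t e y - affine_kernel q t e (truncated_base K) y) \<le> ennreal \<tau>"
    unfolding diff using \<tau> e by (subst sqnorm_affine_kernel) auto
  have "ksqnorm q (\<lambda>y. 1 * (e powr (-H) * incr_kernel t e y - h t * local_kernel t e y) +
      h t * (local_kernel t e y - affine_kernel q t e (truncated_base K) y)) \<le>
      ennreal (2 * 1\<^sup>2 * ((C * e powr \<alpha>)\<^sup>2 * D) + 2 * (h t)\<^sup>2 * \<tau>)"
    using 1 2 D \<tau> by (intro sqnorm_lincomb_le) auto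
  also have "\<dots> \<le> ennreal (2 * ((C * e powr \<alpha>)\<^sup>2 * D) + 2 * c\<^sup>2 * \<tau>)"
  proof (rule ennreal_leI)
    have "(h t)\<^sup>2 \<le> c\<^sup>2" using h_bound[OF t1] c by (simp add: abs_le_square_iff[symmetric])
    then have "2 * (h t)\<^sup>2 * \<tau> \<le> 2 * c\<^sup>2 * \<tau>" using \<tau> by (intro mult_right_mono) auto
    then show "2 * 1\<^sup>2 * ((C * e powr \<alpha>)\<^sup>2 * D) + 2 * (h t)\<^sup>2 * \<tau> \<le> 2 * ((C * e powr \<alpha>)\<^sup>2 * D) + 2 * c\<^sup>2 * \<tau>" by simp
  qed
  finally show ?thesis by (simp add: algebra_simps)
qed

text \<open>The extended integrand is 0 after 1, so only the point u = 1 could contribute. This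
  treats the last summand, whose increment starts at 1.\<close>

lemma incr_kernel_beyond: "t \<ge> 1 \<Longrightarrow> incr_kernel t e y = 0"
proof -
  assume t: "t \<ge> 1"
  have "(\<integral>u. (h0 u * indicator {t..<t + e} u) * kernel u y \<partial>lborel) = (\<integral>u. 0 \<partial>(lborel :: real measure))"
  proof (rule Bochner_Integration.integral_cong_AE)
    show "(\<lambda>u. (h0 u * indicator {t..<t + e} u) * kernel u y) \<in> borel_measurable lborel"
      unfolding kernel_eq by (intro borel_measurable_times borel_measurable_prod borel_measurable_pos_powr) auto
    show "AE u in lborel. (h0 u * indicator {t..<t + e} u) * kernel u y = 0"
      using AE_lborel_singleton[of 1]
      by eventually_elim (use t in \<open>auto simp: h0_def indicator_def\<close>)
  qed simp
  then show ?thesis by (simp add: incr_kernel_def)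
qed

end

section \<open>Comparison with uncorrelated summands and passage to the limit\<close>

context hermite_integral
begin

lemma has_wi_truncated:
  assumes e: "e > 0" and D: "ksqnorm q hermite_base \<le> ennreal D"
  shows "\<exists>Y. has_wi (affine_kernel q t e (truncated_base K)) Y"
    and "ksqnorm q (affine_kernel q t e (truncated_base K)) \<le> ennreal D"
proof -
  have "ksqnorm q (affine_kernel q t e (truncated_base K)) = ksqnorm q (truncated_base K)"
    by (rule sqnorm_affine_kernel[OF _ e]) measurable
  also have "\<dots> \<le> ksqnorm q hermite_base"
    by (intro sqnorm_mono_AE AE_I2 order_trans[OF abs_truncated_base_le abs_ge_self])
  also note D
  finally show le: "ksqnorm q (affine_kernel q t e (truncated_base K)) \<le> ennreal D" .
  show "\<exists>Y. has_wi (affine_kernel q t e (truncated_base K)) Y"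
    by (rule has_wi_square_integrable) (use le in \<open>auto intro: le_less_trans\<close>)
qed

text \<open>Rescaling the window (1 - K, 1] by e and shifting it by t gives (t + e - e K, t + e].
  Its length e K will be exactly the spacing of the grid, so windows of different indices do not
  overlap.\<close>

lemma truncated_support:
  assumes "e > 0" "affine_kernel q t e (truncated_base K) y \<noteq> 0"
  shows "\<forall>i<q. t + e - e * K < y i \<and> y i \<le> t + e"
proof -
  from assms(2) have "truncated_base K (\<lambda>i\<in>{..<q}. (y i - t) / e) \<noteq> 0" by (auto simp: affine_kernel_def)
  then have *: "\<forall>i<q. 1 - K < (y i - t) / e \<and> (y i - t) / e \<le> 1"
    by (auto simp: truncated_base_def split: if_splits)
  show ?thesis
  proof (intro allI impI)
    fix i assume "i < q"
    then have "1 - K < (y i - t) / e" "(y i - t) / e \<le> 1" using * by auto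
    then have "(1 - K) * e < y i - t" "y i - t \<le> e" using assms(1) by (simp_all add: field_simps)
    then show "t + e - e * K < y i \<and> y i \<le> t + e" by (simp add: algebra_simps)
  qed
qed

text \<open>
  The rescaled increments are compared with \<open>h t\<^sub>l Y\<^sub>l\<close>, where \<open>Y\<^sub>l\<close> only depends on the Brownian
  increments in \<open>(t\<^sub>l + e - 1/n, t\<^sub>l + e]\<close>; these intervals are disjoint, so that the \<open>Y\<^sub>l\<close> satisfy a
  law of large numbers.
\<close>

lemma power_variation_bound:
  assumes Z: "has_wi hermite_base Z" and p: "p \<ge> 2"
    and D: "ksqnorm q hermite_base \<le> ennreal D" "D \<ge> 0"
    and n: "n \<ge> 1" and e: "e > 0" "e \<le> 1 / real n" and K: "e * K = 1 / real n"
    and \<tau>: "ksqnorm q (\<lambda>y. hermite_base y - truncated_base K y) \<le> ennreal \<tau>" "\<tau> \<ge> 0"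
  defines "R \<equiv> (c\<^sup>2 + 1) * D"
    and "\<mu> \<equiv> \<integral>\<omega>. Z \<omega> ^ p \<partial>M"
    and "U \<equiv> \<lambda>l \<omega>. e powr (-H) * (X (real l / real n + e) \<omega> - X (real l / real n) \<omega>)"
  shows "\<And>l. l \<in> {1..n} \<Longrightarrow> integrable M (\<lambda>\<omega>. U l \<omega> ^ p)"
    and "(\<integral>\<omega>. \<bar>(\<Sum>l=1..n. U l \<omega> ^ p) / real n - \<mu> * J\<bar> \<partial>M) \<le>
      sqrt (power_diff_const p R * (2 * ((C * e powr \<alpha>)\<^sup>2 * D) + 2 * c\<^sup>2 * \<tau>)) +
      sqrt ((c ^ p)\<^sup>2 * (wi_const p * R ^ p) / real n) +
      c ^ p * sqrt (power_diff_const p R * \<tau>) +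
      \<bar>\<mu>\<bar> * \<bar>(\<Sum>l\<in>{1..<n}. h (real l / real n) ^ p) / real n - J\<bar>"
    (is ?bound)
proof -
  define t where "t l = real l / real n" for l :: nat
  define \<delta> where "\<delta> = 2 * ((C * e powr \<alpha>)\<^sup>2 * D) + 2 * c\<^sup>2 * \<tau>"
  \<comment> \<open>The index n is left out: its increment starts at 1, where h stops, so h(1) times
    an increment of the Hermite process would be the wrong comparison.\<close>
  define A where "A = {1..<n}"
  define fU where "fU l = (\<lambda>y. e powr (-H) * incr_kernel (t l) e y)" for l
  have n0: "real n > 0" using n by simp
  have p1: "p \<ge> 1" using p by simp
  \<comment> \<open>The number \<open>R\<close> bounds both the rescaled increments and their
    approximations, at most \<open>c\<^sup>2 * D\<close>, and the local kernels, at most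
    \<open>D\<close>.\<close>
  have R: "R \<ge> 0" "c\<^sup>2 * D \<le> R" "D \<le> R" using D by (auto simp: R_def algebra_simps)
  have \<delta>: "\<delta> \<ge> 0" using D \<tau> by (simp add: \<delta>_def)
  have t_pos: "t l > 0" if "l \<ge> 1" for l using that n0 by (simp add: t_def)
  have t_e: "t l + e \<le> 1" if "l \<in> A" for l
  proof -
    have "real l + 1 \<le> real n" using that by (auto simp: A_def)
    then have "(real l + 1) / real n \<le> 1" using n0 by simp
    then show ?thesis using e(2) by (simp add: t_def add_divide_distrib)
  qed
  have U: "has_wi (fU l) (U l)" if "l \<ge> 1" for l
    unfolding fU_def U_def t_def[symmetric] by (rule has_wi_cmult[OF has_wi_increment[OF t_pos[OF that] e(1)]])
  show int_U: "integrable M (\<lambda>\<omega>. U l \<omega> ^ p)" if "l \<in> {1..n}" for l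
    using has_wi_integrable_power(1)[OF U p1] that by simp
  have [measurable]: "U l \<in> borel_measurable M" if "l \<ge> 1" for l using has_wi_measurable(2)[OF U[OF that]] .
  have "\<forall>l. \<exists>Y. has_wi (affine_kernel q (t l) e (truncated_base K)) Y"
    using has_wi_truncated(1)[OF e(1) D(1)] by blast
  from choice[OF this] obtain Y where Y: "\<And>l. has_wi (affine_kernel q (t l) e (truncated_base K)) (Y l)" by blast
  have [measurable]: "Y l \<in> borel_measurable M" for l using has_wi_measurable(2)[OF Y] .
  have int_Y: "integrable M (\<lambda>\<omega>. Y l \<omega> ^ p)" for l by (rule has_wi_integrable_power(1)[OF Y p1])
  have h_le: "\<bar>h (t l) ^ p\<bar> \<le> c ^ p" if "l \<in> A" for l
  proof -
    have "t l \<in> {0..1}" using t_pos[of l] t_e[OF that] that e(1) by (auto simp: A_def)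
    from h_bound[OF this] show ?thesis unfolding power_abs by (intro power_mono) auto
  qed
  have sqU: "ksqnorm q (fU l) \<le> ennreal R" if "l \<in> A" for l
    using sqnorm_incr_kernel_le[OF _ e(1) D, of "t l"] t_pos[of l] that R(2) unfolding fU_def
    by (auto simp: A_def intro: order_trans ennreal_leI)
  have sqY: "ksqnorm q (affine_kernel q (t l) e (truncated_base K)) \<le> ennreal R" for l
    by (rule order_trans[OF has_wi_truncated(2)[OF e(1) D(1)] ennreal_leI[OF R(3)]])
  have sqL: "ksqnorm q (local_kernel (t l) e) \<le> ennreal R" for l
    unfolding sqnorm_local_kernel[OF e(1)] by (rule order_trans[OF D(1) ennreal_leI[OF R(3)]])
  have hY: "has_wi (\<lambda>y. h (t l) * affine_kernel q (t l) e (truncated_base K) y) (\<lambda>\<omega>. h (t l) * Y l \<omega>)" for l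
    by (rule has_wi_cmult[OF Y])
  have sqhY: "ksqnorm q (\<lambda>y. h (t l) * affine_kernel q (t l) e (truncated_base K) y) \<le> ennreal R" if "l \<in> A" for l
  proof -
    have tl: "t l \<in> {0..1}" using t_pos[of l] t_e[OF that] that e(1) by (auto simp: A_def)
    have "ksqnorm q (\<lambda>y. h (t l) * affine_kernel q (t l) e (truncated_base K) y) =
        ennreal ((h (t l))\<^sup>2) * ksqnorm q (affine_kernel q (t l) e (truncated_base K))"
      by (rule sqnorm_cmult) measurable
    also have "\<dots> \<le> ennreal (c\<^sup>2) * ennreal D"
      using h_bound[OF tl] c by (intro mult_mono ennreal_leI has_wi_truncated(2)[OF e(1) D(1)])
        (auto simp: abs_le_square_iff[symmetric])
    also have "\<dots> \<le> ennreal R" using R(2) D by (simp add: ennreal_mult[symmetric] ennreal_leI)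
    finally show ?thesis .
  qed
  have e1: "(\<integral>\<omega>. \<bar>U l \<omega> ^ p - h (t l) ^ p * Y l \<omega> ^ p\<bar> \<partial>M) \<le> sqrt (power_diff_const p R * \<delta>)" if l: "l \<in> A" for l
  proof -
    have l1: "l \<ge> 1" using l by (simp add: A_def)
    have "ksqnorm q (\<lambda>y. fU l y - h (t l) * affine_kernel q (t l) e (truncated_base K) y) \<le> ennreal \<delta>"
      unfolding fU_def \<delta>_def
      using t_pos[OF l1] t_e[OF l] by (intro sqnorm_incr_kernel_diff_le e D \<tau>) auto
    from has_wi_abs_power_diff_le(1)[OF U[OF l1] hY p R(1) sqU[OF l] sqhY[OF l] \<delta> this]
    show ?thesis by (simp add: power_mult_distrib)
  qed
  \<comment> \<open>The untruncated local kernel serves as intermediary: its integral has p-th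
    moment \<mu> exactly, and truncation shifts the moment by a controlled amount.\<close>
  have e2: "\<bar>(\<integral>\<omega>. Y l \<omega> ^ p \<partial>M) - \<mu>\<bar> \<le> sqrt (power_diff_const p R * \<tau>)" for l
  proof -
    obtain Z' where Z': "has_wi (local_kernel (t l) e) Z'"
      using has_wi_square_integrable[OF borel_measurable_affine_kernel[OF borel_measurable_hermite_base]
        le_less_trans[OF sqL]] by auto
    have diff: "(\<lambda>y. local_kernel (t l) e y - affine_kernel q (t l) e (truncated_base K) y) =
      affine_kernel q (t l) e (\<lambda>y. hermite_base y - truncated_base K y)"
      by (simp add: affine_kernel_def fun_eq_iff right_diff_distrib)
    have "ksqnorm q (\<lambda>y. local_kernel (t l) e y - affine_kernel q (t l) e (truncated_base K) y) \<le> ennreal \<tau>"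
      unfolding diff using \<tau> e by (subst sqnorm_affine_kernel) auto
    from has_wi_abs_power_diff_le(2)[OF Z' Y p R(1) sqL sqY \<tau>(2) this]
    show ?thesis using has_wi_affine_moment[OF Z Z' e(1) p] by (simp add: \<mu>_def abs_minus_commute)
  qed
  have e3: "(\<integral>\<omega>. \<bar>\<Sum>l\<in>A. h (t l) ^ p * (Y l \<omega> ^ p - (\<integral>\<omega>'. Y l \<omega>' ^ p \<partial>M))\<bar> \<partial>M) \<le>
      sqrt (real (card A) * ((c ^ p)\<^sup>2 * (wi_const p * R ^ p)))"
  proof (rule uncorrelated_sum_abs_le)
    show "sqnorm M (\<lambda>\<omega>. Y l \<omega> ^ p) \<le> ennreal (wi_const p * R ^ p)" for l
      by (rule has_wi_power_sqnorm_le[OF Y p1 sqY R(1)])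
    show "wi_const p * R ^ p \<ge> 0" using R wi_const_nonneg by simp
    have *: "(\<integral>\<omega>. Y l \<omega> ^ p * Y k \<omega> ^ p \<partial>M) = (\<integral>\<omega>. Y l \<omega> ^ p \<partial>M) * (\<integral>\<omega>. Y k \<omega> ^ p \<partial>M)" if "l < k" for l k
    proof (rule has_wi_disjoint_moment[OF Y Y p truncated_support[OF e(1)] truncated_support[OF e(1)]])
      have "real l + 1 \<le> real k" using that by simp
      then have "(real l + 1) / real n \<le> real k / real n" using n0 by (intro divide_right_mono) auto
      \<comment> \<open>Since e K = 1/n, the window of k begins at t_k + e - 1/n, which is t_l + e
        or later whenever l < k.\<close>
      then show "t l + e \<le> t k + e - e * K" unfolding K t_def by (simp add: add_divide_distrib)
    qed (use K n0 in auto)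
    show "(\<integral>\<omega>. Y l \<omega> ^ p * Y k \<omega> ^ p \<partial>M) = (\<integral>\<omega>. Y l \<omega> ^ p \<partial>M) * (\<integral>\<omega>. Y k \<omega> ^ p \<partial>M)" if "l \<noteq> k" for l k
      using *[of l k] *[of k l] that by (cases "l < k") (auto simp: mult.commute)
  qed (use h_le in \<open>auto simp: A_def\<close>)
  have e4: "(\<integral>\<omega>. \<bar>U n \<omega> ^ p\<bar> \<partial>M) \<le> 0"
  proof -
    have "fU n = (\<lambda>y. 0)" using n0 by (simp add: fU_def t_def incr_kernel_beyond)
    then have "ksqnorm q (fU n) \<le> ennreal 0" by (simp add: sqnorm_def)
    from has_wi_power_sqnorm_le[OF U[OF n] p1 this order_refl]
    have "sqnorm M (\<lambda>\<omega>. U n \<omega> ^ p) \<le> ennreal 0" using p1 by (simp add: power_0_left)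
    from sqnorm_bound_integrable(4)[OF _ this order_refl] show ?thesis using n by simp
  qed
  \<comment> \<open>\<open>T1\<close> collects the approximation of the increments,
    \<open>T2\<close> the fluctuation around the mean, \<open>T3\<close> the bias of the truncated
    moments and \<open>T4\<close> the error of the Riemann sum.\<close>
  define T1 where "T1 \<omega> = (\<Sum>l\<in>A. U l \<omega> ^ p - h (t l) ^ p * Y l \<omega> ^ p)" for \<omega>
  define T2 where "T2 \<omega> = (\<Sum>l\<in>A. h (t l) ^ p * (Y l \<omega> ^ p - (\<integral>\<omega>'. Y l \<omega>' ^ p \<partial>M)))" for \<omega>
  define T3 where "T3 = (\<Sum>l\<in>A. h (t l) ^ p * ((\<integral>\<omega>'. Y l \<omega>' ^ p \<partial>M) - \<mu>))"
  define T4 where "T4 = \<mu> * ((\<Sum>l\<in>A. h (t l) ^ p) / real n - J)"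
  have sum_split: "(\<Sum>l=1..n. U l \<omega> ^ p) = (\<Sum>l\<in>A. U l \<omega> ^ p) + U n \<omega> ^ p" for \<omega>
  proof -
    have "{1..n} = insert n A" "n \<notin> A" using n by (auto simp: A_def)
    then show ?thesis by (simp add: A_def add.commute)
  qed
  have decomposition: "(\<Sum>l=1..n. U l \<omega> ^ p) / real n - \<mu> * J = U n \<omega> ^ p / real n + T1 \<omega> / real n + T2 \<omega> / real n + T3 / real n + T4" for \<omega>
  proof -
    have "T1 \<omega> + T2 \<omega> + T3 = (\<Sum>l\<in>A. U l \<omega> ^ p - h (t l) ^ p * \<mu>)"
      unfolding T1_def T2_def T3_def sum.distrib[symmetric] by (intro sum.cong) (auto simp: algebra_simps)
    also have "\<dots> = (\<Sum>l\<in>A. U l \<omega> ^ p) - \<mu> * (\<Sum>l\<in>A. h (t l) ^ p)"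
      by (simp add: sum_subtractf sum_distrib_left mult.commute)
    finally have "(\<Sum>l\<in>A. U l \<omega> ^ p) = T1 \<omega> + T2 \<omega> + T3 + \<mu> * (\<Sum>l\<in>A. h (t l) ^ p)" by simp
    then show ?thesis unfolding sum_split T4_def by (simp add: add_divide_distrib algebra_simps)
  qed
  have A1: "l \<ge> 1" "l \<in> {1..n}" if "l \<in> A" for l using that by (auto simp: A_def)
  have int1: "integrable M (\<lambda>\<omega>. U l \<omega> ^ p - h (t l) ^ p * Y l \<omega> ^ p)" if "l \<in> A" for l
    using int_U[OF A1(2)[OF that]] int_Y by simp
  have intT: "integrable M T1" "integrable M T2" "integrable M (\<lambda>\<omega>. U n \<omega> ^ p)"
    unfolding T1_def[abs_def] T2_def[abs_def] using int1 int_Y int_U[of n] n by auto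
  have card_A: "real (card A) \<le> real n" by (simp add: A_def)
  have b1: "(\<integral>\<omega>. \<bar>T1 \<omega>\<bar> \<partial>M) \<le> real n * sqrt (power_diff_const p R * \<delta>)"
  proof -
    have "(\<integral>\<omega>. \<bar>T1 \<omega>\<bar> \<partial>M) \<le> (\<integral>\<omega>. (\<Sum>l\<in>A. \<bar>U l \<omega> ^ p - h (t l) ^ p * Y l \<omega> ^ p\<bar>) \<partial>M)"
      using intT int1 unfolding T1_def
      by (intro integral_mono integrable_abs Bochner_Integration.integrable_sum sum_abs) auto
    also have "\<dots> = (\<Sum>l\<in>A. \<integral>\<omega>. \<bar>U l \<omega> ^ p - h (t l) ^ p * Y l \<omega> ^ p\<bar> \<partial>M)"
      using int1 by (intro Bochner_Integration.integral_sum) auto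
    also have "\<dots> \<le> (\<Sum>l\<in>A. sqrt (power_diff_const p R * \<delta>))" by (rule sum_mono[OF e1])
    also have "\<dots> = real (card A) * sqrt (power_diff_const p R * \<delta>)" by simp
    also have "\<dots> \<le> real n * sqrt (power_diff_const p R * \<delta>)"
      using card_A \<delta> power_diff_const_nonneg[OF R(1)] by (intro mult_right_mono) auto
    finally show ?thesis .
  qed
  have b2: "(\<integral>\<omega>. \<bar>T2 \<omega>\<bar> \<partial>M) \<le> real n * sqrt ((c ^ p)\<^sup>2 * (wi_const p * R ^ p) / real n)"
  proof -
    have "(\<integral>\<omega>. \<bar>T2 \<omega>\<bar> \<partial>M) \<le> sqrt (real (card A) * ((c ^ p)\<^sup>2 * (wi_const p * R ^ p)))"
      using e3 by (simp add: T2_def)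
    also have "\<dots> \<le> sqrt (real n * ((c ^ p)\<^sup>2 * (wi_const p * R ^ p)))"
      using card_A R(1) wi_const_nonneg by (intro real_sqrt_le_mono mult_right_mono mult_nonneg_nonneg) auto
    \<comment> \<open>Moving n^2 under the root exhibits the bound as n times a quantity of order
      n^(-1/2), ready for division by n.\<close>
    also have "real n * ((c ^ p)\<^sup>2 * (wi_const p * R ^ p)) = (real n)\<^sup>2 * ((c ^ p)\<^sup>2 * (wi_const p * R ^ p) / real n)"
      using n0 by (simp add: power2_eq_square)
    also have "sqrt \<dots> = real n * sqrt ((c ^ p)\<^sup>2 * (wi_const p * R ^ p) / real n)"
      by (simp only: real_sqrt_mult real_sqrt_abs abs_of_nat)
    finally show ?thesis .
  qed
  have b3: "\<bar>T3\<bar> \<le> real n * (c ^ p * sqrt (power_diff_const p R * \<tau>))"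
  proof -
    have "\<bar>T3\<bar> \<le> (\<Sum>l\<in>A. \<bar>h (t l) ^ p * ((\<integral>\<omega>'. Y l \<omega>' ^ p \<partial>M) - \<mu>)\<bar>)"
      unfolding T3_def by (rule sum_abs)
    also have "\<dots> \<le> (\<Sum>l\<in>A. c ^ p * sqrt (power_diff_const p R * \<tau>))"
      unfolding abs_mult using h_le e2 c by (intro sum_mono mult_mono) auto
    also have "\<dots> = real (card A) * (c ^ p * sqrt (power_diff_const p R * \<tau>))" by simp
    also have "\<dots> \<le> real n * (c ^ p * sqrt (power_diff_const p R * \<tau>))"
      using card_A \<tau> c power_diff_const_nonneg[OF R(1)] by (intro mult_right_mono) auto
    finally show ?thesis .
  qed
  have "(\<integral>\<omega>. \<bar>(\<Sum>l=1..n. U l \<omega> ^ p) / real n - \<mu> * J\<bar> \<partial>M) \<le>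
      (\<integral>\<omega>. \<bar>U n \<omega> ^ p\<bar> / real n + \<bar>T1 \<omega>\<bar> / real n + \<bar>T2 \<omega>\<bar> / real n + (\<bar>T3\<bar> / real n + \<bar>T4\<bar>) \<partial>M)"
    unfolding decomposition
  proof (rule integral_mono)
    show "integrable M (\<lambda>\<omega>. \<bar>U n \<omega> ^ p / real n + T1 \<omega> / real n + T2 \<omega> / real n + T3 / real n + T4\<bar>)"
      "integrable M (\<lambda>\<omega>. \<bar>U n \<omega> ^ p\<bar> / real n + \<bar>T1 \<omega>\<bar> / real n + \<bar>T2 \<omega>\<bar> / real n + (\<bar>T3\<bar> / real n + \<bar>T4\<bar>))"
      using intT by auto
    fix \<omega>
    have "\<bar>x / real n\<bar> = \<bar>x\<bar> / real n" for x using n0 by simp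
    then show "\<bar>U n \<omega> ^ p / real n + T1 \<omega> / real n + T2 \<omega> / real n + T3 / real n + T4\<bar> \<le>
      \<bar>U n \<omega> ^ p\<bar> / real n + \<bar>T1 \<omega>\<bar> / real n + \<bar>T2 \<omega>\<bar> / real n + (\<bar>T3\<bar> / real n + \<bar>T4\<bar>)"
      by (smt (verit) abs_triangle_ineq)
  qed
  also have "\<dots> = (\<integral>\<omega>. \<bar>U n \<omega> ^ p\<bar> \<partial>M) / real n + (\<integral>\<omega>. \<bar>T1 \<omega>\<bar> \<partial>M) / real n + (\<integral>\<omega>. \<bar>T2 \<omega>\<bar> \<partial>M) / real n + (\<bar>T3\<bar> / real n + \<bar>T4\<bar>)"
    using intT by (simp add: prob_space)
  also have "\<dots> \<le> 0 / real n + (real n * sqrt (power_diff_const p R * \<delta>)) / real n +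
      (real n * sqrt ((c ^ p)\<^sup>2 * (wi_const p * R ^ p) / real n)) / real n +
      ((real n * (c ^ p * sqrt (power_diff_const p R * \<tau>))) / real n + \<bar>T4\<bar>)"
    using e4 b1 b2 b3 n0 by (intro add_mono divide_right_mono order_refl) auto
  also have "\<dots> = sqrt (power_diff_const p R * \<delta>) + sqrt ((c ^ p)\<^sup>2 * (wi_const p * R ^ p) / real n) +
      c ^ p * sqrt (power_diff_const p R * \<tau>) + \<bar>T4\<bar>"
    using n0 by simp
  also have "\<bar>T4\<bar> = \<bar>\<mu>\<bar> * \<bar>(\<Sum>l\<in>{1..<n}. h (real l / real n) ^ p) / real n - J\<bar>"
    by (simp add: T4_def abs_mult A_def t_def)
  finally show ?bound
    by (simp add: \<delta>_def)
qed

lemma power_variation_eq: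
  "power_variation \<gamma> H p X N \<omega> =
    (\<Sum>l=1..2 ^ mesh_exponent \<gamma> N. ((1 / 2 ^ N) powr (-H) *
      (X (real l / real (2 ^ mesh_exponent \<gamma> N) + 1 / 2 ^ N) \<omega> - X (real l / real (2 ^ mesh_exponent \<gamma> N)) \<omega>)) ^ p) /
    real (2 ^ mesh_exponent \<gamma> N)"
proof -
  have "(1 / 2 ^ N :: real) powr (-H) = 2 powr (H * real N)"
    by (simp add: powr_minus_divide powr_divide powr_realpow[symmetric] powr_powr mult.commute)
  moreover have "(2 powr (H * real N)) ^ p = 2 powr (real p * H * real N)"
    by (simp add: powr_power mult_ac)
  ultimately show ?thesis
    by (simp add: power_variation_def increment_def power_mult_distrib sum_distrib_left sum_divide_distrib)
qed

lemma power_variation_tendsto: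
  assumes Z: "has_wi hermite_base Z" and p: "p \<ge> 2" and \<gamma>: "0 < \<gamma>" "\<gamma> < 1"
  shows "(\<forall>N\<ge>1. integrable M (power_variation \<gamma> H p X N)) \<and>
    (\<lambda>N. LINT \<omega>|M. \<bar>power_variation \<gamma> H p X N \<omega> -
        (\<integral>\<omega>'. Z \<omega>' ^ p \<partial>M) * (LINT s:{0..1}|lborel. h s ^ p)\<bar>) \<longlonglongrightarrow> 0"
proof -
  define \<mu> where "\<mu> = (\<integral>\<omega>'. Z \<omega>' ^ p \<partial>M)"
  define J where "J = (LINT s:{0..1}|lborel. h s ^ p)"
  define n :: "nat \<Rightarrow> nat" where "n N = 2 ^ mesh_exponent \<gamma> N" for N
  define e :: "nat \<Rightarrow> real" where "e N = 1 / 2 ^ N" for N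
  \<comment> \<open>The ratio of mesh to increment length is the largest window for which the
    truncated kernels of neighbouring indices have disjoint supports.\<close>
  define K :: "nat \<Rightarrow> real" where "K N = 2 ^ N / 2 ^ mesh_exponent \<gamma> N" for N
  define \<tau> where "\<tau> N = enn2real (ksqnorm q (\<lambda>y. hermite_base y - truncated_base (K N) y))" for N
  obtain D where D: "D \<ge> 0" "ksqnorm q hermite_base \<le> ennreal D" by (rule has_wi_sqnorm_finite[OF Z])
  define R where "R = (c\<^sup>2 + 1) * D"
  define U where "U N l \<omega> = e N powr (-H) * (X (real l / real (n N) + e N) \<omega> - X (real l / real (n N)) \<omega>)" for N l \<omega>
  have pv: "power_variation \<gamma> H p X N \<omega> = (\<Sum>l=1..n N. U N l \<omega> ^ p) / real (n N)" for N \<omega>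
    unfolding power_variation_eq n_def U_def e_def ..
  have sq_fin: "ksqnorm q (\<lambda>y. hermite_base y - truncated_base K' y) < \<infinity>" for K'
  proof -
    have "ksqnorm q (\<lambda>y. hermite_base y - truncated_base K' y) \<le> ksqnorm q hermite_base"
      using hermite_base_nonneg by (intro sqnorm_mono_AE AE_I2) (auto simp: truncated_base_def)
    also note D(2)
    finally show ?thesis by (rule le_less_trans) simp
  qed
  have \<tau>: "ksqnorm q (\<lambda>y. hermite_base y - truncated_base (K N) y) \<le> ennreal (\<tau> N)" "\<tau> N \<ge> 0" for N
    using sq_fin[of "K N"] by (auto simp: \<tau>_def)
  have \<tau>_lim: "\<tau> \<longlonglongrightarrow> 0"
  proof -
    have "(\<lambda>N. ksqnorm q (\<lambda>y. hermite_base y - truncated_base (K N) y)) \<longlonglongrightarrow> 0"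
      unfolding K_def by (rule truncated_base_tendsto[OF filterlim_scale_ratio[OF \<gamma>]])
    then have "(\<lambda>N. enn2real (ksqnorm q (\<lambda>y. hermite_base y - truncated_base (K N) y))) \<longlonglongrightarrow> enn2real 0"
      by (intro tendsto_enn2real) auto
    then show ?thesis by (simp add: \<tau>_def[abs_def])
  qed
  have n1: "n N \<ge> 1" for N by (simp add: n_def)
  have e: "e N > 0" for N by (simp add: e_def)
  have eK: "e N * K N = 1 / real (n N)" for N by (simp add: e_def K_def n_def)
  \<comment> \<open>For N \<ge> 1 one has N^\<gamma> \<le> N, so an increment is not longer than a
    mesh interval; at l = n - 1 it ends at 1 at the latest.\<close>
  have e_le: "e N \<le> 1 / real (n N)" if "N \<ge> 1" for N
  proof -
    have "real N powr \<gamma> \<le> real N powr 1" using that \<gamma> by (intro powr_mono) auto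
    then have "mesh_exponent \<gamma> N \<le> N" using mesh_exponent_le[of \<gamma> N] that by simp
    then show ?thesis unfolding e_def n_def by (simp add: frac_le)
  qed
  note bound = power_variation_bound[OF Z p D(2,1) n1 e e_le eK \<tau>, folded R_def \<mu>_def U_def]
  have "integrable M (power_variation \<gamma> H p X N)" if "N \<ge> 1" for N
    unfolding pv[abs_def]
    by (intro integrable_divide Bochner_Integration.integrable_sum bound(1)[OF that])
  moreover have "(\<lambda>N. LINT \<omega>|M. \<bar>power_variation \<gamma> H p X N \<omega> - \<mu> * J\<bar>) \<longlonglongrightarrow> 0"
  proof (rule Lim_null_comparison)
    let ?b = "\<lambda>N. sqrt (power_diff_const p R * (2 * ((C * e N powr \<alpha>)\<^sup>2 * D) + 2 * c\<^sup>2 * \<tau> N)) +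
      sqrt ((c ^ p)\<^sup>2 * (wi_const p * R ^ p) / real (n N)) +
      c ^ p * sqrt (power_diff_const p R * \<tau> N) +
      \<bar>\<mu>\<bar> * \<bar>(\<Sum>l\<in>{1..<n N}. h (real l / real (n N)) ^ p) / real (n N) - J\<bar>"
    show "\<forall>\<^sub>F N in sequentially. norm (LINT \<omega>|M. \<bar>power_variation \<gamma> H p X N \<omega> - \<mu> * J\<bar>) \<le> ?b N"
      using eventually_ge_at_top[of 1]
    proof eventually_elim
      case (elim N)
      have "norm (LINT \<omega>|M. \<bar>power_variation \<gamma> H p X N \<omega> - \<mu> * J\<bar>) = (LINT \<omega>|M. \<bar>power_variation \<gamma> H p X N \<omega> - \<mu> * J\<bar>)"
        by simp
      also have "\<dots> \<le> ?b N" unfolding pv by (rule bound(2)[OF elim])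
      finally show ?case .
    qed
    have n_top: "filterlim n at_top sequentially"
    proof (rule filterlim_at_top_mono[OF filterlim_mesh_exponent[OF \<gamma>(1)]], intro always_eventually allI)
      show "mesh_exponent \<gamma> N \<le> n N" for N
        unfolding n_def by (rule less_imp_le) (rule less_exp)
    qed
    have rn_top: "filterlim (\<lambda>N. real (n N)) at_top sequentially"
      by (rule filterlim_compose[OF filterlim_real_sequentially n_top])
    have e_lim: "(\<lambda>N. e N powr \<alpha>) \<longlonglongrightarrow> 0"
    proof -
      have "(\<lambda>N. (1 / 2 :: real) ^ N) \<longlonglongrightarrow> 0" by (rule LIMSEQ_power_zero) simp
      then have "e \<longlonglongrightarrow> 0" by (simp add: e_def[abs_def] power_one_over)
      then have "(\<lambda>N. e N powr \<alpha>) \<longlonglongrightarrow> 0 powr \<alpha>"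
        using \<alpha> by (intro tendsto_powr') (auto simp: less_imp_le[OF e])
      then show ?thesis by simp
    qed
    have inv_n: "(\<lambda>N. a / real (n N)) \<longlonglongrightarrow> 0" for a :: real
      by (rule real_tendsto_divide_at_top[OF tendsto_const rn_top])
    \<comment> \<open>The sum without its last term differs from the Riemann sum by h(1)^p / n,
      which vanishes in the limit.\<close>
    have riemann: "(\<lambda>N. (\<Sum>l\<in>{1..<n N}. h (real l / real (n N)) ^ p) / real (n N)) \<longlonglongrightarrow> J"
    proof -
      have "(\<lambda>k. (\<Sum>l=1..k. h (real l / real k) ^ p) / real k) \<longlonglongrightarrow> J"
        unfolding J_def by (rule riemann_sum_tendsto) (intro continuous_intros h_cont)
      from filterlim_compose[OF this n_top]
      have "(\<lambda>N. (\<Sum>l=1..n N. h (real l / real (n N)) ^ p) / real (n N) - h 1 ^ p / real (n N)) \<longlonglongrightarrow> J - 0"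
        by (intro tendsto_diff inv_n)
      moreover have "(\<Sum>l=1..n N. h (real l / real (n N)) ^ p) / real (n N) - h 1 ^ p / real (n N) =
          (\<Sum>l\<in>{1..<n N}. h (real l / real (n N)) ^ p) / real (n N)" for N
      proof -
        have "{1..n N} = insert (n N) {1..<n N}" using n1[of N] by auto
        then show ?thesis using n1[of N] by (simp add: add_divide_distrib)
      qed
      ultimately show ?thesis by simp
    qed
    have "?b \<longlonglongrightarrow> sqrt (power_diff_const p R * (2 * ((C * 0)\<^sup>2 * D) + 2 * c\<^sup>2 * 0)) + sqrt 0 +
      c ^ p * sqrt (power_diff_const p R * 0) + \<bar>\<mu>\<bar> * \<bar>J - J\<bar>"
      by (intro tendsto_intros e_lim \<tau>_lim inv_n riemann)
    then show "?b \<longlonglongrightarrow> 0" by simp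
  qed
  ultimately show ?thesis by (simp add: \<mu>_def J_def)
qed

end

theorem proposition4:
  fixes M :: "'a measure" and B Z X :: "real \<Rightarrow> 'a \<Rightarrow> real"
    and q p :: nat and H d \<gamma> \<alpha> x0 :: real and h :: "real \<Rightarrow> real"
  assumes "two_sided_brownian_motion M B"
    and "q \<ge> 1" and "1 / 2 < H" and "H < 1"
    and "d > 0"
    and "hermite_process M B q H d Z"
    and "\<And>t. t \<ge> 0 \<Longrightarrow> (LINT \<omega>|M. (Z t \<omega>)\<^sup>2) = t powr (2 * H)"
    and "0 < \<gamma>" and "\<gamma> < 1"
    and "0 < \<alpha>" and "\<alpha> < 1"
    and "bounded (h ` {0..1})"
    and "holder_continuous_on \<alpha> {0..1} h"
    and "\<And>t. t \<ge> 0 \<Longrightarrow> X t \<in> borel_measurable M"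
    and "\<And>t. t \<ge> 0 \<Longrightarrow> AE \<omega> in M. X t \<omega> = x0 +
           wiener_hermite_integral M B q H d
             (\<lambda>s. indicator {0..1} s * h s * indicator {0<..<t} s) \<omega>"
    and "p \<ge> 2"
  shows "(\<forall>N\<ge>1. integrable M (power_variation \<gamma> H p X N)) \<and>
    (\<lambda>N. LINT \<omega>|M. \<bar>power_variation \<gamma> H p X N \<omega> -
        (LINT \<omega>'|M. Z 1 \<omega>' ^ p) * (LINT s:{0..1}|lborel. h s ^ p)\<bar>) \<longlonglongrightarrow> 0"
proof -
  obtain c0 where c0: "\<And>s. s \<in> {0..1} \<Longrightarrow> \<bar>h s\<bar> \<le> c0"
  proof -
    from assms(12) obtain a where "\<forall>x\<in>h ` {0..1}. norm x \<le> a" unfolding bounded_iff by blast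
    then show ?thesis by (intro that[of a]) auto
  qed
  obtain C0 where C0: "\<And>s t. s \<in> {0..1} \<Longrightarrow> t \<in> {0..1} \<Longrightarrow> \<bar>h s - h t\<bar> \<le> C0 * \<bar>s - t\<bar> powr \<alpha>"
    using assms(13) unfolding holder_continuous_on_def by blast
  have C0': "\<bar>h s - h t\<bar> \<le> \<bar>C0\<bar> * \<bar>s - t\<bar> powr \<alpha>" if "s \<in> {0..1}" "t \<in> {0..1}" for s t
    by (rule order_trans[OF C0[OF that]]) (auto intro: mult_right_mono)
  \<comment> \<open>Absolute values supply the nonnegative constants that the estimates use; a
    Hoelder constant as obtained may be negative when h is constant.\<close>
  interpret hermite_integral M B q H d h X x0 "\<bar>C0\<bar>" "\<bar>c0\<bar>" \<alpha>
  proof unfold_locales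
    show "continuous_on {0..1} h" by (rule holder_continuous_on_imp_continuous_on[OF assms(13,10)])
    show "\<bar>h s\<bar> \<le> \<bar>c0\<bar>" if "s \<in> {0..1}" for s using c0[OF that] by simp
  qed (use assms C0' in auto)
  \<comment> \<open>At time 1 the kernel of the Hermite process is \<open>hermite_base\<close>, so
    \<open>Z 1\<close> is a version of its integral and the limiting moment is that of
    \<open>Z 1\<close>.\<close>
  have "has_wi hermite_base (wiener_ito_integral M B q hermite_base)"
    by (rule has_wi_version[OF borel_measurable_hermite_base sqnorm_hermite_base])
  moreover have "Z 1 \<in> borel_measurable M" "AE \<omega> in M. Z 1 \<omega> = wiener_ito_integral M B q hermite_base \<omega>"
    using assms(6) by (auto simp: hermite_process_def hermite_base_def[abs_def])
  ultimately have "has_wi hermite_base (Z 1)"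
    by (elim has_wi_cong_AE) (auto elim: eventually_mono)
  from power_variation_tendsto[OF this assms(16,8,9)] show ?thesis .
qed

end
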